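(* Let $k$ be a unital commutative ring and let $A$ be an augmented, commutative $k$-algebra with augmentation ideal $I$. There is a surjective map of chain complexes \[\Phi\circ q\colon NCS_{\star}(I)\rightarrow NC\Gamma_{\star}(I,k),\] where $q$ is the quotient map $NCS_\star(I)\to\overline{NCS_\star(I)}$ and $\Phi\colon\overline{NCS_\star(I)}\to NC\Gamma_\star(I,k)$ is the map forgetting the orderings on fibres (both defined in the context).
   Context: All tensor products are over $k$. $A$ is augmented by a $k$-algebra homomorphism $\varepsilon\colon A\to k$, $I=\mathrm{Ker}(\varepsilon)$, and $k$ is a symmetric $A$-bimodule via $\varepsilon$. For a simplicial $k$-module, the normalized chain complex (prefix $N$) is the associated chain complex (alternating sum of faces) modulo the subcomplex generated by images of degeneracies. Category $\Delta S$: objects $\underline{n}=\{1,\dots,n\}$, $n\geqslant1$; a morphism $\underline{n}\to\underline{m}$ is a pair $(\phi,g)$ with $g\in\Sigma_n$ and $\phi\colon\underline{n}\to\underline{m}$ order-preserving. The composite of $(\phi,g)\colon\underline n\to\underline m$ and $(\psi,h)\colon\underline m\to\underline l$ is $(\psi\circ h_\star(\phi),\phi^\star(h)\circ g)$, where $h_\star(\phi)$ is the order-preserving map and $\phi^\star(h)\in\Sigma_n$ the permutation, order-preserving on each fibre of $\phi$, uniquely determined by $h\circ\phi=h_\star(\phi)\circ\phi^\star(h)$ as maps of sets. Equivalently, a morphism is a map of sets (namely $\phi\circ g$) with a total ordering on each fibre (that of $g$). $\mathrm{Epi}\Delta S$ is the subcategory of all objects and the epimorphisms (those with $\phi$ surjective).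 The functor $B_I^{sym}\colon\mathrm{Epi}\Delta S\to k\text{-Mod}$ has $B_I^{sym}(\underline n)=I^{\otimes n}$ and $(\phi,g)$ sends $a_1\otimes\cdots\otimes a_n$ to the tensor whose $j$-th factor is $\prod_{i\in\phi^{-1}(j)}a_{g^{-1}(i)}$ (product in increasing order of $i$). $CS_\star(I)=C_\star(\mathrm{Epi}\Delta S,B_I^{sym})$ is the simplicial $k$-module (and its chain complex) with $CS_n(I)=\bigoplus_{(f_n,\dots,f_1)}B_I^{sym}(\underline{x})$, the sum over strings $\underline{x}\xrightarrow{f_1}\underline{x_1}\to\cdots\xrightarrow{f_n}\underline{x_n}$ of composable morphisms in $\mathrm{Epi}\Delta S$ (objects if $n=0$), with faces $\partial_0(f_n,\dots,f_1,y)=(f_n,\dots,f_2,B_I^{sym}(f_1)(y))$, $\partial_i(f_n,\dots,f_1,y)=(f_n,\dots,f_{i+1}\circ f_i,\dots,f_1,y)$ for $1\leqslant i\leqslant n-1$, $\partial_n(f_n,\dots,f_1,y)=(f_{n-1},\dots,f_1,y)$, and degeneracies inserting identities. $NCS_\star(I)$ is its normalized complex. $NCS^1_\star(I)\subseteq NCS_\star(I)$ is the subcomplex generated by classes of strings with final object $\underline{x_n}\neq\underline{1}$; $\overline{NCS_\star(I)}=NCS_\star(I)/NCS_\star^1(I)$ and $q$ is the quotient map. Let $\Omega$ be the category with objects $\underline{n}$, $n\geqslant1$, and morphisms surjections; $N\Omega_n(\underline x,\underline1)$ is the set of strings $[f_n\mid\cdots\mid f_1]$ of composable morphisms $\underline{x}\xrightarrow{f_1}\underline{x_1}\to\cdots\to\underline{x_{n-1}}\xrightarrow{f_n}\underline{1}$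 in $\Omega$. For $i\in\underline{x_{n-1}}$, the $i$-th component $[f^i_{n-1}\mid\cdots\mid f_1^i]$ is obtained by restricting to iterated preimages of $i$ and re-indexing order-preservingly, with final codomain $\underline 1$. $C\Gamma_\star(I,k)$ is the simplicial $k$-module (and its chain complex) with $C\Gamma_n(I,k)=\bigoplus_{x\geqslant1}k[N\Omega_n(\underline x,\underline1)]\otimes I^{\otimes x}\otimes k$ (so $C\Gamma_0(I,k)=I\otimes k$), whose faces on $X=[f_n\mid\cdots\mid f_1]\otimes(y_1\otimes\cdots\otimes y_x)\otimes\lambda$ are: $\partial_0X=[f_n\mid\cdots\mid f_2]\otimes f_{1\star}(y_1\otimes\cdots\otimes y_x)\otimes\lambda$, where $f_{1\star}$ multiplies together the factors in each fibre of $f_1$; $\partial_jX=[f_n\mid\cdots\mid f_{j+1}\circ f_j\mid\cdots\mid f_1]\otimes(y_1\otimes\cdots\otimes y_x)\otimes\lambda$ for $1\leqslant j\leqslant n-1$; $\partial_nX=\sum_{i\in\underline{x_{n-1}}}[f_{n-1}^i\mid\cdots\mid f_1^i]\otimes(y_{i_1}\otimes\cdots\otimes y_{i_r})\otimes\big(\prod_{j\notin\{i_1,\dots,i_r\}}y_j\big)\lambda$, where $\{i_1<\cdots<i_r\}=(f_{n-1}\circ\cdots\circ f_1)^{-1}(i)$ and $A$ acts on $k$ via $\varepsilon$; degeneracies insert identities. $NC\Gamma_\star(I,k)$ is its normalized complex. Let $U\colon\mathrm{Epi}\Delta S\to\Omega$ be the identity on objects and send a morphism to its underlying surjection. $\Phi_n\colon\overline{NCS_n(I)}\to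 NC\Gamma_n(I,k)$ is determined by $[(f_n,\dots,f_1),(y_1\otimes\cdots\otimes y_x)]\mapsto[[U(f_n)\mid\cdots\mid U(f_1)]\otimes(y_1\otimes\cdots\otimes y_x)\otimes1_k]$. *)

theory Defs
  imports "HOL-Combinatorics.Permutations" "HOL-Algebra.Module" "HOL-Algebra.AbelCoset"
begin

section \<open>Modules over a commutative ring\<close>

definition mod_hom :: "'k ring \<Rightarrow> ('k,'m) module \<Rightarrow> ('k,'n) module \<Rightarrow> ('m \<Rightarrow> 'n) set" where
  "mod_hom k M N = {h \<in> hom (add_monoid M) (add_monoid N).
     \<forall>r\<in>carrier k. \<forall>x\<in>carrier M. h (r \<odot>\<^bsub>M\<^esub> x) = r \<odot>\<^bsub>N\<^esub> h x}"

text \<open>The linear map \<open>M \<rightarrow> N\<close> sending the generator \<open>e j\<close> to \<open>v j\<close> for all \<open>j \<in> J\<close>. It is only used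
  for families \<open>e\<close> that generate \<open>M\<close>, so there is at most one such map on the carrier of \<open>M\<close>;
  \<open>extensional\<close> fixes the irrelevant values outside it.\<close>

definition is_lin_ext ::
  "'k ring \<Rightarrow> ('k,'m) module \<Rightarrow> ('k,'n) module \<Rightarrow> 'j set \<Rightarrow> ('j \<Rightarrow> 'm) \<Rightarrow> ('j \<Rightarrow> 'n) \<Rightarrow> ('m \<Rightarrow> 'n) \<Rightarrow> bool"
  where "is_lin_ext k M N J e v h \<longleftrightarrow>
    h \<in> mod_hom k M N \<and> h \<in> extensional (carrier M) \<and> (\<forall>j\<in>J. h (e j) = v j)"

definition lin_ext ::
  "'k ring \<Rightarrow> ('k,'m) module \<Rightarrow> ('k,'n) module \<Rightarrow> 'j set \<Rightarrow> ('j \<Rightarrow> 'm) \<Rightarrow> ('j \<Rightarrow> 'n) \<Rightarrow> 'm \<Rightarrow> 'n"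
  where "lin_ext k M N J e v = (THE h. is_lin_ext k M N J e v h)"

definition submod_gen :: "'k ring \<Rightarrow> ('k,'m) module \<Rightarrow> 'm set \<Rightarrow> 'm set" where
  "submod_gen k M S = \<Inter>{H. submodule H k M \<and> S \<subseteq> H}"

text \<open>Module records inherit the fields \<open>mult\<close> and \<open>one\<close> from rings; they play no role for modules
  and are left undefined below.\<close>

definition quot_mod :: "('k,'m) module \<Rightarrow> 'm set \<Rightarrow> ('k,'m set) module" where
  "quot_mod M H = \<lparr>carrier = a_rcosets\<^bsub>M\<^esub> H, mult = undefined, one = undefined,
     zero = H, add = set_add M, smult = (\<lambda>r Z. \<Union>x\<in>Z. H +>\<^bsub>M\<^esub> (r \<odot>\<^bsub>M\<^esub> x))\<rparr>"

definition dsum :: "'x set \<Rightarrow> ('x \<Rightarrow> ('k,'m) module) \<Rightarrow> ('k,'x \<Rightarrow> 'm) module" where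
  "dsum Z M = \<lparr>carrier = {c \<in> (\<Pi>\<^sub>E x\<in>Z. carrier (M x)). finite {x\<in>Z. c x \<noteq> \<zero>\<^bsub>M x\<^esub>}},
     mult = undefined, one = undefined,
     zero = (\<lambda>x\<in>Z. \<zero>\<^bsub>M x\<^esub>), add = (\<lambda>c d. \<lambda>x\<in>Z. c x \<oplus>\<^bsub>M x\<^esub> d x),
     smult = (\<lambda>r c. \<lambda>x\<in>Z. r \<odot>\<^bsub>M x\<^esub> c x)\<rparr>"

definition dincl :: "'x set \<Rightarrow> ('x \<Rightarrow> ('k,'m) module) \<Rightarrow> 'x \<Rightarrow> 'm \<Rightarrow> 'x \<Rightarrow> 'm" where
  "dincl Z M x m = (\<lambda>z\<in>Z. if z = x then m else \<zero>\<^bsub>M z\<^esub>)"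

definition reg_mod :: "'k ring \<Rightarrow> ('k,'k) module" where
  "reg_mod k = \<lparr>carrier = carrier k, mult = (\<otimes>\<^bsub>k\<^esub>), one = one k,
     zero = zero k, add = add k, smult = (\<otimes>\<^bsub>k\<^esub>)\<rparr>"

definition free_mod :: "'k ring \<Rightarrow> 'x set \<Rightarrow> ('k,'x \<Rightarrow> 'k) module" where
  "free_mod k Z = dsum Z (\<lambda>_. reg_mod k)"

definition basis_elt :: "'k ring \<Rightarrow> 'x set \<Rightarrow> 'x \<Rightarrow> 'x \<Rightarrow> 'k" where
  "basis_elt k Z x = dincl Z (\<lambda>_. reg_mod k) x \<one>\<^bsub>k\<^esub>"

subsection \<open>Tensor products\<close>

definition tens_rels :: "'k ring \<Rightarrow> ('k,'m) module \<Rightarrow> ('k,'n) module \<Rightarrow> ('m \<times> 'n \<Rightarrow> 'k) set" where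
  "tens_rels k M N =
    (let P = carrier M \<times> carrier N; F = free_mod k P; b = basis_elt k P in
      {b (x \<oplus>\<^bsub>M\<^esub> x', y) \<ominus>\<^bsub>F\<^esub> (b (x, y) \<oplus>\<^bsub>F\<^esub> b (x', y)) |x x' y.
          x \<in> carrier M \<and> x' \<in> carrier M \<and> y \<in> carrier N} \<union>
      {b (x, y \<oplus>\<^bsub>N\<^esub> y') \<ominus>\<^bsub>F\<^esub> (b (x, y) \<oplus>\<^bsub>F\<^esub> b (x, y')) |x y y'.
          x \<in> carrier M \<and> y \<in> carrier N \<and> y' \<in> carrier N} \<union>
      {b (r \<odot>\<^bsub>M\<^esub> x, y) \<ominus>\<^bsub>F\<^esub> (r \<odot>\<^bsub>F\<^esub> b (x, y)) |r x y.
          r \<in> carrier k \<and> x \<in> carrier M \<and> y \<in> carrier N} \<union>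
      {b (x, r \<odot>\<^bsub>N\<^esub> y) \<ominus>\<^bsub>F\<^esub> (r \<odot>\<^bsub>F\<^esub> b (x, y)) |r x y.
          r \<in> carrier k \<and> x \<in> carrier M \<and> y \<in> carrier N})"

definition tens_sub :: "'k ring \<Rightarrow> ('k,'m) module \<Rightarrow> ('k,'n) module \<Rightarrow> ('m \<times> 'n \<Rightarrow> 'k) set" where
  "tens_sub k M N = submod_gen k (free_mod k (carrier M \<times> carrier N)) (tens_rels k M N)"

definition tens_mod :: "'k ring \<Rightarrow> ('k,'m) module \<Rightarrow> ('k,'n) module \<Rightarrow> ('k, ('m \<times> 'n \<Rightarrow> 'k) set) module"
  where "tens_mod k M N = quot_mod (free_mod k (carrier M \<times> carrier N)) (tens_sub k M N)"

definition tens :: "'k ring \<Rightarrow> ('k,'m) module \<Rightarrow> ('k,'n) module \<Rightarrow> 'm \<Rightarrow> 'n \<Rightarrow> ('m \<times> 'n \<Rightarrow> 'k) set" where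
  "tens k M N x y = tens_sub k M N
     +>\<^bsub>free_mod k (carrier M \<times> carrier N)\<^esub> basis_elt k (carrier M \<times> carrier N) (x, y)"

text \<open>The \<open>n\<close>-fold tensor power: the free module on the \<open>n\<close>-tuples \<open>(y\<^sub>1,\<dots>,y\<^sub>n)\<close>, which are functions
  on \<open>{1..n}\<close>, modulo multilinearity.\<close>

definition tuples :: "nat \<Rightarrow> ('k,'m) module \<Rightarrow> (nat \<Rightarrow> 'm) set" where
  "tuples n M = {1..n} \<rightarrow>\<^sub>E carrier M"

definition tpow_rels :: "'k ring \<Rightarrow> ('k,'m) module \<Rightarrow> nat \<Rightarrow> ((nat \<Rightarrow> 'm) \<Rightarrow> 'k) set" where
  "tpow_rels k M n =
    (let P = tuples n M; F = free_mod k P; b = basis_elt k P in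
      {b (y(i := u \<oplus>\<^bsub>M\<^esub> v)) \<ominus>\<^bsub>F\<^esub> (b (y(i := u)) \<oplus>\<^bsub>F\<^esub> b (y(i := v))) |y i u v.
          y \<in> P \<and> i \<in> {1..n} \<and> u \<in> carrier M \<and> v \<in> carrier M} \<union>
      {b (y(i := r \<odot>\<^bsub>M\<^esub> u)) \<ominus>\<^bsub>F\<^esub> (r \<odot>\<^bsub>F\<^esub> b (y(i := u))) |y i r u.
          y \<in> P \<and> i \<in> {1..n} \<and> r \<in> carrier k \<and> u \<in> carrier M})"

definition tpow_sub :: "'k ring \<Rightarrow> ('k,'m) module \<Rightarrow> nat \<Rightarrow> ((nat \<Rightarrow> 'm) \<Rightarrow> 'k) set" where
  "tpow_sub k M n = submod_gen k (free_mod k (tuples n M)) (tpow_rels k M n)"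

definition tpow :: "'k ring \<Rightarrow> ('k,'m) module \<Rightarrow> nat \<Rightarrow> ('k, ((nat \<Rightarrow> 'm) \<Rightarrow> 'k) set) module" where
  "tpow k M n = quot_mod (free_mod k (tuples n M)) (tpow_sub k M n)"

definition pure_tens :: "'k ring \<Rightarrow> ('k,'m) module \<Rightarrow> nat \<Rightarrow> (nat \<Rightarrow> 'm) \<Rightarrow> ((nat \<Rightarrow> 'm) \<Rightarrow> 'k) set" where
  "pure_tens k M n y = tpow_sub k M n +>\<^bsub>free_mod k (tuples n M)\<^esub> basis_elt k (tuples n M) y"


section \<open>Chain complexes and simplicial modules\<close>

text \<open>\<open>cdiff C n\<close> is the differential from degree \<open>n + 1\<close> to degree \<open>n\<close>.\<close>

record ('k,'c) chain_cx =
  cmod :: "nat \<Rightarrow> ('k,'c) module"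
  cdiff :: "nat \<Rightarrow> 'c \<Rightarrow> 'c"

definition is_chain_cx :: "'k ring \<Rightarrow> ('k,'c) chain_cx \<Rightarrow> bool" where
  "is_chain_cx k C \<longleftrightarrow>
    (\<forall>n. module k (cmod C n)) \<and>
    (\<forall>n. cdiff C n \<in> mod_hom k (cmod C (Suc n)) (cmod C n)) \<and>
    (\<forall>n. \<forall>c\<in>carrier (cmod C (Suc (Suc n))). cdiff C n (cdiff C (Suc n) c) = \<zero>\<^bsub>cmod C n\<^esub>)"

definition is_chain_map ::
  "'k ring \<Rightarrow> ('k,'c) chain_cx \<Rightarrow> ('k,'d) chain_cx \<Rightarrow> (nat \<Rightarrow> 'c \<Rightarrow> 'd) \<Rightarrow> bool" where
  "is_chain_map k C D f \<longleftrightarrow> is_chain_cx k C \<and> is_chain_cx k D \<and>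
    (\<forall>n. f n \<in> mod_hom k (cmod C n) (cmod D n)) \<and>
    (\<forall>n. \<forall>c\<in>carrier (cmod C (Suc n)). f n (cdiff C n c) = cdiff D n (f (Suc n) c))"

definition is_subcx :: "'k ring \<Rightarrow> ('k,'c) chain_cx \<Rightarrow> (nat \<Rightarrow> 'c set) \<Rightarrow> bool" where
  "is_subcx k C S \<longleftrightarrow>
    (\<forall>n. submodule (S n) k (cmod C n)) \<and> (\<forall>n. cdiff C n ` S (Suc n) \<subseteq> S n)"

definition subcx_gen :: "'k ring \<Rightarrow> ('k,'c) chain_cx \<Rightarrow> (nat \<Rightarrow> 'c set) \<Rightarrow> nat \<Rightarrow> 'c set" where
  "subcx_gen k C G n = \<Inter>{S n |S. is_subcx k C S \<and> (\<forall>m. G m \<subseteq> S m)}"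

definition quot_cx :: "('k,'c) chain_cx \<Rightarrow> (nat \<Rightarrow> 'c set) \<Rightarrow> ('k,'c set) chain_cx" where
  "quot_cx C S = \<lparr>cmod = (\<lambda>n. quot_mod (cmod C n) (S n)),
     cdiff = (\<lambda>n Z. \<Union>x\<in>Z. S n +>\<^bsub>cmod C n\<^esub> cdiff C n x)\<rparr>"

text \<open>\<open>sface Z n i\<close> is the face \<open>\<partial>\<^sub>i\<close> (\<open>i \<le> n\<close>, \<open>n \<ge> 1\<close>) from degree \<open>n\<close> to degree \<open>n - 1\<close>;
  \<open>sdegen Z n i\<close> is the degeneracy \<open>s\<^sub>i\<close> (\<open>i \<le> n\<close>) from degree \<open>n\<close> to degree \<open>n + 1\<close>.\<close>

record ('k,'c) simp_mod =
  smod :: "nat \<Rightarrow> ('k,'c) module"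
  sface :: "nat \<Rightarrow> nat \<Rightarrow> 'c \<Rightarrow> 'c"
  sdegen :: "nat \<Rightarrow> nat \<Rightarrow> 'c \<Rightarrow> 'c"

definition assoc_cx :: "('k,'c) simp_mod \<Rightarrow> ('k,'c) chain_cx" where
  "assoc_cx Z = \<lparr>cmod = smod Z,
     cdiff = (\<lambda>n c. \<Oplus>\<^bsub>smod Z n\<^esub>i\<in>{0..Suc n}.
       if even i then sface Z (Suc n) i c else \<ominus>\<^bsub>smod Z n\<^esub> sface Z (Suc n) i c)\<rparr>"

definition degenerates :: "('k,'c) simp_mod \<Rightarrow> nat \<Rightarrow> 'c set" where
  "degenerates Z n = {sdegen Z m i c |m i c. n = Suc m \<and> i \<le> m \<and> c \<in> carrier (smod Z m)}"

definition degen_cx :: "'k ring \<Rightarrow> ('k,'c) simp_mod \<Rightarrow> nat \<Rightarrow> 'c set" where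
  "degen_cx k Z = subcx_gen k (assoc_cx Z) (degenerates Z)"

definition norm_cx :: "'k ring \<Rightarrow> ('k,'c) simp_mod \<Rightarrow> ('k,'c set) chain_cx" where
  "norm_cx k Z = quot_cx (assoc_cx Z) (degen_cx k Z)"

definition norm_class :: "'k ring \<Rightarrow> ('k,'c) simp_mod \<Rightarrow> nat \<Rightarrow> 'c \<Rightarrow> 'c set" where
  "norm_class k Z n c = degen_cx k Z n +>\<^bsub>smod Z n\<^esub> c"


section \<open>Categories and strings of composable morphisms\<close>

text \<open>\<open>Comp C g f\<close> is the composite ``\<open>g\<close> after \<open>f\<close>''.\<close>

record ('o,'m) cat =
  Obj :: "'o set"
  Mor :: "'m set"
  Dom :: "'m \<Rightarrow> 'o"
  Cod :: "'m \<Rightarrow> 'o"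
  Comp :: "'m \<Rightarrow> 'm \<Rightarrow> 'm"
  Ident :: "'o \<Rightarrow> 'm"

text \<open>A string \<open>x \<rightarrow> x\<^sub>1 \<rightarrow> \<dots> \<rightarrow> x\<^sub>n\<close> is stored as its source \<open>x\<close> and the list \<open>[f\<^sub>1, \<dots>, f\<^sub>n]\<close>, in the order
  in which the morphisms are applied, so that \<open>f\<^sub>i\<close> is the list entry with index \<open>i - 1\<close>.\<close>

fun is_path :: "('o,'m) cat \<Rightarrow> 'o \<Rightarrow> 'm list \<Rightarrow> 'o \<Rightarrow> bool" where
  "is_path C x [] y \<longleftrightarrow> x \<in> Obj C \<and> x = y"
| "is_path C x (f # fs) y \<longleftrightarrow> x \<in> Obj C \<and> f \<in> Mor C \<and> Dom C f = x \<and> is_path C (Cod C f) fs y"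

definition paths :: "('o,'m) cat \<Rightarrow> nat \<Rightarrow> 'o \<Rightarrow> 'o \<Rightarrow> 'm list set" where
  "paths C n x y = {fs. length fs = n \<and> is_path C x fs y}"

definition strings :: "('o,'m) cat \<Rightarrow> nat \<Rightarrow> ('o \<times> 'm list) set" where
  "strings C n = {(x, fs) |x fs y. fs \<in> paths C n x y}"

definition str_vertex :: "('o,'m) cat \<Rightarrow> 'o \<times> 'm list \<Rightarrow> nat \<Rightarrow> 'o" where
  "str_vertex C s i = (if i = 0 then fst s else Cod C (snd s ! (i - 1)))"

definition str_face :: "('o,'m) cat \<Rightarrow> nat \<Rightarrow> 'o \<times> 'm list \<Rightarrow> 'o \<times> 'm list" where
  "str_face C i s = (case s of (x, fs) \<Rightarrow>
     if i = 0 then (Cod C (hd fs), tl fs)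
     else if i = length fs then (x, butlast fs)
     else (x, take (i - 1) fs @ Comp C (fs ! i) (fs ! (i - 1)) # drop (i + 1) fs))"

definition str_degen :: "('o,'m) cat \<Rightarrow> nat \<Rightarrow> 'o \<times> 'm list \<Rightarrow> 'o \<times> 'm list" where
  "str_degen C i s = (case s of (x, fs) \<Rightarrow>
     (x, take i fs @ Ident C (str_vertex C s i) # drop i fs))"

text \<open>The simplicial module \<open>C\<^sub>\<star>(C, F)\<close> for a functor \<open>F\<close> to \<open>k\<close>-modules, given by its effect \<open>Fo\<close> on
  objects and \<open>Fm\<close> on morphisms.\<close>

definition cat_chain_mod ::
  "('o,'m) cat \<Rightarrow> ('o \<Rightarrow> ('k,'c) module) \<Rightarrow> nat \<Rightarrow> ('k, 'o \<times> 'm list \<Rightarrow> 'c) module" where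
  "cat_chain_mod C Fo n = dsum (strings C n) (\<lambda>s. Fo (fst s))"

definition cat_chain_elt ::
  "('o,'m) cat \<Rightarrow> ('o \<Rightarrow> ('k,'c) module) \<Rightarrow> nat \<Rightarrow> 'o \<times> 'm list \<Rightarrow> 'c \<Rightarrow> 'o \<times> 'm list \<Rightarrow> 'c" where
  "cat_chain_elt C Fo n s y = dincl (strings C n) (\<lambda>s. Fo (fst s)) s y"

definition cat_chains ::
  "'k ring \<Rightarrow> ('o,'m) cat \<Rightarrow> ('o \<Rightarrow> ('k,'c) module) \<Rightarrow> ('m \<Rightarrow> 'c \<Rightarrow> 'c) \<Rightarrow>
   ('k, 'o \<times> 'm list \<Rightarrow> 'c) simp_mod" where
  "cat_chains k C Fo Fm = \<lparr>
     smod = cat_chain_mod C Fo,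
     sface = (\<lambda>n i. lin_ext k (cat_chain_mod C Fo n) (cat_chain_mod C Fo (n - 1))
        {(s, y). s \<in> strings C n \<and> y \<in> carrier (Fo (fst s))}
        (\<lambda>(s, y). cat_chain_elt C Fo n s y)
        (\<lambda>(s, y). cat_chain_elt C Fo (n - 1) (str_face C i s)
           (if i = 0 then Fm (hd (snd s)) y else y))),
     sdegen = (\<lambda>n i. lin_ext k (cat_chain_mod C Fo n) (cat_chain_mod C Fo (n + 1))
        {(s, y). s \<in> strings C n \<and> y \<in> carrier (Fo (fst s))}
        (\<lambda>(s, y). cat_chain_elt C Fo n s y)
        (\<lambda>(s, y). cat_chain_elt C Fo (n + 1) (str_degen C i s) y))\<rparr>"


section \<open>The categories \<open>\<Delta>S\<close>, \<open>Epi\<Delta>S\<close> and \<open>\<Omega>\<close>\<close>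

text \<open>The morphism \<open>(\<phi>, g) : n \<rightarrow> m\<close>, with \<open>\<phi>\<close> a function that is undefined outside \<open>{1..n}\<close> and \<open>g\<close>
  a permutation of \<open>nat\<close> that is the identity outside \<open>{1..n}\<close>.\<close>

datatype ds_mor = DS (ds_dom: nat) (ds_cod: nat) (ds_ord: "nat \<Rightarrow> nat") (ds_perm: "nat \<Rightarrow> nat")

text \<open>For \<open>\<phi> : n \<rightarrow> m\<close> order-preserving and \<open>h \<in> \<Sigma>\<^sub>m\<close>: the pair \<open>(h\<^sub>\<star>(\<phi>), \<phi>\<^sup>\<star>(h))\<close>.\<close>

definition ds_exchange :: "nat \<Rightarrow> nat \<Rightarrow> (nat \<Rightarrow> nat) \<Rightarrow> (nat \<Rightarrow> nat) \<Rightarrow> (nat \<Rightarrow> nat) \<times> (nat \<Rightarrow> nat)" where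
  "ds_exchange n m h \<phi> = (THE (\<chi>, \<sigma>).
     \<chi> \<in> {1..n} \<rightarrow>\<^sub>E {1..m} \<and> mono_on {1..n} \<chi> \<and>
     \<sigma> permutes {1..n} \<and> (\<forall>j\<in>{1..m}. mono_on {i\<in>{1..n}. \<phi> i = j} \<sigma>) \<and>
     (\<forall>i\<in>{1..n}. h (\<phi> i) = \<chi> (\<sigma> i)))"

definition ds_comp :: "ds_mor \<Rightarrow> ds_mor \<Rightarrow> ds_mor" where
  "ds_comp G F = (case ds_exchange (ds_dom F) (ds_cod F) (ds_perm G) (ds_ord F) of (\<chi>, \<sigma>) \<Rightarrow>
     DS (ds_dom F) (ds_cod G) (\<lambda>i\<in>{1..ds_dom F}. ds_ord G (\<chi> i)) (\<sigma> \<circ> ds_perm F))"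

definition DeltaS :: "(nat, ds_mor) cat" where
  "DeltaS = \<lparr>Obj = {1..},
     Mor = {DS n m \<phi> g |n m \<phi> g. n \<ge> 1 \<and> m \<ge> 1 \<and> \<phi> \<in> {1..n} \<rightarrow>\<^sub>E {1..m} \<and> mono_on {1..n} \<phi> \<and>
              g permutes {1..n}},
     Dom = ds_dom, Cod = ds_cod, Comp = ds_comp, Ident = (\<lambda>n. DS n n (\<lambda>i\<in>{1..n}. i) id)\<rparr>"

definition EpiDeltaS :: "(nat, ds_mor) cat" where
  "EpiDeltaS = DeltaS\<lparr>Mor := {F \<in> Mor DeltaS. ds_ord F ` {1..ds_dom F} = {1..ds_cod F}}\<rparr>"

datatype om_mor = Om (om_dom: nat) (om_cod: nat) (om_fun: "nat \<Rightarrow> nat")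

definition Omega :: "(nat, om_mor) cat" where
  "Omega = \<lparr>Obj = {1..},
     Mor = {Om n m f |n m f. n \<ge> 1 \<and> m \<ge> 1 \<and> f \<in> {1..n} \<rightarrow>\<^sub>E {1..m} \<and> f ` {1..n} = {1..m}},
     Dom = om_dom, Cod = om_cod,
     Comp = (\<lambda>G F. Om (om_dom F) (om_cod G) (\<lambda>i\<in>{1..om_dom F}. om_fun G (om_fun F i))),
     Ident = (\<lambda>n. Om n n (\<lambda>i\<in>{1..n}. i))\<rparr>"

definition forget_U :: "ds_mor \<Rightarrow> om_mor" where
  "forget_U F = Om (ds_dom F) (ds_cod F) (\<lambda>i\<in>{1..ds_dom F}. ds_ord F (ds_perm F i))"


section \<open>Augmented commutative algebras\<close>

text \<open>\<open>algebra k A\<close> already says that \<open>k\<close> and \<open>A\<close> are commutative rings with unit.\<close>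

locale augmented_algebra = algebra k A for k :: "'k ring" and A :: "('k,'a) module" +
  fixes \<epsilon> :: "'a \<Rightarrow> 'k"
  assumes aug_ring_hom: "\<epsilon> \<in> ring_hom A k"
    and aug_smult: "\<lbrakk>r \<in> carrier k; a \<in> carrier A\<rbrakk> \<Longrightarrow> \<epsilon> (r \<odot>\<^bsub>A\<^esub> a) = r \<otimes>\<^bsub>k\<^esub> \<epsilon> a"

definition aug_ideal :: "'k ring \<Rightarrow> ('k,'a) module \<Rightarrow> ('a \<Rightarrow> 'k) \<Rightarrow> ('k,'a) module" where
  "aug_ideal k A \<epsilon> = A\<lparr>carrier := a_kernel A k \<epsilon>\<rparr>"

abbreviation Ipow ::
  "'k ring \<Rightarrow> ('k,'a) module \<Rightarrow> ('a \<Rightarrow> 'k) \<Rightarrow> nat \<Rightarrow> ('k, ((nat \<Rightarrow> 'a) \<Rightarrow> 'k) set) module" where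
  "Ipow k A \<epsilon> n \<equiv> tpow k (aug_ideal k A \<epsilon>) n"

abbreviation Ipure ::
  "'k ring \<Rightarrow> ('k,'a) module \<Rightarrow> ('a \<Rightarrow> 'k) \<Rightarrow> nat \<Rightarrow> (nat \<Rightarrow> 'a) \<Rightarrow> ((nat \<Rightarrow> 'a) \<Rightarrow> 'k) set" where
  "Ipure k A \<epsilon> n y \<equiv> pure_tens k (aug_ideal k A \<epsilon>) n y"

abbreviation Ituples :: "'k ring \<Rightarrow> ('k,'a) module \<Rightarrow> ('a \<Rightarrow> 'k) \<Rightarrow> nat \<Rightarrow> (nat \<Rightarrow> 'a) set" where
  "Ituples k A \<epsilon> n \<equiv> tuples n (aug_ideal k A \<epsilon>)"


section \<open>The complexes \<open>CS\<close> and \<open>C\<Gamma>\<close>\<close>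

text \<open>The order of the factors in the products below is immaterial since \<open>A\<close> is commutative, so
  they are written with \<open>finprod\<close>.\<close>

definition Bsym ::
  "'k ring \<Rightarrow> ('k,'a) module \<Rightarrow> ('a \<Rightarrow> 'k) \<Rightarrow> ds_mor \<Rightarrow> ((nat \<Rightarrow> 'a) \<Rightarrow> 'k) set \<Rightarrow> ((nat \<Rightarrow> 'a) \<Rightarrow> 'k) set" where
  "Bsym k A \<epsilon> F = (let n = ds_dom F; m = ds_cod F in
     lin_ext k (Ipow k A \<epsilon> n) (Ipow k A \<epsilon> m) (Ituples k A \<epsilon> n) (Ipure k A \<epsilon> n)
       (\<lambda>a. Ipure k A \<epsilon> m
          (\<lambda>j\<in>{1..m}. \<Otimes>\<^bsub>A\<^esub>i\<in>{i\<in>{1..n}. ds_ord F i = j}. a (inv_into UNIV (ds_perm F) i))))"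

definition CS :: "'k ring \<Rightarrow> ('k,'a) module \<Rightarrow> ('a \<Rightarrow> 'k) \<Rightarrow>
    ('k, nat \<times> ds_mor list \<Rightarrow> ((nat \<Rightarrow> 'a) \<Rightarrow> 'k) set) simp_mod" where
  "CS k A \<epsilon> = cat_chains k EpiDeltaS (Ipow k A \<epsilon>) (Bsym k A \<epsilon>)"

abbreviation "NCS k A \<epsilon> \<equiv> norm_cx k (CS k A \<epsilon>)"

text \<open>The class in \<open>NCS\<^sub>n(I)\<close> of the string \<open>s\<close> labelled by \<open>y \<in> I\<^sup>\<otimes>\<^sup>x\<close>.\<close>

definition NCS_class where
  "NCS_class k A \<epsilon> n s y = norm_class k (CS k A \<epsilon>) n (cat_chain_elt EpiDeltaS (Ipow k A \<epsilon>) n s y)"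

definition NCS1 where
  "NCS1 k A \<epsilon> = subcx_gen k (NCS k A \<epsilon>)
     (\<lambda>n. {NCS_class k A \<epsilon> n (x, fs) y |x fs z y.
        fs \<in> paths EpiDeltaS n x z \<and> z \<noteq> 1 \<and> y \<in> carrier (Ipow k A \<epsilon> x)})"

definition NCSbar where
  "NCSbar k A \<epsilon> = quot_cx (NCS k A \<epsilon>) (NCS1 k A \<epsilon>)"

definition q_map where
  "q_map k A \<epsilon> n Z = NCS1 k A \<epsilon> n +>\<^bsub>cmod (NCS k A \<epsilon>) n\<^esub> Z"

text \<open>For a string \<open>gs\<close> in \<open>\<Omega>\<close>, \<open>om_fibre gs i\<close> is the preimage of \<open>i\<close> under the composite of \<open>gs\<close>.\<close>

fun om_fibre :: "om_mor list \<Rightarrow> nat \<Rightarrow> nat set" where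
  "om_fibre [] i = {i}"
| "om_fibre (g # gs) i = {a\<in>{1..om_dom g}. om_fun g a \<in> om_fibre gs i}"

text \<open>For a finite set \<open>S\<close> of naturals, \<open>set_enum S\<close> is the order isomorphism \<open>{1..card S} \<rightarrow> S\<close> and \<open>set_rank S\<close>
  is its inverse.\<close>

definition set_enum :: "nat set \<Rightarrow> nat \<Rightarrow> nat" where
  "set_enum S a = sorted_list_of_set S ! (a - 1)"

definition set_rank :: "nat set \<Rightarrow> nat \<Rightarrow> nat" where
  "set_rank S s = card {t\<in>S. t \<le> s}"

definition om_restrict :: "om_mor \<Rightarrow> nat set \<Rightarrow> nat set \<Rightarrow> om_mor" where
  "om_restrict g S T = Om (card S) (card T) (\<lambda>a\<in>{1..card S}. set_rank T (om_fun g (set_enum S a)))"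

fun om_component :: "om_mor list \<Rightarrow> nat \<Rightarrow> om_mor list" where
  "om_component [] i = []"
| "om_component (g # gs) i =
     om_restrict g (om_fibre (g # gs) i) (om_fibre gs i) # om_component gs i"

text \<open>\<open>I\<^sup>\<otimes>\<^sup>x \<rightarrow> I\<^sup>\<otimes>\<^sup>m\<close> on tuples: multiply the factors in each fibre of \<open>f\<close>.\<close>

definition om_push :: "('k,'a) module \<Rightarrow> om_mor \<Rightarrow> (nat \<Rightarrow> 'a) \<Rightarrow> nat \<Rightarrow> 'a" where
  "om_push A f y = (\<lambda>j\<in>{1..om_cod f}. \<Otimes>\<^bsub>A\<^esub>i\<in>{i\<in>{1..om_dom f}. om_fun f i = j}. y i)"

abbreviation "NOmega n x \<equiv> paths Omega n x 1"

definition CG_summand where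
  "CG_summand k A \<epsilon> n x =
     tens_mod k (tens_mod k (free_mod k (NOmega n x)) (Ipow k A \<epsilon> x)) (reg_mod k)"

definition CG_mod where
  "CG_mod k A \<epsilon> n = dsum {1..} (CG_summand k A \<epsilon> n)"

text \<open>The generator \<open>[f\<^sub>n | \<dots> | f\<^sub>1] \<otimes> (y\<^sub>1 \<otimes> \<dots> \<otimes> y\<^sub>x) \<otimes> \<lambda>\<close> of \<open>C\<Gamma>\<^sub>n(I,k)\<close>.\<close>

definition CG_gen where
  "CG_gen k A \<epsilon> n x fs y l = dincl {1..} (CG_summand k A \<epsilon> n) x
     (tens k (tens_mod k (free_mod k (NOmega n x)) (Ipow k A \<epsilon> x)) (reg_mod k)
       (tens k (free_mod k (NOmega n x)) (Ipow k A \<epsilon> x)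
         (basis_elt k (NOmega n x) fs) (Ipure k A \<epsilon> x y)) l)"

definition CG_index where
  "CG_index k A \<epsilon> n = {(x, fs, y, l). x \<ge> 1 \<and> fs \<in> NOmega n x \<and> y \<in> Ituples k A \<epsilon> x \<and> l \<in> carrier k}"

text \<open>The last face: the sum over \<open>i\<close> in \<open>x\<^sub>n\<^sub>-\<^sub>1\<close>, the domain of \<open>f\<^sub>n\<close>.\<close>

definition CG_last_face where
  "CG_last_face k A \<epsilon> n x fs y l =
     (\<Oplus>\<^bsub>CG_mod k A \<epsilon> (n - 1)\<^esub>i\<in>{1..om_dom (last fs)}.
        let S = om_fibre (butlast fs) i in
        CG_gen k A \<epsilon> (n - 1) (card S) (om_component (butlast fs) i)
          (\<lambda>a\<in>{1..card S}. y (set_enum S a))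
          (\<epsilon> (\<Otimes>\<^bsub>A\<^esub>j\<in>{1..x} - S. y j) \<otimes>\<^bsub>k\<^esub> l))"

definition CGamma where
  "CGamma k A \<epsilon> = \<lparr>
     smod = CG_mod k A \<epsilon>,
     sface = (\<lambda>n i. lin_ext k (CG_mod k A \<epsilon> n) (CG_mod k A \<epsilon> (n - 1)) (CG_index k A \<epsilon> n)
        (\<lambda>(x, fs, y, l). CG_gen k A \<epsilon> n x fs y l)
        (\<lambda>(x, fs, y, l).
           if i = n then CG_last_face k A \<epsilon> n x fs y l
           else case str_face Omega i (x, fs) of (x', fs') \<Rightarrow>
             CG_gen k A \<epsilon> (n - 1) x' fs' (if i = 0 then om_push A (hd fs) y else y) l)),
     sdegen = (\<lambda>n i. lin_ext k (CG_mod k A \<epsilon> n) (CG_mod k A \<epsilon> (n + 1)) (CG_index k A \<epsilon> n)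
        (\<lambda>(x, fs, y, l). CG_gen k A \<epsilon> n x fs y l)
        (\<lambda>(x, fs, y, l). case str_degen Omega i (x, fs) of (x', fs') \<Rightarrow>
             CG_gen k A \<epsilon> (n + 1) x' fs' y l))\<rparr>"

abbreviation "NCGamma k A \<epsilon> \<equiv> norm_cx k (CGamma k A \<epsilon>)"


section \<open>The map \<open>\<Phi>\<close>\<close>

text \<open>\<open>is_Phi\<close> expresses that \<open>\<Phi>\<^sub>n\<close> is the linear map with
  \<open>[(f\<^sub>n, \<dots>, f\<^sub>1), y] \<mapsto> [[U f\<^sub>n | \<dots> | U f\<^sub>1] \<otimes> y \<otimes> 1]\<close> for strings with final object \<open>1\<close>. Their classes
  generate the quotient, as all other strings vanish in it.\<close>

definition is_Phi where
  "is_Phi k A \<epsilon> n = is_lin_ext k (cmod (NCSbar k A \<epsilon>) n) (cmod (NCGamma k A \<epsilon>) n)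
     {(x, fs, y). x \<ge> 1 \<and> fs \<in> paths EpiDeltaS n x 1 \<and> y \<in> Ituples k A \<epsilon> x}
     (\<lambda>(x, fs, y). q_map k A \<epsilon> n (NCS_class k A \<epsilon> n (x, fs) (Ipure k A \<epsilon> x y)))
     (\<lambda>(x, fs, y). norm_class k (CGamma k A \<epsilon>) n
        (CG_gen k A \<epsilon> n x (map forget_U fs) y \<one>\<^bsub>k\<^esub>))"

end

theory Submission
  imports Defs
begin

text \<open>The composite \<open>\<Phi> \<circ> q\<close> comes from a map of simplicial modules before normalization. Send a string of \<open>Epi\<Delta>S\<close>
  that ends in \<open>1\<close> to its string of underlying surjections, with the same label in \<open>I\<^sup>\<otimes>\<^sup>x\<close>, and every other
  string to zero (\<open>forget_chain\<close>). Three observations carry the proof.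

  \<^item> The last face of \<open>C\<Gamma>\<close> is simpler than it looks (\<open>CG_last_face_eq\<close>). It is a sum over the fibres of a composite of
    surjections, in which each fibre is weighted by the augmentation of the product of all entries outside
    it. Fibres are nonempty and \<open>\<epsilon>\<close> vanishes on \<open>I\<close>, so the sum is zero unless there is only one fibre, and
    then the face just removes the last map. On strings in \<open>Epi\<Delta>S\<close> that end in \<open>1\<close>, removing the last map
    leaves a string that ends in \<open>1\<close> in precisely this case. Surjections do not raise the size of an
    object, so a string that does not end in \<open>1\<close> keeps this property under all faces. Hence \<open>forget_chain\<close>
    commutes with the last face; for the other faces and the degeneracies this is the functoriality of
    \<open>U\<close>, together with the fact that, \<open>A\<close> being commutative, \<open>B\<^sub>I\<^sup>s\<^sup>y\<^sup>m\<close> factors through \<open>U\<close> (\<open>Bsym_eq_push\<close>).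

  \<^item> Every surjection underlies a morphism of \<open>Epi\<Delta>S\<close> (\<open>forget_U_surj\<close>), so \<open>forget_chain\<close> hits a generating
    set and is onto.

  \<^item> That \<open>CS\<close> is a complex follows from the simplicial identities for strings in a category, where the
    associativity of the composition of \<open>\<Delta>S\<close> enters (\<open>ds_comp_assoc\<close>). For \<open>C\<Gamma>\<close> there is no need to iterate the
    last face: \<open>d \<circ> d = 0\<close> is inherited along the surjection \<open>forget_chain\<close> (\<open>CG_chain_cx\<close>).

  A map of simplicial modules preserves degenerate chains, so there is an induced chain map of normalized
  complexes. Its kernel is a subcomplex that contains all classes of strings that do not end in \<open>1\<close>, hence
  \<open>NCS\<^sup>1\<close>, and the factorization through \<open>q\<close> is \<open>\<Phi>\<close>.

  All modules involved are given by generators and relations, and all maps by their values on generators.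
  The first part supplies what this requires: the universal properties of quotients, direct sums, tensor
  powers and tensor products, to show that the maps exist, and generating sets, to compare them.\<close>

section \<open>Linear maps, submodules and generators\<close>

lemma mod_homI:
  assumes "\<And>x. x \<in> carrier M \<Longrightarrow> h x \<in> carrier N"
    and "\<And>x y. x \<in> carrier M \<Longrightarrow> y \<in> carrier M \<Longrightarrow> h (x \<oplus>\<^bsub>M\<^esub> y) = h x \<oplus>\<^bsub>N\<^esub> h y"
    and "\<And>r x. r \<in> carrier k \<Longrightarrow> x \<in> carrier M \<Longrightarrow> h (r \<odot>\<^bsub>M\<^esub> x) = r \<odot>\<^bsub>N\<^esub> h x"
  shows "h \<in> mod_hom k M N"
  using assms by (auto simp: mod_hom_def hom_def)

lemma mod_homD:
  assumes "h \<in> mod_hom k M N"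
  shows mod_hom_closed: "x \<in> carrier M \<Longrightarrow> h x \<in> carrier N"
    and mod_hom_add: "x \<in> carrier M \<Longrightarrow> y \<in> carrier M \<Longrightarrow> h (x \<oplus>\<^bsub>M\<^esub> y) = h x \<oplus>\<^bsub>N\<^esub> h y"
    and mod_hom_smult: "r \<in> carrier k \<Longrightarrow> x \<in> carrier M \<Longrightarrow> h (r \<odot>\<^bsub>M\<^esub> x) = r \<odot>\<^bsub>N\<^esub> h x"
  using assms by (auto simp: mod_hom_def hom_def)

lemma mod_hom_zero:
  assumes "module k M" "module k N" "h \<in> mod_hom k M N"
  shows "h \<zero>\<^bsub>M\<^esub> = \<zero>\<^bsub>N\<^esub>"
proof -
  interpret M: module k M by fact
  interpret N: module k N by fact
  have "h (\<zero>\<^bsub>k\<^esub> \<odot>\<^bsub>M\<^esub> \<zero>\<^bsub>M\<^esub>) = \<zero>\<^bsub>k\<^esub> \<odot>\<^bsub>N\<^esub> h \<zero>\<^bsub>M\<^esub>"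
    by (rule mod_hom_smult[OF assms(3)]) auto
  then show ?thesis using mod_hom_closed[OF assms(3)] by simp
qed

lemma mod_hom_a_inv:
  assumes "module k M" "module k N" "h \<in> mod_hom k M N" "x \<in> carrier M"
  shows "h (\<ominus>\<^bsub>M\<^esub> x) = \<ominus>\<^bsub>N\<^esub> h x"
proof -
  interpret M: module k M by fact
  interpret N: module k N by fact
  have "h ((\<ominus>\<^bsub>k\<^esub> \<one>\<^bsub>k\<^esub>) \<odot>\<^bsub>M\<^esub> x) = (\<ominus>\<^bsub>k\<^esub> \<one>\<^bsub>k\<^esub>) \<odot>\<^bsub>N\<^esub> h x"
    using mod_hom_smult[OF assms(3)] assms(4) by simp
  then show ?thesis using mod_hom_closed[OF assms(3,4)] assms(4)
    by (simp add: M.smult_l_minus N.smult_l_minus)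
qed

lemma mod_hom_minus:
  assumes "module k M" "module k N" "h \<in> mod_hom k M N" "x \<in> carrier M" "y \<in> carrier M"
  shows "h (x \<ominus>\<^bsub>M\<^esub> y) = h x \<ominus>\<^bsub>N\<^esub> h y"
proof -
  interpret M: module k M by fact
  show ?thesis
    using assms by (simp add: a_minus_def mod_hom_add[OF assms(3)] mod_hom_a_inv[OF assms(1-3)])
qed

lemma minus_self_eq_zero:
  assumes "module k N" "x \<in> carrier N" "x = y" shows "x \<ominus>\<^bsub>N\<^esub> y = \<zero>\<^bsub>N\<^esub>"
proof -
  interpret N: module k N by fact
  show ?thesis using assms by (simp add: a_minus_def N.M.r_neg)
qed

lemma mod_hom_finsum:
  assumes "module k M" "module k N" "h \<in> mod_hom k M N" "finite X"
    and "f \<in> X \<rightarrow> carrier M"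
  shows "h (finsum M f X) = finsum N (\<lambda>i. h (f i)) X"
proof -
  interpret M: module k M by fact
  interpret N: module k N by fact
  show ?thesis using assms(4,5)
  proof (induction X)
    case empty then show ?case by (simp add: mod_hom_zero[OF assms(1-3)])
  next
    case (insert a X)
    have 1: "f a \<in> carrier M" "f \<in> X \<rightarrow> carrier M" using insert by auto
    then have 2: "(\<lambda>i. h (f i)) \<in> X \<rightarrow> carrier N" "h (f a) \<in> carrier N"
      by (auto intro: mod_hom_closed[OF assms(3)])
    show ?case using insert 1 2 by (simp add: mod_hom_add[OF assms(3)])
  qed
qed

lemma mod_hom_comp:
  "g \<in> mod_hom k N L \<Longrightarrow> h \<in> mod_hom k M N \<Longrightarrow> (\<lambda>x. g (h x)) \<in> mod_hom k M L"
  by (auto intro!: mod_homI simp: mod_homD)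

lemma mod_hom_restrict:
  assumes "module k M" "h \<in> mod_hom k M N"
  shows "restrict h (carrier M) \<in> mod_hom k M N"
proof -
  interpret M: module k M by fact
  show ?thesis using mod_homD[OF assms(2)] by (intro mod_homI) auto
qed

lemma mod_hom_zero_map:
  assumes "module k N" shows "(\<lambda>x. \<zero>\<^bsub>N\<^esub>) \<in> mod_hom k M N"
proof -
  interpret N: module k N by fact
  show ?thesis by (intro mod_homI) auto
qed

lemma mod_hom_add_maps:
  assumes "module k N" "f \<in> mod_hom k M N" "g \<in> mod_hom k M N"
  shows "(\<lambda>x. f x \<oplus>\<^bsub>N\<^esub> g x) \<in> mod_hom k M N"
proof -
  interpret N: module k N by fact
  note F = mod_homD[OF assms(2)] and G = mod_homD[OF assms(3)]
  show ?thesis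
    by (intro mod_homI) (simp_all add: F G N.smult_r_distr N.M.a_ac)
qed

lemma mod_hom_uminus_map:
  assumes "module k N" "f \<in> mod_hom k M N"
  shows "(\<lambda>x. \<ominus>\<^bsub>N\<^esub> f x) \<in> mod_hom k M N"
proof -
  interpret N: module k N by fact
  note F = mod_homD[OF assms(2)]
  show ?thesis
    by (intro mod_homI) (simp_all add: F N.smult_r_minus N.M.minus_add)
qed

lemma mod_hom_finsum_maps:
  assumes "module k N" "finite X" "\<And>i. i \<in> X \<Longrightarrow> f i \<in> mod_hom k M N"
  shows "(\<lambda>x. finsum N (\<lambda>i. f i x) X) \<in> mod_hom k M N"
proof -
  interpret N: module k N by fact
  have cl: "(\<lambda>i. f i x) \<in> X \<rightarrow> carrier N" if "x \<in> carrier M" for x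
    using mod_hom_closed[OF assms(3)] that by auto
  show ?thesis
  proof (intro mod_homI)
    show "finsum N (\<lambda>i. f i x) X \<in> carrier N" if "x \<in> carrier M" for x
      by (rule N.M.finsum_closed[OF cl[OF that]])
    show "finsum N (\<lambda>i. f i (x \<oplus>\<^bsub>M\<^esub> y)) X = finsum N (\<lambda>i. f i x) X \<oplus>\<^bsub>N\<^esub> finsum N (\<lambda>i. f i y) X"
      if "x \<in> carrier M" "y \<in> carrier M" for x y
    proof -
      have "finsum N (\<lambda>i. f i (x \<oplus>\<^bsub>M\<^esub> y)) X = finsum N (\<lambda>i. f i x \<oplus>\<^bsub>N\<^esub> f i y) X"
        using that cl mod_hom_add[OF assms(3)] mod_hom_closed[OF assms(3)]
        by (intro N.M.finsum_cong') auto
      then show ?thesis using N.M.finsum_addf[OF cl[OF that(1)] cl[OF that(2)]] by simp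
    qed
    show "finsum N (\<lambda>i. f i (r \<odot>\<^bsub>M\<^esub> x)) X = r \<odot>\<^bsub>N\<^esub> finsum N (\<lambda>i. f i x) X"
      if "r \<in> carrier k" "x \<in> carrier M" for r x
    proof -
      have "finsum N (\<lambda>i. f i (r \<odot>\<^bsub>M\<^esub> x)) X = finsum N (\<lambda>i. r \<odot>\<^bsub>N\<^esub> f i x) X"
        using that cl mod_hom_smult[OF assms(3)] mod_hom_closed[OF assms(3)]
        by (intro N.M.finsum_cong') auto
      then show ?thesis using N.finsum_smult_ldistr[OF assms(2) that(1) cl[OF that(2)]] by simp
    qed
  qed
qed

lemma mod_hom_smult_map:
  assumes "module k N" "r \<in> carrier k" "f \<in> mod_hom k M N"
  shows "(\<lambda>x. r \<odot>\<^bsub>N\<^esub> f x) \<in> mod_hom k M N"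
proof -
  interpret N: module k N by fact
  note F = mod_homD[OF assms(3)]
  show ?thesis
  proof (intro mod_homI)
    fix s x assume sx: "s \<in> carrier k" "x \<in> carrier M"
    have "r \<odot>\<^bsub>N\<^esub> (s \<odot>\<^bsub>N\<^esub> f x) = (r \<otimes>\<^bsub>k\<^esub> s) \<odot>\<^bsub>N\<^esub> f x"
      using assms sx F by (simp add: N.smult_assoc1)
    also have "\<dots> = (s \<otimes>\<^bsub>k\<^esub> r) \<odot>\<^bsub>N\<^esub> f x" using assms sx by (simp add: N.R.m_comm)
    also have "\<dots> = s \<odot>\<^bsub>N\<^esub> (r \<odot>\<^bsub>N\<^esub> f x)" using assms sx F by (simp add: N.smult_assoc1)
    finally show "r \<odot>\<^bsub>N\<^esub> f (s \<odot>\<^bsub>M\<^esub> x) = s \<odot>\<^bsub>N\<^esub> (r \<odot>\<^bsub>N\<^esub> f x)" using sx F by simp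
  qed (use assms F in \<open>simp_all add: N.smult_r_distr\<close>)
qed

text \<open>Closure under negatives need not be checked, because \<open>\<ominus> a\<close> is the multiple of \<open>a\<close> by \<open>\<ominus> \<one>\<close>.\<close>

lemma submoduleI_linear:
  assumes "module k M" "H \<subseteq> carrier M" "\<zero>\<^bsub>M\<^esub> \<in> H"
    and "\<And>a b. a \<in> H \<Longrightarrow> b \<in> H \<Longrightarrow> a \<oplus>\<^bsub>M\<^esub> b \<in> H"
    and "\<And>r a. r \<in> carrier k \<Longrightarrow> a \<in> H \<Longrightarrow> r \<odot>\<^bsub>M\<^esub> a \<in> H"
  shows "submodule H k M"
proof -
  interpret M: module k M by fact
  have "\<ominus>\<^bsub>M\<^esub> a \<in> H" if "a \<in> H" for a
  proof -
    have "(\<ominus>\<^bsub>k\<^esub> \<one>\<^bsub>k\<^esub>) \<odot>\<^bsub>M\<^esub> a = \<ominus>\<^bsub>M\<^esub> a"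
      using that assms(2) by (auto simp: M.smult_l_minus)
    then show ?thesis using assms(5)[of "\<ominus>\<^bsub>k\<^esub> \<one>\<^bsub>k\<^esub>" a] that by simp
  qed
  then show ?thesis using assms by (intro M.submoduleI) auto
qed

lemma submoduleD:
  assumes "module k M" "submodule H k M"
  shows "H \<subseteq> carrier M" "\<zero>\<^bsub>M\<^esub> \<in> H"
    "\<And>a b. a \<in> H \<Longrightarrow> b \<in> H \<Longrightarrow> a \<oplus>\<^bsub>M\<^esub> b \<in> H"
    "\<And>r a. r \<in> carrier k \<Longrightarrow> a \<in> H \<Longrightarrow> r \<odot>\<^bsub>M\<^esub> a \<in> H"
    "\<And>a. a \<in> H \<Longrightarrow> \<ominus>\<^bsub>M\<^esub> a \<in> H"
proof -
  interpret M: module k M by fact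
  interpret H: submodule H k M by fact
  show "H \<subseteq> carrier M" "\<And>a b. a \<in> H \<Longrightarrow> b \<in> H \<Longrightarrow> a \<oplus>\<^bsub>M\<^esub> b \<in> H"
    "\<And>r a. r \<in> carrier k \<Longrightarrow> a \<in> H \<Longrightarrow> r \<odot>\<^bsub>M\<^esub> a \<in> H"
    "\<And>a. a \<in> H \<Longrightarrow> \<ominus>\<^bsub>M\<^esub> a \<in> H" using M.submoduleE[OF assms(2)] by auto
  show "\<zero>\<^bsub>M\<^esub> \<in> H" using H.one_closed by simp
qed

lemma submodule_preimage:
  assumes "module k M" "module k N" "h \<in> mod_hom k M N" "submodule H k N"
  shows "submodule {x \<in> carrier M. h x \<in> H} k M"
proof -
  interpret M: module k M by fact
  note [simp] = mod_homD[OF assms(3)] mod_hom_zero[OF assms(1-3)] submoduleD(2-4)[OF assms(2,4)]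
  show ?thesis by (rule submoduleI_linear[OF assms(1)]) auto
qed

lemma submodule_image:
  assumes "module k M" "module k N" "h \<in> mod_hom k M N"
  shows "submodule (h ` carrier M) k N"
proof -
  interpret M: module k M by fact
  note H = mod_homD[OF assms(3)] mod_hom_zero[OF assms(1-3)]
  show ?thesis
  proof (rule submoduleI_linear[OF assms(2)])
    show "\<zero>\<^bsub>N\<^esub> \<in> h ` carrier M" using H(4) M.zero_closed by (metis imageI)
    show "a \<oplus>\<^bsub>N\<^esub> b \<in> h ` carrier M" if "a \<in> h ` carrier M" "b \<in> h ` carrier M" for a b
      using that H(2) M.a_closed by (auto simp flip: H(2))
    show "r \<odot>\<^bsub>N\<^esub> a \<in> h ` carrier M" if "r \<in> carrier k" "a \<in> h ` carrier M" for r a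
      using that by (auto simp flip: H(3))
  qed (use H in auto)
qed

lemma submodule_zero:
  assumes "module k M" shows "submodule {\<zero>\<^bsub>M\<^esub>} k M"
proof -
  interpret M: module k M by fact
  show ?thesis by (rule submoduleI_linear[OF assms]) auto
qed

lemma submodule_Inter:
  assumes "module k M" "\<H> \<noteq> {}" "\<And>H. H \<in> \<H> \<Longrightarrow> submodule H k M"
  shows "submodule (\<Inter>\<H>) k M"
proof (rule submoduleI_linear[OF assms(1)])
  note D = submoduleD[OF assms(1) assms(3)]
  show "\<Inter>\<H> \<subseteq> carrier M" using assms(2) D(1) by blast
qed (use submoduleD(2-4)[OF assms(1) assms(3)] in auto)

text \<open>Generation is stated with submodules instead of linear combinations. Proofs then only need to exhibit a
  submodule: an equalizer, an image or a preimage.\<close>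

definition generates :: "'k ring \<Rightarrow> ('k,'m) module \<Rightarrow> 'm set \<Rightarrow> bool" where
  "generates k M E \<longleftrightarrow> E \<subseteq> carrier M \<and> (\<forall>H. submodule H k M \<longrightarrow> E \<subseteq> H \<longrightarrow> carrier M \<subseteq> H)"

lemma generatesD: "generates k M E \<Longrightarrow> submodule H k M \<Longrightarrow> E \<subseteq> H \<Longrightarrow> carrier M \<subseteq> H"
  by (auto simp: generates_def)

lemma generates_subset: "generates k M E \<Longrightarrow> E \<subseteq> carrier M"
  by (auto simp: generates_def)

lemma mod_hom_eq_on_generators:
  assumes "module k M" "module k N" "g \<in> mod_hom k M N" "h \<in> mod_hom k M N"
    and "generates k M E" "\<And>e. e \<in> E \<Longrightarrow> g e = h e" "x \<in> carrier M"
  shows "g x = h x"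
proof -
  interpret M: module k M by fact
  interpret N: module k N by fact
  note G = mod_homD[OF assms(3)] mod_hom_zero[OF assms(1-3)]
  note H = mod_homD[OF assms(4)] mod_hom_zero[OF assms(1,2,4)]
  have "submodule {x \<in> carrier M. g x = h x} k M"
    by (rule submoduleI_linear[OF assms(1)]) (auto simp: G H)
  from generatesD[OF assms(5) this] generates_subset[OF assms(5)] assms(6,7) show ?thesis by auto
qed

lemma mod_hom_surj_on_generators:
  assumes "module k M" "module k N" "h \<in> mod_hom k M N" "generates k N E" "E \<subseteq> h ` carrier M"
  shows "h ` carrier M = carrier N"
  using generatesD[OF assms(4) submodule_image[OF assms(1-3)] assms(5)] mod_hom_closed[OF assms(3)]
  by auto

lemma generates_if_contains:
  assumes "generates k M E" "E' \<subseteq> carrier M"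
    "\<And>H. submodule H k M \<Longrightarrow> E' \<subseteq> H \<Longrightarrow> E \<subseteq> H"
  shows "generates k M E'"
  using assms unfolding generates_def by blast

lemma generates_carrier: "generates k M (carrier M)"
  by (simp add: generates_def)

lemma lin_ext_eq:
  assumes "module k M" "module k N" "generates k M (e ` J)"
    and "h \<in> mod_hom k M N" "\<And>j. j \<in> J \<Longrightarrow> h (e j) = v j"
  shows "lin_ext k M N J e v = restrict h (carrier M)"
  unfolding lin_ext_def
proof (rule the_equality)
  have "e j \<in> carrier M" if "j \<in> J" for j using that generates_subset[OF assms(3)] by auto
  then show "is_lin_ext k M N J e v (restrict h (carrier M))"
    using mod_hom_restrict[OF assms(1,4)] assms(5) by (auto simp: is_lin_ext_def)
next
  fix g assume g: "is_lin_ext k M N J e v g"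
  then have gh: "g \<in> mod_hom k M N" "g \<in> extensional (carrier M)" "\<And>j. j \<in> J \<Longrightarrow> g (e j) = v j"
    by (auto simp: is_lin_ext_def)
  show "g = restrict h (carrier M)"
  proof (rule extensionalityI[OF gh(2)])
    fix x assume "x \<in> carrier M"
    moreover have "g y = h y" if "y \<in> e ` J" for y using that gh(3) assms(5) by auto
    ultimately show "g x = restrict h (carrier M) x"
      using mod_hom_eq_on_generators[OF assms(1,2) gh(1) assms(4,3)] by auto
  qed simp
qed

text \<open>That some linear map with the prescribed values exists has to be supplied. For the faces and degeneracies,
  this is where the universal properties below are used.\<close>

lemma lin_ext_works:
  assumes "module k M" "module k N" "generates k M (e ` J)"
    and "\<exists>h \<in> mod_hom k M N. \<forall>j\<in>J. h (e j) = v j"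
  shows "lin_ext k M N J e v \<in> mod_hom k M N"
    and "\<And>j. j \<in> J \<Longrightarrow> lin_ext k M N J e v (e j) = v j"
proof -
  obtain h where h: "h \<in> mod_hom k M N" "\<And>j. j \<in> J \<Longrightarrow> h (e j) = v j" using assms(4) by auto
  have "e j \<in> carrier M" if "j \<in> J" for j using that generates_subset[OF assms(3)] by auto
  then show "lin_ext k M N J e v \<in> mod_hom k M N"
    and "\<And>j. j \<in> J \<Longrightarrow> lin_ext k M N J e v (e j) = v j"
    using lin_ext_eq[OF assms(1-3) h] mod_hom_restrict[OF assms(1) h(1)] h(2) by auto
qed

lemma lin_ext_cong:
  assumes "\<And>j. j \<in> J \<Longrightarrow> v j = w j" shows "lin_ext k M N J e v = lin_ext k M N J e w"
proof -
  have "is_lin_ext k M N J e v h = is_lin_ext k M N J e w h" for h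
    using assms by (simp add: is_lin_ext_def)
  then show ?thesis by (simp add: lin_ext_def)
qed

section \<open>Quotient modules\<close>

lemma mem_coset_iff:
  assumes "module k M" "submodule H k M" "x \<in> carrier M"
  shows "z \<in> H +>\<^bsub>M\<^esub> x \<longleftrightarrow> z \<in> carrier M \<and> z \<ominus>\<^bsub>M\<^esub> x \<in> H"
proof -
  interpret M: module k M by fact
  note H = submoduleD[OF assms(1,2)]
  have "h \<oplus>\<^bsub>M\<^esub> x \<ominus>\<^bsub>M\<^esub> x = h" if "h \<in> H" for h
    using that H(1) assms(3) by (auto simp: a_minus_def M.M.a_assoc M.M.r_neg)
  moreover have "z \<ominus>\<^bsub>M\<^esub> x \<oplus>\<^bsub>M\<^esub> x = z" if "z \<in> carrier M"
    using that assms(3) by (auto simp: a_minus_def M.M.a_assoc M.M.l_neg)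
  ultimately show ?thesis using H(1) assms(3)
    by (auto simp: a_r_coset_def' intro!: bexI[of _ "z \<ominus>\<^bsub>M\<^esub> x"])
qed

lemma quot_class_eq_iff:
  assumes "module k M" "submodule H k M" "x \<in> carrier M" "y \<in> carrier M"
  shows "H +>\<^bsub>M\<^esub> x = H +>\<^bsub>M\<^esub> y \<longleftrightarrow> x \<ominus>\<^bsub>M\<^esub> y \<in> H"
proof -
  interpret M: module k M by fact
  note H = submoduleD[OF assms(1,2)] and I = mem_coset_iff[OF assms(1,2)]
  have self: "x \<in> H +>\<^bsub>M\<^esub> x" using assms(3) H(2) by (simp add: I M.M.r_neg a_minus_def)
  have sub: "H +>\<^bsub>M\<^esub> u \<subseteq> H +>\<^bsub>M\<^esub> v"
    if "u \<ominus>\<^bsub>M\<^esub> v \<in> H" "u \<in> carrier M" "v \<in> carrier M" for u v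
  proof
    fix z assume "z \<in> H +>\<^bsub>M\<^esub> u"
    then have z: "z \<in> carrier M" "z \<ominus>\<^bsub>M\<^esub> u \<in> H" using that by (auto simp: I)
    have "z \<ominus>\<^bsub>M\<^esub> v = (z \<ominus>\<^bsub>M\<^esub> u) \<oplus>\<^bsub>M\<^esub> (u \<ominus>\<^bsub>M\<^esub> v)"
      using z that by (simp add: a_minus_def M.M.a_assoc M.M.r_neg1)
    then show "z \<in> H +>\<^bsub>M\<^esub> v" using z that H(3)[OF z(2) that(1)] by (simp add: I)
  qed
  show ?thesis
  proof
    assume "H +>\<^bsub>M\<^esub> x = H +>\<^bsub>M\<^esub> y"
    then show "x \<ominus>\<^bsub>M\<^esub> y \<in> H" using self assms by (simp add: I)
  next
    assume xy: "x \<ominus>\<^bsub>M\<^esub> y \<in> H"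
    have "y \<ominus>\<^bsub>M\<^esub> x = \<ominus>\<^bsub>M\<^esub> (x \<ominus>\<^bsub>M\<^esub> y)"
      using assms by (simp add: a_minus_def M.M.minus_add M.M.a_comm)
    then have "y \<ominus>\<^bsub>M\<^esub> x \<in> H" using H(5)[OF xy] by simp
    then show "H +>\<^bsub>M\<^esub> x = H +>\<^bsub>M\<^esub> y" using sub xy assms by blast
  qed
qed

lemma carrier_quot_mod: "carrier (quot_mod M H) = (\<lambda>x. H +>\<^bsub>M\<^esub> x) ` carrier M"
  by (auto simp: quot_mod_def A_RCOSETS_def' )

lemma quot_mod_ops:
  assumes "module k M" "submodule H k M"
  shows quot_mod_zero: "\<zero>\<^bsub>quot_mod M H\<^esub> = H +>\<^bsub>M\<^esub> \<zero>\<^bsub>M\<^esub>"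
    and quot_mod_add: "\<And>x y. x \<in> carrier M \<Longrightarrow> y \<in> carrier M \<Longrightarrow>
      (H +>\<^bsub>M\<^esub> x) \<oplus>\<^bsub>quot_mod M H\<^esub> (H +>\<^bsub>M\<^esub> y) = H +>\<^bsub>M\<^esub> (x \<oplus>\<^bsub>M\<^esub> y)"
    and quot_mod_smult: "\<And>r x. r \<in> carrier k \<Longrightarrow> x \<in> carrier M \<Longrightarrow>
      r \<odot>\<^bsub>quot_mod M H\<^esub> (H +>\<^bsub>M\<^esub> x) = H +>\<^bsub>M\<^esub> (r \<odot>\<^bsub>M\<^esub> x)"
proof -
  interpret M: module k M by fact
  interpret H: abelian_subgroup H M
    using assms(2) by (intro abelian_subgroupI3 additive_subgroup.intro submodule.axioms(1))
      (auto intro: M.abelian_group_axioms)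
  note Hs = submoduleD[OF assms] and I = mem_coset_iff[OF assms]
  show "\<zero>\<^bsub>quot_mod M H\<^esub> = H +>\<^bsub>M\<^esub> \<zero>\<^bsub>M\<^esub>"
    using Hs(1) by (simp add: quot_mod_def)
  show "(H +>\<^bsub>M\<^esub> x) \<oplus>\<^bsub>quot_mod M H\<^esub> (H +>\<^bsub>M\<^esub> y) = H +>\<^bsub>M\<^esub> (x \<oplus>\<^bsub>M\<^esub> y)"
    if "x \<in> carrier M" "y \<in> carrier M" for x y
    using that by (simp add: quot_mod_def H.a_rcos_sum)
  show "r \<odot>\<^bsub>quot_mod M H\<^esub> (H +>\<^bsub>M\<^esub> x) = H +>\<^bsub>M\<^esub> (r \<odot>\<^bsub>M\<^esub> x)"
    if "r \<in> carrier k" "x \<in> carrier M" for r x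
  proof -
    have "H +>\<^bsub>M\<^esub> (r \<odot>\<^bsub>M\<^esub> z) = H +>\<^bsub>M\<^esub> (r \<odot>\<^bsub>M\<^esub> x)" if z: "z \<in> H +>\<^bsub>M\<^esub> x" for z
    proof -
      have z': "z \<in> carrier M" "z \<ominus>\<^bsub>M\<^esub> x \<in> H" using z \<open>x \<in> carrier M\<close> by (auto simp: I)
      have "r \<odot>\<^bsub>M\<^esub> z \<ominus>\<^bsub>M\<^esub> r \<odot>\<^bsub>M\<^esub> x = r \<odot>\<^bsub>M\<^esub> (z \<ominus>\<^bsub>M\<^esub> x)"
        using z' \<open>x \<in> carrier M\<close> \<open>r \<in> carrier k\<close>
        by (simp add: a_minus_def M.smult_r_distr M.smult_r_minus)
      then show ?thesis
        using z' \<open>x \<in> carrier M\<close> \<open>r \<in> carrier k\<close> Hs(4)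
        by (simp add: quot_class_eq_iff[OF assms])
    qed
    moreover have xx: "x \<in> H +>\<^bsub>M\<^esub> x"
      using that(2) Hs(2) by (simp add: I M.M.r_neg a_minus_def)
    ultimately have "(\<Union>z\<in>H +>\<^bsub>M\<^esub> x. H +>\<^bsub>M\<^esub> (r \<odot>\<^bsub>M\<^esub> z))
        = (\<Union>z\<in>H +>\<^bsub>M\<^esub> x. H +>\<^bsub>M\<^esub> (r \<odot>\<^bsub>M\<^esub> x))"
      by (intro SUP_cong refl)
    also have "\<dots> = H +>\<^bsub>M\<^esub> (r \<odot>\<^bsub>M\<^esub> x)" using xx by blast
    finally show ?thesis by (simp add: quot_mod_def)
  qed
qed

text \<open>The module axioms are equations, so they pass along a surjection that preserves the operations. This
  gives the module structure on a quotient.\<close>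

lemma module_of_surjection:
  assumes "module k M" "p ` carrier M = carrier N" "\<zero>\<^bsub>N\<^esub> = p \<zero>\<^bsub>M\<^esub>"
    and add: "\<And>x y. x \<in> carrier M \<Longrightarrow> y \<in> carrier M \<Longrightarrow> p x \<oplus>\<^bsub>N\<^esub> p y = p (x \<oplus>\<^bsub>M\<^esub> y)"
    and sm: "\<And>r x. r \<in> carrier k \<Longrightarrow> x \<in> carrier M \<Longrightarrow> r \<odot>\<^bsub>N\<^esub> p x = p (r \<odot>\<^bsub>M\<^esub> x)"
  shows "module k N"
proof -
  interpret M: module k M by fact
  have lift: "\<exists>a\<in>carrier M. x = p a" if "x \<in> carrier N" for x
    using that assms(2) by blast
  have cl: "p a \<in> carrier N" if "a \<in> carrier M" for a using that assms(2) by blast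
  note [simp] = cl assms(3) add sm
  show ?thesis
  proof (rule moduleI)
    show "cring k" by (rule M.R.is_cring)
    show "abelian_group N"
    proof (rule abelian_groupI)
      show "\<exists>y\<in>carrier N. y \<oplus>\<^bsub>N\<^esub> x = \<zero>\<^bsub>N\<^esub>" if x: "x \<in> carrier N" for x
      proof -
        obtain a where a: "a \<in> carrier M" "x = p a" using lift[OF x] by blast
        then have "p (\<ominus>\<^bsub>M\<^esub> a) \<oplus>\<^bsub>N\<^esub> p a = \<zero>\<^bsub>N\<^esub>" by (simp add: M.M.l_neg)
        moreover have "p (\<ominus>\<^bsub>M\<^esub> a) \<in> carrier N" using a by simp
        ultimately show ?thesis using a by blast
      qed
    qed (auto dest!: lift simp: M.M.a_ac)
  qed (auto dest!: lift simp: M.smult_l_distr M.smult_r_distr M.smult_assoc1)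
qed

lemma module_quot_mod:
  assumes "module k M" "submodule H k M" shows "module k (quot_mod M H)"
  by (rule module_of_surjection[OF assms(1), where p = "\<lambda>x. H +>\<^bsub>M\<^esub> x"])
    (auto simp: carrier_quot_mod quot_mod_ops[OF assms])

lemma quot_class_hom:
  assumes "module k M" "submodule H k M"
  shows "(\<lambda>x. H +>\<^bsub>M\<^esub> x) \<in> mod_hom k M (quot_mod M H)"
  by (rule mod_homI) (auto simp: carrier_quot_mod quot_mod_ops[OF assms])

lemma quot_class_eq_zero_iff:
  assumes "module k M" "submodule H k M" "x \<in> carrier M"
  shows "H +>\<^bsub>M\<^esub> x = \<zero>\<^bsub>quot_mod M H\<^esub> \<longleftrightarrow> x \<in> H"
proof -
  interpret M: module k M by fact
  have minus_zero: "\<ominus>\<^bsub>M\<^esub> \<zero>\<^bsub>M\<^esub> = \<zero>\<^bsub>M\<^esub>" by (rule M.M.minus_equality) auto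
  show ?thesis using assms(3)
    by (simp add: minus_zero quot_mod_zero[OF assms(1,2)] quot_class_eq_iff[OF assms(1,2)] a_minus_def)
qed

lemma quot_lift:
  assumes "module k M" "module k N" "submodule H k M" "h \<in> mod_hom k M N"
    and "\<And>x. x \<in> H \<Longrightarrow> h x = \<zero>\<^bsub>N\<^esub>"
  shows "\<exists>h' \<in> mod_hom k (quot_mod M H) N. \<forall>x\<in>carrier M. h' (H +>\<^bsub>M\<^esub> x) = h x"
proof -
  interpret M: module k M by fact
  interpret N: module k N by fact
  note Hs = submoduleD[OF assms(1,3)] and I = mem_coset_iff[OF assms(1,3)]
  define h' where "h' Z = h (SOME z. z \<in> Z)" for Z
  have h': "h' (H +>\<^bsub>M\<^esub> x) = h x" if x: "x \<in> carrier M" for x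
  proof -
    have "x \<in> H +>\<^bsub>M\<^esub> x" using x Hs(2) by (simp add: I M.M.r_neg a_minus_def)
    then have "(SOME z. z \<in> H +>\<^bsub>M\<^esub> x) \<in> H +>\<^bsub>M\<^esub> x" by (rule someI)
    moreover have "h z = h x" if "z \<in> H +>\<^bsub>M\<^esub> x" for z
    proof -
      have z: "z \<in> carrier M" "z \<ominus>\<^bsub>M\<^esub> x \<in> H" using that x by (auto simp: I)
      have "h z \<ominus>\<^bsub>N\<^esub> h x = \<zero>\<^bsub>N\<^esub>"
        using mod_hom_minus[OF assms(1,2,4) z(1) x] assms(5)[OF z(2)] by simp
      moreover have "h z = (h z \<ominus>\<^bsub>N\<^esub> h x) \<oplus>\<^bsub>N\<^esub> h x"
        using mod_hom_closed[OF assms(4)] z(1) x by (simp add: a_minus_def N.M.a_assoc N.M.l_neg)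
      ultimately show ?thesis using mod_hom_closed[OF assms(4)] x by simp
    qed
    ultimately show ?thesis by (simp add: h'_def)
  qed
  have "h' \<in> mod_hom k (quot_mod M H) N"
    by (rule mod_homI)
      (auto simp: carrier_quot_mod quot_mod_ops[OF assms(1,3)] h' mod_homD[OF assms(4)])
  then show ?thesis using h' by auto
qed

lemma generates_quot_mod:
  assumes "module k M" "submodule H k M" "generates k M E"
  shows "generates k (quot_mod M H) ((\<lambda>x. H +>\<^bsub>M\<^esub> x) ` E)"
  unfolding generates_def
proof (intro conjI allI impI)
  show "(\<lambda>x. H +>\<^bsub>M\<^esub> x) ` E \<subseteq> carrier (quot_mod M H)"
    using generates_subset[OF assms(3)] by (auto simp: carrier_quot_mod)
  fix L assume L: "submodule L k (quot_mod M H)" "(\<lambda>x. H +>\<^bsub>M\<^esub> x) ` E \<subseteq> L"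
  note S = submodule_preimage[OF assms(1) module_quot_mod[OF assms(1,2)] quot_class_hom[OF assms(1,2)] L(1)]
  have "carrier M \<subseteq> {x \<in> carrier M. H +>\<^bsub>M\<^esub> x \<in> L}"
    using generatesD[OF assms(3) S] L(2) generates_subset[OF assms(3)] by auto
  then show "carrier (quot_mod M H) \<subseteq> L" by (auto simp: carrier_quot_mod)
qed

lemma submod_gen_submodule:
  assumes "module k M" "S \<subseteq> carrier M" shows "submodule (submod_gen k M S) k M"
  unfolding submod_gen_def
  by (rule submodule_Inter[OF assms(1)])
    (use module.carrier_is_submodule[OF assms(1)] assms(2) in auto)

lemma submod_gen_superset: "S \<subseteq> submod_gen k M S"
  by (auto simp: submod_gen_def)

lemma submod_gen_least: "submodule H k M \<Longrightarrow> S \<subseteq> H \<Longrightarrow> submod_gen k M S \<subseteq> H"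
  by (auto simp: submod_gen_def)

lemma mod_hom_vanishes_on_submod_gen:
  assumes "module k M" "module k N" "h \<in> mod_hom k M N" "S \<subseteq> carrier M"
    and "\<And>s. s \<in> S \<Longrightarrow> h s = \<zero>\<^bsub>N\<^esub>" "x \<in> submod_gen k M S"
  shows "h x = \<zero>\<^bsub>N\<^esub>"
  using submod_gen_least[OF submodule_preimage[OF assms(1-3) submodule_zero[OF assms(2)]], of S]
    assms(4-6) by auto

text \<open>The universal property of a module given by generators and relations.\<close>

lemma presented_lift:
  assumes "module k F" "module k N" "R \<subseteq> carrier F" "h \<in> mod_hom k F N"
    and "\<And>s. s \<in> R \<Longrightarrow> h s = \<zero>\<^bsub>N\<^esub>"
  shows "\<exists>h' \<in> mod_hom k (quot_mod F (submod_gen k F R)) N.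
    \<forall>x\<in>carrier F. h' (submod_gen k F R +>\<^bsub>F\<^esub> x) = h x"
  by (rule quot_lift[OF assms(1,2) submod_gen_submodule[OF assms(1,3)] assms(4)
        mod_hom_vanishes_on_submod_gen[OF assms(1,2,4,3,5)]])


section \<open>Direct sums and free modules\<close>

lemma carrier_dsum:
  "c \<in> carrier (dsum Z M) \<longleftrightarrow>
    c \<in> extensional Z \<and> (\<forall>x\<in>Z. c x \<in> carrier (M x)) \<and> finite {x\<in>Z. c x \<noteq> \<zero>\<^bsub>M x\<^esub>}"
  by (auto simp: dsum_def PiE_def)

lemma dsum_ops:
  "\<zero>\<^bsub>dsum Z M\<^esub> = (\<lambda>x\<in>Z. \<zero>\<^bsub>M x\<^esub>)"
  "c \<oplus>\<^bsub>dsum Z M\<^esub> d = (\<lambda>x\<in>Z. c x \<oplus>\<^bsub>M x\<^esub> d x)"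
  "r \<odot>\<^bsub>dsum Z M\<^esub> c = (\<lambda>x\<in>Z. r \<odot>\<^bsub>M x\<^esub> c x)"
  by (simp_all add: dsum_def)

lemma module_dsum:
  fixes M :: "'x \<Rightarrow> ('k,'m) module"
  assumes "cring k" and M: "\<And>x. x \<in> Z \<Longrightarrow> module k (M x)"
  shows "module k (dsum Z M)"
proof -
  interpret k: cring k by fact
  note ag = module.axioms(2)[OF M]
  have am: "abelian_monoid (M x)" if "x \<in> Z" for x using ag[OF that] by (rule abelian_group.axioms(1))
  note facts = abelian_monoid.zero_closed[OF am] abelian_monoid.a_closed[OF am] module.smult_closed[OF M]
    abelian_monoid.l_zero[OF am] abelian_monoid.r_zero[OF am] abelian_monoid.a_assoc[OF am]
    abelian_monoid.a_comm[OF am] abelian_monoid.a_lcomm[OF am]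
    abelian_group.a_inv_closed[OF ag] abelian_group.l_neg[OF ag] abelian_group.r_neg[OF ag]
    module.smult_l_distr[OF M] module.smult_r_distr[OF M] module.smult_assoc1[OF M] module.smult_one[OF M]
    module.smult_r_null[OF M]
  have supp_add: "finite {x\<in>Z. c x \<oplus>\<^bsub>M x\<^esub> d x \<noteq> \<zero>\<^bsub>M x\<^esub>}"
    if "finite {x\<in>Z. c x \<noteq> \<zero>\<^bsub>M x\<^esub>}" "finite {x\<in>Z. d x \<noteq> \<zero>\<^bsub>M x\<^esub>}" for c d
    by (rule finite_subset[OF _ finite_UnI[OF that]]) (auto simp: facts)
  have supp_sm: "finite {x\<in>Z. r \<odot>\<^bsub>M x\<^esub> c x \<noteq> \<zero>\<^bsub>M x\<^esub>}"
    if "finite {x\<in>Z. c x \<noteq> \<zero>\<^bsub>M x\<^esub>}" "r \<in> carrier k" for c r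
    by (rule finite_subset[OF _ that(1)]) (use that(2) in \<open>auto simp: facts\<close>)
  have restrict_neq: "{x. (x \<in> Z \<longrightarrow> f x \<noteq> \<zero>\<^bsub>M x\<^esub>) \<and> x \<in> Z} = {x\<in>Z. f x \<noteq> \<zero>\<^bsub>M x\<^esub>}" for f
    by auto
  note cd = carrier_dsum dsum_ops restrict_neq
  have ext: "c = d \<longleftrightarrow> (\<forall>x\<in>Z. c x = d x)" if "c \<in> extensional Z" "d \<in> extensional Z" for c d :: "'x \<Rightarrow> 'm"
    using that by (auto intro: extensionalityI)
  show ?thesis
  proof (rule moduleI)
    show "abelian_group (dsum Z M)"
    proof (rule abelian_groupI)
      show "\<exists>d\<in>carrier (dsum Z M). d \<oplus>\<^bsub>dsum Z M\<^esub> c = \<zero>\<^bsub>dsum Z M\<^esub>"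
        if "c \<in> carrier (dsum Z M)" for c
      proof (rule bexI[of _ "(\<ominus>\<^bsub>k\<^esub> \<one>\<^bsub>k\<^esub>) \<odot>\<^bsub>dsum Z M\<^esub> c"])
        show "(\<ominus>\<^bsub>k\<^esub> \<one>\<^bsub>k\<^esub>) \<odot>\<^bsub>dsum Z M\<^esub> c \<in> carrier (dsum Z M)"
          using that by (auto simp: cd facts supp_sm)
        show "(\<ominus>\<^bsub>k\<^esub> \<one>\<^bsub>k\<^esub>) \<odot>\<^bsub>dsum Z M\<^esub> c \<oplus>\<^bsub>dsum Z M\<^esub> c = \<zero>\<^bsub>dsum Z M\<^esub>"
          using that by (auto simp: cd ext facts module.smult_l_minus[OF M])
      qed
    qed (auto simp: cd ext facts supp_add)
  qed (auto simp: cd ext facts supp_sm \<open>cring k\<close>)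
qed

lemma dincl_hom:
  assumes "\<And>x. x \<in> Z \<Longrightarrow> module k (M x)" "x \<in> Z"
  shows "dincl Z M x \<in> mod_hom k (M x) (dsum Z M)"
proof (rule mod_homI)
  note ag = module.axioms(2)[OF assms(1)]
  have am: "abelian_monoid (M x)" if "x \<in> Z" for x using ag[OF that] by (rule abelian_group.axioms(1))
  note facts = abelian_monoid.zero_closed[OF am] abelian_monoid.a_closed[OF am]
    abelian_monoid.l_zero[OF am] module.smult_r_null[OF assms(1)]
  show "dincl Z M x m \<in> carrier (dsum Z M)" if "m \<in> carrier (M x)" for m
    using that by (auto simp: carrier_dsum dincl_def facts intro!: finite_subset[of _ "{x}"])
  show "dincl Z M x (m \<oplus>\<^bsub>M x\<^esub> n) = dincl Z M x m \<oplus>\<^bsub>dsum Z M\<^esub> dincl Z M x n" for m n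
    by (auto simp: dincl_def dsum_ops facts)
  show "dincl Z M x (r \<odot>\<^bsub>M x\<^esub> m) = r \<odot>\<^bsub>dsum Z M\<^esub> dincl Z M x m" if "r \<in> carrier k" for r m
    using that by (auto simp: dincl_def dsum_ops facts)
qed

lemma dincl_zero: "dincl Z M x \<zero>\<^bsub>M x\<^esub> = \<zero>\<^bsub>dsum Z M\<^esub>"
  by (auto simp: dincl_def dsum_ops)

text \<open>The sum of the given maps over the components. The support of the argument varies, so additivity is
  checked by summing over a common finite set that contains all supports involved.\<close>

lemma dsum_lift:
  assumes "cring k" "\<And>x. x \<in> Z \<Longrightarrow> module k (M x)" "module k N"
    and hs: "\<And>x. x \<in> Z \<Longrightarrow> h x \<in> mod_hom k (M x) N"
  shows "\<exists>g \<in> mod_hom k (dsum Z M) N. \<forall>x\<in>Z. \<forall>m\<in>carrier (M x). g (dincl Z M x m) = h x m"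
proof -
  interpret N: module k N by fact
  interpret D: module k "dsum Z M" by (rule module_dsum[OF assms(1,2)])
  note ag = module.axioms(2)[OF assms(2)]
  have am: "abelian_monoid (M x)" if "x \<in> Z" for x using ag[OF that] by (rule abelian_group.axioms(1))
  note facts = abelian_monoid.zero_closed[OF am] abelian_monoid.a_closed[OF am]
    abelian_monoid.l_zero[OF am] module.smult_r_null[OF assms(2)]
  define supp where "supp c = {x\<in>Z. c x \<noteq> \<zero>\<^bsub>M x\<^esub>}" for c
  define g where "g c = (\<Oplus>\<^bsub>N\<^esub>x\<in>supp c. h x (c x))" for c
  \<comment> \<open>the sum may be taken over any finite set containing the support\<close>
  have g_eq: "g c = (\<Oplus>\<^bsub>N\<^esub>x\<in>X. h x (c x))"
    if "finite X" "X \<subseteq> Z" "supp c \<subseteq> X" "c \<in> carrier (dsum Z M)" for c X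
    unfolding g_def
  proof (rule N.M.add.finprod_mono_neutral_cong_left[OF that(1,3)])
    show "h i (c i) = \<zero>\<^bsub>N\<^esub>" if "i \<in> X - supp c" for i
      using that \<open>X \<subseteq> Z\<close> mod_hom_zero[OF assms(2,3) hs] by (auto simp: supp_def)
    show "(\<lambda>x. h x (c x)) \<in> X \<rightarrow> carrier N"
      using that mod_hom_closed[OF hs] by (auto simp: carrier_dsum)
  qed simp
  have gcl: "(\<lambda>x. h x (c x)) \<in> X \<rightarrow> carrier N" if "c \<in> carrier (dsum Z M)" "X \<subseteq> Z" for c X
    using that mod_hom_closed[OF hs] by (auto simp: carrier_dsum)
  have "g \<in> mod_hom k (dsum Z M) N"
  proof (rule mod_homI)
    show "g c \<in> carrier N" if "c \<in> carrier (dsum Z M)" for c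
      unfolding g_def using gcl[OF that, of "supp c"] by (auto simp: supp_def)
    show "g (c \<oplus>\<^bsub>dsum Z M\<^esub> d) = g c \<oplus>\<^bsub>N\<^esub> g d"
      if "c \<in> carrier (dsum Z M)" "d \<in> carrier (dsum Z M)" for c d
    proof -
      let ?X = "supp c \<union> supp d"
      have X: "finite ?X" "?X \<subseteq> Z" using that by (auto simp: supp_def carrier_dsum)
      have s: "supp (c \<oplus>\<^bsub>dsum Z M\<^esub> d) \<subseteq> ?X" by (auto simp: supp_def dsum_ops facts)
      have "g (c \<oplus>\<^bsub>dsum Z M\<^esub> d) = (\<Oplus>\<^bsub>N\<^esub>x\<in>?X. h x (c x) \<oplus>\<^bsub>N\<^esub> h x (d x))"
        unfolding g_eq[OF X s D.M.a_closed[OF that]]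
        using gcl[OF that(1) X(2)] gcl[OF that(2) X(2)] that X(2)
        by (intro N.M.add.finprod_cong')
          (auto simp: dsum_ops carrier_dsum mod_hom_add[OF hs] subset_eq Pi_iff)
      also have "\<dots> = g c \<oplus>\<^bsub>N\<^esub> g d"
        using N.M.finsum_addf[OF gcl[OF that(1) X(2)] gcl[OF that(2) X(2)]]
          g_eq[OF X _ that(1)] g_eq[OF X _ that(2)] by simp
      finally show ?thesis .
    qed
    show "g (r \<odot>\<^bsub>dsum Z M\<^esub> c) = r \<odot>\<^bsub>N\<^esub> g c"
      if "r \<in> carrier k" "c \<in> carrier (dsum Z M)" for r c
    proof -
      let ?X = "supp c"
      have X: "finite ?X" "?X \<subseteq> Z" using that by (auto simp: supp_def carrier_dsum)
      have s: "supp (r \<odot>\<^bsub>dsum Z M\<^esub> c) \<subseteq> ?X" using that by (auto simp: supp_def dsum_ops facts)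
      have "g (r \<odot>\<^bsub>dsum Z M\<^esub> c) = (\<Oplus>\<^bsub>N\<^esub>x\<in>?X. r \<odot>\<^bsub>N\<^esub> h x (c x))"
        unfolding g_eq[OF X s D.smult_closed[OF that]]
        using gcl[OF that(2) X(2)] that X(2)
        by (intro N.M.add.finprod_cong')
          (auto simp: dsum_ops carrier_dsum mod_hom_smult[OF hs] subset_eq Pi_iff)
      also have "\<dots> = r \<odot>\<^bsub>N\<^esub> g c"
        using N.finsum_smult_ldistr[OF X(1) that(1) gcl[OF that(2) X(2)]] by (simp add: g_def)
      finally show ?thesis .
    qed
  qed
  moreover have "g (dincl Z M x m) = h x m" if "x \<in> Z" "m \<in> carrier (M x)" for x m
  proof -
    have c: "dincl Z M x m \<in> carrier (dsum Z M)"
      by (rule mod_hom_closed[OF dincl_hom[where M = M and Z = Z, OF assms(2) that(1)] that(2)])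
    have "supp (dincl Z M x m) \<subseteq> {x}" by (auto simp: supp_def dincl_def)
    then have "g (dincl Z M x m) = (\<Oplus>\<^bsub>N\<^esub>z\<in>{x}. h z (dincl Z M x m z))"
      using g_eq[of "{x}"] c that by auto
    also have "\<dots> = h x (dincl Z M x m x)"
      using gcl[OF c, of "{x}"] that by auto
    finally show ?thesis using that by (simp add: dincl_def)
  qed
  ultimately show ?thesis by blast
qed

lemma generates_dsum:
  assumes "cring k" "\<And>x. x \<in> Z \<Longrightarrow> module k (M x)" "\<And>x. x \<in> Z \<Longrightarrow> generates k (M x) (E x)"
  shows "generates k (dsum Z M) {dincl Z M x m |x m. x \<in> Z \<and> m \<in> E x}"
  unfolding generates_def
proof (intro conjI allI impI)
  note D = module_dsum[OF assms(1,2)]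
  show "{dincl Z M x m |x m. x \<in> Z \<and> m \<in> E x} \<subseteq> carrier (dsum Z M)"
    using mod_hom_closed[OF dincl_hom[where M = M and Z = Z, OF assms(2)]] generates_subset[OF assms(3)] by blast
  fix H assume H: "submodule H k (dsum Z M)" "{dincl Z M x m |x m. x \<in> Z \<and> m \<in> E x} \<subseteq> H"
  note Hs = submoduleD[OF D H(1)]
  note am = abelian_group.axioms(1)[OF module.axioms(2)[OF assms(2)]]
  note facts = abelian_monoid.zero_closed[OF am] abelian_monoid.r_zero[OF am] abelian_monoid.l_zero[OF am]
  have dH: "dincl Z M x m \<in> H" if "x \<in> Z" "m \<in> carrier (M x)" for x m
  proof -
    have "submodule {m \<in> carrier (M x). dincl Z M x m \<in> H} k (M x)"
      by (rule submodule_preimage[OF assms(2)[OF that(1)] D dincl_hom[where M = M and Z = Z, OF assms(2) that(1)] H(1)])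
    from generatesD[OF assms(3)[OF that(1)] this] show ?thesis
      using H(2) generates_subset[OF assms(3)[OF that(1)]] that by blast
  qed
  have "c \<in> H" if "finite X" "{x\<in>Z. c x \<noteq> \<zero>\<^bsub>M x\<^esub>} = X" "c \<in> carrier (dsum Z M)" for X c
    using that
  proof (induction X arbitrary: c rule: finite_induct)
    case empty
    then have "c = \<zero>\<^bsub>dsum Z M\<^esub>"
      by (intro extensionalityI[of _ Z]) (auto simp: dsum_ops carrier_dsum)
    then show ?case using Hs(2) by simp
  next
    case (insert a X)
    \<comment> \<open>split off one component\<close>
    define d where "d = c(a := \<zero>\<^bsub>M a\<^esub>)"
    have aZ: "a \<in> Z" using insert.prems(1) by auto
    have ds: "{x\<in>Z. d x \<noteq> \<zero>\<^bsub>M x\<^esub>} = X" using insert by (auto simp: d_def)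
    have "d \<in> carrier (dsum Z M)" using insert ds aZ facts[OF aZ]
      by (auto simp: carrier_dsum extensional_def d_def)
    then have "d \<in> H" using insert.IH ds by blast
    moreover have "c = dincl Z M a (c a) \<oplus>\<^bsub>dsum Z M\<^esub> d"
      using insert.prems(2) aZ
      by (intro extensionalityI[of _ Z]) (auto simp: dsum_ops carrier_dsum d_def dincl_def facts)
    moreover have "dincl Z M a (c a) \<in> H" using dH aZ insert.prems(2) by (auto simp: carrier_dsum)
    ultimately show ?case using Hs(3) by metis
  qed
  then show "carrier (dsum Z M) \<subseteq> H" by (auto simp: carrier_dsum)
qed

lemma reg_mod_simps [simp]: "carrier (reg_mod k) = carrier k" "\<zero>\<^bsub>reg_mod k\<^esub> = \<zero>\<^bsub>k\<^esub>"
  "x \<oplus>\<^bsub>reg_mod k\<^esub> y = x \<oplus>\<^bsub>k\<^esub> y" "x \<odot>\<^bsub>reg_mod k\<^esub> y = x \<otimes>\<^bsub>k\<^esub> y"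
  by (auto simp: reg_mod_def)

lemma module_reg_mod: assumes "cring k" shows "module k (reg_mod k)"
proof -
  interpret cring k by fact
  have "abelian_group (reg_mod k)"
  proof (rule abelian_groupI)
    show "\<exists>y\<in>carrier (reg_mod k). y \<oplus>\<^bsub>reg_mod k\<^esub> x = \<zero>\<^bsub>reg_mod k\<^esub>"
      if "x \<in> carrier (reg_mod k)" for x
      using that by (intro bexI[of _ "\<ominus>\<^bsub>k\<^esub> x"]) (auto simp: l_neg)
  qed (auto simp: a_ac)
  then show ?thesis
    by (rule moduleI[OF assms]) (auto simp: l_distr r_distr m_assoc)
qed

lemma reg_mod_lift:
  assumes "module k N" "n \<in> carrier N"
  shows "(\<lambda>r. r \<odot>\<^bsub>N\<^esub> n) \<in> mod_hom k (reg_mod k) N"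
proof -
  interpret module k N by fact
  show ?thesis using assms(2) by (intro mod_homI) (auto simp: smult_l_distr smult_assoc1)
qed

lemma generates_reg_mod: assumes "cring k" shows "generates k (reg_mod k) {\<one>\<^bsub>k\<^esub>}"
proof -
  interpret cring k by fact
  show ?thesis unfolding generates_def
  proof (intro conjI allI impI subsetI)
    fix H x assume "submodule H k (reg_mod k)" "{\<one>\<^bsub>k\<^esub>} \<subseteq> H" "x \<in> carrier (reg_mod k)"
    then show "x \<in> H" using submoduleD(4)[OF module_reg_mod[OF assms], of H x "\<one>\<^bsub>k\<^esub>"] by auto
  qed auto
qed

lemma module_free_mod: "cring k \<Longrightarrow> module k (free_mod k P)"
  unfolding free_mod_def by (intro module_dsum module_reg_mod)

lemma basis_elt_closed: assumes "cring k" shows "basis_elt k P x \<in> carrier (free_mod k P)"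
proof -
  interpret cring k by fact
  show ?thesis
    by (auto simp: carrier_dsum basis_elt_def free_mod_def dincl_def intro!: finite_subset[of _ "{x}"])
qed

lemma free_mod_lift:
  assumes "module k N" "\<And>p. p \<in> P \<Longrightarrow> v p \<in> carrier N"
  shows "\<exists>h \<in> mod_hom k (free_mod k P) N. \<forall>p\<in>P. h (basis_elt k P p) = v p"
proof -
  interpret N: module k N by fact
  have "\<exists>g \<in> mod_hom k (dsum P (\<lambda>_. reg_mod k)) N.
    \<forall>x\<in>P. \<forall>m\<in>carrier (reg_mod k). g (dincl P (\<lambda>_. reg_mod k) x m) = m \<odot>\<^bsub>N\<^esub> v x"
    by (rule dsum_lift[OF N.R.is_cring module_reg_mod[OF N.R.is_cring] assms(1)])
      (rule reg_mod_lift[OF assms(1,2)])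
  then obtain g where g: "g \<in> mod_hom k (dsum P (\<lambda>_. reg_mod k)) N"
    "\<And>x m. x \<in> P \<Longrightarrow> m \<in> carrier k \<Longrightarrow> g (dincl P (\<lambda>_. reg_mod k) x m) = m \<odot>\<^bsub>N\<^esub> v x"
    by auto
  have "g (basis_elt k P p) = v p" if "p \<in> P" for p
    using g(2)[OF that, of "\<one>\<^bsub>k\<^esub>"] assms(2)[OF that] by (simp add: basis_elt_def)
  then show ?thesis using g(1) unfolding free_mod_def by blast
qed

lemma generates_free_mod:
  assumes "cring k" shows "generates k (free_mod k P) (basis_elt k P ` P)"
proof -
  have "basis_elt k P ` P = {dincl P (\<lambda>_. reg_mod k) x m |x m. x \<in> P \<and> m \<in> {\<one>\<^bsub>k\<^esub>}}"
    by (auto simp: basis_elt_def)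
  then show ?thesis unfolding free_mod_def
    using generates_dsum[where Z = P, OF assms module_reg_mod[OF assms] generates_reg_mod[OF assms]]
    by simp
qed


section \<open>Tensor powers and tensor products\<close>

lemma tuples_upd: "y \<in> tuples n M \<Longrightarrow> i \<in> {1..n} \<Longrightarrow> u \<in> carrier M \<Longrightarrow> y(i := u) \<in> tuples n M"
  by (auto simp: tuples_def PiE_def extensional_def)

lemma tpow_rels_subset:
  assumes "cring k"
  shows "tpow_rels k M n \<subseteq> carrier (free_mod k (tuples n M))"
proof -
  interpret F: module k "free_mod k (tuples n M)" by (rule module_free_mod[OF assms])
  show ?thesis by (auto simp: tpow_rels_def Let_def basis_elt_closed[OF assms] intro!: F.M.minus_closed)
qed

lemma tpow_sub_submodule:
  assumes "cring k" shows "submodule (tpow_sub k M n) k (free_mod k (tuples n M))"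
  unfolding tpow_sub_def
  by (rule submod_gen_submodule[OF module_free_mod[OF assms] tpow_rels_subset[OF assms]])

lemma module_tpow: "cring k \<Longrightarrow> module k (tpow k M n)"
  unfolding tpow_def by (intro module_quot_mod module_free_mod tpow_sub_submodule)

lemma pure_tens_closed: "cring k \<Longrightarrow> pure_tens k M n y \<in> carrier (tpow k M n)"
  by (auto simp: pure_tens_def tpow_def carrier_quot_mod basis_elt_closed)

lemma generates_tpow:
  assumes "cring k" shows "generates k (tpow k M n) (pure_tens k M n ` tuples n M)"
  using generates_quot_mod[OF module_free_mod[OF assms] tpow_sub_submodule[OF assms]
      generates_free_mod[OF assms], of n M]
  by (simp add: tpow_def pure_tens_def[abs_def] image_image)

lemma pure_tens_multilinear:
  assumes k: "cring k" and M: "module k M" and y: "y \<in> tuples n M" and i: "i \<in> {1..n}"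
  shows pure_tens_add: "u \<in> carrier M \<Longrightarrow> v \<in> carrier M \<Longrightarrow> pure_tens k M n (y(i := u \<oplus>\<^bsub>M\<^esub> v)) =
      pure_tens k M n (y(i := u)) \<oplus>\<^bsub>tpow k M n\<^esub> pure_tens k M n (y(i := v))"
    and pure_tens_smult: "r \<in> carrier k \<Longrightarrow> u \<in> carrier M \<Longrightarrow> pure_tens k M n (y(i := r \<odot>\<^bsub>M\<^esub> u)) =
      r \<odot>\<^bsub>tpow k M n\<^esub> pure_tens k M n (y(i := u))"
proof -
  let ?F = "free_mod k (tuples n M)" and ?b = "basis_elt k (tuples n M)"
  interpret F: module k ?F by (rule module_free_mod[OF k])
  note S = tpow_sub_submodule[OF k, of M n]
  note b = basis_elt_closed[OF k, of "tuples n M"]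
  have sub: "tpow_rels k M n \<subseteq> tpow_sub k M n" unfolding tpow_sub_def by (rule submod_gen_superset)
  show "pure_tens k M n (y(i := u \<oplus>\<^bsub>M\<^esub> v)) =
      pure_tens k M n (y(i := u)) \<oplus>\<^bsub>tpow k M n\<^esub> pure_tens k M n (y(i := v))"
    if "u \<in> carrier M" "v \<in> carrier M"
  proof -
    have "?b (y(i := u \<oplus>\<^bsub>M\<^esub> v)) \<ominus>\<^bsub>?F\<^esub> (?b (y(i := u)) \<oplus>\<^bsub>?F\<^esub> ?b (y(i := v))) \<in> tpow_rels k M n"
      unfolding tpow_rels_def Let_def using that y i by blast
    then show ?thesis unfolding pure_tens_def tpow_def
      using sub b by (auto simp: quot_mod_add[OF F.module_axioms S] quot_class_eq_iff[OF F.module_axioms S])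
  qed
  show "pure_tens k M n (y(i := r \<odot>\<^bsub>M\<^esub> u)) = r \<odot>\<^bsub>tpow k M n\<^esub> pure_tens k M n (y(i := u))"
    if "r \<in> carrier k" "u \<in> carrier M"
  proof -
    have "?b (y(i := r \<odot>\<^bsub>M\<^esub> u)) \<ominus>\<^bsub>?F\<^esub> (r \<odot>\<^bsub>?F\<^esub> ?b (y(i := u))) \<in> tpow_rels k M n"
      unfolding tpow_rels_def Let_def using that y i by blast
    then show ?thesis unfolding pure_tens_def tpow_def
      using sub b that(1)
      by (auto simp: quot_mod_smult[OF F.module_axioms S] quot_class_eq_iff[OF F.module_axioms S])
  qed
qed

text \<open>The relations of the tensor power say exactly that a map out of it is a multilinear map on tuples.\<close>

lemma tpow_lift:
  assumes k: "cring k" and M: "module k M" and N: "module k N"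
    and cl: "\<And>y. y \<in> tuples n M \<Longrightarrow> v y \<in> carrier N"
    and add: "\<And>y i a b. \<lbrakk>y \<in> tuples n M; i \<in> {1..n}; a \<in> carrier M; b \<in> carrier M\<rbrakk> \<Longrightarrow>
      v (y(i := a \<oplus>\<^bsub>M\<^esub> b)) = v (y(i := a)) \<oplus>\<^bsub>N\<^esub> v (y(i := b))"
    and sm: "\<And>y i r a. \<lbrakk>y \<in> tuples n M; i \<in> {1..n}; r \<in> carrier k; a \<in> carrier M\<rbrakk> \<Longrightarrow>
      v (y(i := r \<odot>\<^bsub>M\<^esub> a)) = r \<odot>\<^bsub>N\<^esub> v (y(i := a))"
  shows "\<exists>h \<in> mod_hom k (tpow k M n) N. \<forall>y\<in>tuples n M. h (pure_tens k M n y) = v y"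
proof -
  let ?F = "free_mod k (tuples n M)" and ?b = "basis_elt k (tuples n M)"
  interpret M: module k M by (rule M)
  interpret F: module k ?F by (rule module_free_mod[OF k])
  note b = basis_elt_closed[OF k, of "tuples n M"]
  obtain h where h: "h \<in> mod_hom k ?F N" "\<And>y. y \<in> tuples n M \<Longrightarrow> h (?b y) = v y"
    using free_mod_lift[where P = "tuples n M" and v = v, OF N cl] by auto
  note H = mod_homD[OF h(1)] mod_hom_minus[OF F.module_axioms N h(1)]
  have "h s = \<zero>\<^bsub>N\<^esub>" if "s \<in> tpow_rels k M n" for s
    using that unfolding tpow_rels_def Let_def
  proof (elim UnE CollectE exE conjE)
    fix y i u w assume *: "s = ?b (y(i := u \<oplus>\<^bsub>M\<^esub> w)) \<ominus>\<^bsub>?F\<^esub> (?b (y(i := u)) \<oplus>\<^bsub>?F\<^esub> ?b (y(i := w)))"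
      "y \<in> tuples n M" "i \<in> {1..n}" "u \<in> carrier M" "w \<in> carrier M"
    then have "h s = v (y(i := u \<oplus>\<^bsub>M\<^esub> w)) \<ominus>\<^bsub>N\<^esub> (v (y(i := u)) \<oplus>\<^bsub>N\<^esub> v (y(i := w)))"
      by (simp add: H h(2) b tuples_upd del: fun_upd_apply)
    then show ?thesis using minus_self_eq_zero[OF N cl add[OF *(2-5)]] * by (simp add: tuples_upd)
  next
    fix y i r u assume *: "s = ?b (y(i := r \<odot>\<^bsub>M\<^esub> u)) \<ominus>\<^bsub>?F\<^esub> (r \<odot>\<^bsub>?F\<^esub> ?b (y(i := u)))"
      "y \<in> tuples n M" "i \<in> {1..n}" "r \<in> carrier k" "u \<in> carrier M"
    then have "h s = v (y(i := r \<odot>\<^bsub>M\<^esub> u)) \<ominus>\<^bsub>N\<^esub> (r \<odot>\<^bsub>N\<^esub> v (y(i := u)))"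
      by (simp add: H h(2) b tuples_upd del: fun_upd_apply)
    then show ?thesis using minus_self_eq_zero[OF N cl sm[OF *(2-5)]] * by (simp add: tuples_upd)
  qed
  from presented_lift[OF F.module_axioms N tpow_rels_subset[OF k] h(1) this]
  obtain g where "g \<in> mod_hom k (tpow k M n) N" "\<forall>x\<in>carrier ?F. g (tpow_sub k M n +>\<^bsub>?F\<^esub> x) = h x"
    by (auto simp: tpow_def tpow_sub_def)
  then show ?thesis using b h(2) by (auto simp: pure_tens_def intro!: bexI[of _ g])
qed

lemma tens_rels_subset:
  assumes "module k M" "module k N"
  shows "tens_rels k M N \<subseteq> carrier (free_mod k (carrier M \<times> carrier N))"
proof -
  interpret M: module k M by fact
  note k = M.R.is_cring
  interpret F: module k "free_mod k (carrier M \<times> carrier N)" by (rule module_free_mod[OF k])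
  show ?thesis by (auto simp: tens_rels_def Let_def basis_elt_closed[OF k] intro!: F.M.minus_closed)
qed

lemma tens_sub_submodule:
  assumes "module k M" "module k N"
  shows "submodule (tens_sub k M N) k (free_mod k (carrier M \<times> carrier N))"
  unfolding tens_sub_def
  by (rule submod_gen_submodule[OF module_free_mod[OF module.axioms(1)] tens_rels_subset]) fact+

lemma module_tens_mod:
  assumes "module k M" "module k N" shows "module k (tens_mod k M N)"
  unfolding tens_mod_def
  by (rule module_quot_mod[OF module_free_mod[OF module.axioms(1)] tens_sub_submodule]) fact+

lemma tens_relsI:
  fixes k M N
  defines "F \<equiv> free_mod k (carrier M \<times> carrier N)" and "b \<equiv> basis_elt k (carrier M \<times> carrier N)"
  shows "\<lbrakk>x \<in> carrier M; x' \<in> carrier M; y \<in> carrier N\<rbrakk> \<Longrightarrow>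
      b (x \<oplus>\<^bsub>M\<^esub> x', y) \<ominus>\<^bsub>F\<^esub> (b (x, y) \<oplus>\<^bsub>F\<^esub> b (x', y)) \<in> tens_rels k M N"
    and "\<lbrakk>x \<in> carrier M; y \<in> carrier N; y' \<in> carrier N\<rbrakk> \<Longrightarrow>
      b (x, y \<oplus>\<^bsub>N\<^esub> y') \<ominus>\<^bsub>F\<^esub> (b (x, y) \<oplus>\<^bsub>F\<^esub> b (x, y')) \<in> tens_rels k M N"
    and "\<lbrakk>r \<in> carrier k; x \<in> carrier M; y \<in> carrier N\<rbrakk> \<Longrightarrow>
      b (r \<odot>\<^bsub>M\<^esub> x, y) \<ominus>\<^bsub>F\<^esub> (r \<odot>\<^bsub>F\<^esub> b (x, y)) \<in> tens_rels k M N"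
    and "\<lbrakk>r \<in> carrier k; x \<in> carrier M; y \<in> carrier N\<rbrakk> \<Longrightarrow>
      b (x, r \<odot>\<^bsub>N\<^esub> y) \<ominus>\<^bsub>F\<^esub> (r \<odot>\<^bsub>F\<^esub> b (x, y)) \<in> tens_rels k M N"
  unfolding tens_rels_def Let_def F_def b_def
  subgoal by (rule UnI1, rule UnI1, rule UnI1, rule CollectI, intro exI conjI, rule refl)
  subgoal by (rule UnI1, rule UnI1, rule UnI2, rule CollectI, intro exI conjI, rule refl)
  subgoal by (rule UnI1, rule UnI2, rule CollectI, intro exI conjI, rule refl)
  subgoal by (rule UnI2, rule CollectI, intro exI conjI, rule refl)
  done

lemma tens_bilinear:
  assumes M: "module k M" and N: "module k N"
  shows tens_hom_left: "y \<in> carrier N \<Longrightarrow> (\<lambda>x. tens k M N x y) \<in> mod_hom k M (tens_mod k M N)"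
    and tens_hom_right: "x \<in> carrier M \<Longrightarrow> (\<lambda>y. tens k M N x y) \<in> mod_hom k N (tens_mod k M N)"
proof -
  interpret M: module k M by fact
  interpret N: module k N by fact
  note k = M.R.is_cring
  let ?P = "carrier M \<times> carrier N"
  let ?F = "free_mod k ?P" and ?b = "basis_elt k ?P"
  interpret F: module k ?F by (rule module_free_mod[OF k])
  note S = tens_sub_submodule[OF M N]
  note b = basis_elt_closed[OF k, of ?P]
  have sub: "s \<in> tens_sub k M N" if "s \<in> tens_rels k M N" for s
    unfolding tens_sub_def by (rule subsetD[OF submod_gen_superset that])
  note Q = quot_mod_add[OF F.module_axioms S] quot_mod_smult[OF F.module_axioms S]
    quot_class_eq_iff[OF F.module_axioms S]
  show "(\<lambda>x. tens k M N x y) \<in> mod_hom k M (tens_mod k M N)" if y: "y \<in> carrier N"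
  proof (rule mod_homI)
    fix x x' assume "x \<in> carrier M" "x' \<in> carrier M"
    then have "?b (x \<oplus>\<^bsub>M\<^esub> x', y) \<ominus>\<^bsub>?F\<^esub> (?b (x, y) \<oplus>\<^bsub>?F\<^esub> ?b (x', y)) \<in> tens_rels k M N"
      using y by (intro tens_relsI(1))
    from sub[OF this] show "tens k M N (x \<oplus>\<^bsub>M\<^esub> x') y = tens k M N x y \<oplus>\<^bsub>tens_mod k M N\<^esub> tens k M N x' y"
      unfolding tens_def tens_mod_def using b by (simp add: Q)
  next
    fix r x assume "r \<in> carrier k" "x \<in> carrier M"
    then have "?b (r \<odot>\<^bsub>M\<^esub> x, y) \<ominus>\<^bsub>?F\<^esub> (r \<odot>\<^bsub>?F\<^esub> ?b (x, y)) \<in> tens_rels k M N"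
      using y by (intro tens_relsI(3))
    from sub[OF this] show "tens k M N (r \<odot>\<^bsub>M\<^esub> x) y = r \<odot>\<^bsub>tens_mod k M N\<^esub> tens k M N x y"
      unfolding tens_def tens_mod_def using b \<open>r \<in> carrier k\<close> by (simp add: Q)
  qed (use b in \<open>auto simp: tens_def tens_mod_def carrier_quot_mod\<close>)
  show "(\<lambda>y. tens k M N x y) \<in> mod_hom k N (tens_mod k M N)" if x: "x \<in> carrier M"
  proof (rule mod_homI)
    fix y y' assume "y \<in> carrier N" "y' \<in> carrier N"
    then have "?b (x, y \<oplus>\<^bsub>N\<^esub> y') \<ominus>\<^bsub>?F\<^esub> (?b (x, y) \<oplus>\<^bsub>?F\<^esub> ?b (x, y')) \<in> tens_rels k M N"
      using x by (intro tens_relsI(2))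
    from sub[OF this] show "tens k M N x (y \<oplus>\<^bsub>N\<^esub> y') = tens k M N x y \<oplus>\<^bsub>tens_mod k M N\<^esub> tens k M N x y'"
      unfolding tens_def tens_mod_def using b by (simp add: Q)
  next
    fix r y assume "r \<in> carrier k" "y \<in> carrier N"
    then have "?b (x, r \<odot>\<^bsub>N\<^esub> y) \<ominus>\<^bsub>?F\<^esub> (r \<odot>\<^bsub>?F\<^esub> ?b (x, y)) \<in> tens_rels k M N"
      using x by (intro tens_relsI(4))
    from sub[OF this] show "tens k M N x (r \<odot>\<^bsub>N\<^esub> y) = r \<odot>\<^bsub>tens_mod k M N\<^esub> tens k M N x y"
      unfolding tens_def tens_mod_def using b \<open>r \<in> carrier k\<close> by (simp add: Q)
  qed (use b in \<open>auto simp: tens_def tens_mod_def carrier_quot_mod\<close>)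
qed

text \<open>One factor at a time: for a fixed generator \<open>y\<close>, the \<open>x\<close> with \<open>x \<otimes> y\<close> in a given submodule form a submodule,
  and so do, for fixed \<open>x\<close>, the \<open>y\<close>.\<close>

lemma generates_tens_mod:
  assumes M: "module k M" and N: "module k N" and E: "generates k M E" and G: "generates k N G"
  shows "generates k (tens_mod k M N) {tens k M N x y |x y. x \<in> E \<and> y \<in> G}"
proof -
  interpret M: module k M by fact
  let ?P = "carrier M \<times> carrier N"
  let ?T = "tens_mod k M N" and ?t = "tens k M N"
  note T = module_tens_mod[OF M N]
  note cl = mod_hom_closed[OF tens_hom_left[OF M N]]
  have "generates k ?T {?t x y |x y. x \<in> carrier M \<and> y \<in> carrier N}"
  proof -
    have "(\<lambda>x. tens_sub k M N +>\<^bsub>free_mod k ?P\<^esub> x) ` basis_elt k ?P ` ?P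
        = {?t x y |x y. x \<in> carrier M \<and> y \<in> carrier N}"
      by (auto simp: tens_def image_iff)
    then show ?thesis
      using generates_quot_mod[OF module_free_mod[OF M.R.is_cring] tens_sub_submodule[OF M N]
          generates_free_mod[OF M.R.is_cring]]
      by (simp add: tens_mod_def)
  qed
  then show ?thesis
  proof (rule generates_if_contains)
    show "{?t x y |x y. x \<in> E \<and> y \<in> G} \<subseteq> carrier ?T"
      using cl generates_subset[OF E] generates_subset[OF G] by blast
    fix H assume H: "submodule H k ?T" "{?t x y |x y. x \<in> E \<and> y \<in> G} \<subseteq> H"
    have 1: "?t x y \<in> H" if "x \<in> carrier M" "y \<in> G" for x y
    proof -
      have y: "y \<in> carrier N" using that generates_subset[OF G] by auto
      have "submodule {x \<in> carrier M. ?t x y \<in> H} k M"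
        by (rule submodule_preimage[OF M T tens_hom_left[OF M N y] H(1)])
      from generatesD[OF E this] show ?thesis using that H(2) generates_subset[OF E] by blast
    qed
    have "?t x y \<in> H" if x: "x \<in> carrier M" and y: "y \<in> carrier N" for x y
    proof -
      have "submodule {y \<in> carrier N. ?t x y \<in> H} k N"
        by (rule submodule_preimage[OF N T tens_hom_right[OF M N x] H(1)])
      from generatesD[OF G this] show ?thesis using x y 1 generates_subset[OF G] by blast
    qed
    then show "{?t x y |x y. x \<in> carrier M \<and> y \<in> carrier N} \<subseteq> H" by blast
  qed
qed

lemma tens_lift:
  assumes M: "module k M" and N: "module k N" and L: "module k L"
    and l: "\<And>y. y \<in> carrier N \<Longrightarrow> (\<lambda>x. v x y) \<in> mod_hom k M L"
    and r: "\<And>x. x \<in> carrier M \<Longrightarrow> (\<lambda>y. v x y) \<in> mod_hom k N L"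
  shows "\<exists>h \<in> mod_hom k (tens_mod k M N) L. \<forall>x\<in>carrier M. \<forall>y\<in>carrier N. h (tens k M N x y) = v x y"
proof -
  interpret M: module k M by fact
  interpret N: module k N by fact
  interpret L: module k L by fact
  note k = M.R.is_cring
  let ?P = "carrier M \<times> carrier N"
  let ?F = "free_mod k ?P" and ?b = "basis_elt k ?P"
  interpret F: module k ?F by (rule module_free_mod[OF k])
  note b = basis_elt_closed[OF k, of ?P]
  note vl = mod_homD[OF l] and vr = mod_homD[OF r]
  have "\<exists>h \<in> mod_hom k ?F L. \<forall>p\<in>?P. h (?b p) = (case p of (x, y) \<Rightarrow> v x y)"
    using vl(1) by (intro free_mod_lift[OF L]) auto
  then obtain h where h: "h \<in> mod_hom k ?F L"
    "\<And>x y. x \<in> carrier M \<Longrightarrow> y \<in> carrier N \<Longrightarrow> h (?b (x, y)) = v x y"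
    by auto
  note H = mod_homD[OF h(1)] mod_hom_minus[OF F.module_axioms L h(1)]
  have "h s = \<zero>\<^bsub>L\<^esub>" if "s \<in> tens_rels k M N" for s
    using that unfolding tens_rels_def Let_def
    by (elim UnE CollectE exE conjE)
      (simp_all add: H h(2) b vl minus_self_eq_zero[OF L _ refl] vr(2,3))
  from presented_lift[OF F.module_axioms L tens_rels_subset[OF M N] h(1) this]
  obtain g where "g \<in> mod_hom k (tens_mod k M N) L" "\<forall>x\<in>carrier ?F. g (tens_sub k M N +>\<^bsub>?F\<^esub> x) = h x"
    by (auto simp: tens_mod_def tens_sub_def)
  then show ?thesis using b h(2) by (auto simp: tens_def intro!: bexI[of _ g])
qed


section \<open>Alternating sums of faces\<close>

text \<open>Both sides sum over the pairs \<open>i \<le> j \<le> m\<close>.\<close>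

lemma (in abelian_monoid) finsum_triangle_swap:
  assumes "\<And>i j. f j i \<in> carrier G"
  shows "(\<Oplus>i\<in>{..m}. \<Oplus>j\<in>{i..m}. f j i) = (\<Oplus>j\<in>{..m::nat}. \<Oplus>i\<in>{..j}. f j i)"
proof (induction m)
  case 0
  then show ?case using assms by simp
next
  case (Suc m)
  have cl: "(\<lambda>i. g i) \<in> X \<rightarrow> carrier G" if "\<And>i. g i \<in> carrier G" for g :: "nat \<Rightarrow> 'a" and X using that by auto
  have split: "(\<Oplus>j\<in>{i..Suc m}. f j i) = f (Suc m) i \<oplus> (\<Oplus>j\<in>{i..m}. f j i)" if "i \<le> m" for i
  proof -
    have "{i..Suc m} = insert (Suc m) {i..m}" using that by auto
    then show ?thesis using assms by (simp add: finsum_insert)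
  qed
  have "(\<Oplus>i\<in>{..Suc m}. \<Oplus>j\<in>{i..Suc m}. f j i)
      = f (Suc m) (Suc m) \<oplus> (\<Oplus>i\<in>{..m}. \<Oplus>j\<in>{i..Suc m}. f j i)"
    using assms by (subst finsum_Suc) auto
  also have "(\<Oplus>i\<in>{..m}. \<Oplus>j\<in>{i..Suc m}. f j i) = (\<Oplus>i\<in>{..m}. f (Suc m) i \<oplus> (\<Oplus>j\<in>{i..m}. f j i))"
    using assms by (intro finsum_cong') (auto simp: split)
  also have "\<dots> = (\<Oplus>i\<in>{..m}. f (Suc m) i) \<oplus> (\<Oplus>i\<in>{..m}. \<Oplus>j\<in>{i..m}. f j i)"
    using assms by (intro finsum_addf) auto
  also have "(\<Oplus>i\<in>{..m}. \<Oplus>j\<in>{i..m}. f j i) = (\<Oplus>j\<in>{..m}. \<Oplus>i\<in>{..j}. f j i)" by (rule Suc.IH)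
  also have "f (Suc m) (Suc m) \<oplus> ((\<Oplus>i\<in>{..m}. f (Suc m) i) \<oplus> (\<Oplus>j\<in>{..m}. \<Oplus>i\<in>{..j}. f j i))
      = (\<Oplus>i\<in>{..Suc m}. f (Suc m) i) \<oplus> (\<Oplus>j\<in>{..m}. \<Oplus>i\<in>{..j}. f j i)"
    using assms by (subst finsum_Suc) (auto simp: a_assoc)
  also have "\<dots> = (\<Oplus>j\<in>{..Suc m}. \<Oplus>i\<in>{..j}. f j i)"
    using assms by (subst finsum_Suc) auto
  finally show ?case .
qed

lemma (in abelian_group) finsum_a_inv:
  assumes "finite X" "f \<in> X \<rightarrow> carrier G"
  shows "(\<Oplus>i\<in>X. \<ominus> f i) = \<ominus> (\<Oplus>i\<in>X. f i)"
  using assms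
proof (induction X)
  case empty
  have minus_zero: "\<ominus> \<zero> = \<zero>" by (rule minus_equality) auto
  show ?case by (simp add: minus_zero)
next
  case (insert a X)
  then have "f a \<in> carrier G" "f \<in> X \<rightarrow> carrier G" by auto
  then show ?case using insert by (subst finsum_insert) (auto simp: minus_add)
qed

definition signed :: "('a,'m) ring_scheme \<Rightarrow> nat \<Rightarrow> 'a \<Rightarrow> 'a" where
  "signed G i x = (if even i then x else \<ominus>\<^bsub>G\<^esub> x)"

lemma (in abelian_group) signed_closed [simp]: "x \<in> carrier G \<Longrightarrow> signed G i x \<in> carrier G"
  by (simp add: signed_def)

text \<open>The cancellation behind \<open>d \<circ> d = 0\<close>: the term at \<open>(i, j)\<close> with \<open>i < j\<close> equals the term at \<open>(j - 1, i)\<close>, and the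
  parities of \<open>i + j\<close> and \<open>j - 1 + i\<close> differ. This matches the terms above the diagonal with the others.\<close>

lemma (in abelian_group) alternating_double_sum_zero:
  assumes cl: "\<And>i j. x i j \<in> carrier G"
    and x: "\<And>i j. i < j \<Longrightarrow> j \<le> Suc m \<Longrightarrow> x i j = x (j - 1) i"
  shows "(\<Oplus>i\<in>{..m}. \<Oplus>j\<in>{..Suc m}. signed G (i + j) (x i j)) = \<zero>"
proof -
  define t where "t i j = signed G (i + j) (x i j)" for i j
  have t [simp]: "t i j \<in> carrier G" for i j using cl by (simp add: t_def)
  have flip: "t i (Suc j) = \<ominus> t j i" if "i \<le> j" "j \<le> m" for i j
    using x[of i "Suc j"] that cl by (auto simp: t_def signed_def add.commute)
  have split: "(\<Oplus>j\<in>{..Suc m}. t i j) = (\<Oplus>j\<in>{..i}. t i j) \<oplus> \<ominus> (\<Oplus>j\<in>{i..m}. t j i)" if "i \<le> m" for i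
  proof -
    \<comment> \<open>cut the row \<open>i\<close> after the diagonal and shift the second part, to which \<open>flip\<close> applies\<close>
    have "{..Suc m} = {..i} \<union> Suc ` {i..m}" using that by (auto simp: image_Suc_atLeastAtMost)
    then have "(\<Oplus>j\<in>{..Suc m}. t i j) = (\<Oplus>j\<in>{..i}. t i j) \<oplus> (\<Oplus>j\<in>Suc ` {i..m}. t i j)"
      by (simp only:) (rule finsum_Un_disjoint, auto)
    also have "(\<Oplus>j\<in>Suc ` {i..m}. t i j) = (\<Oplus>j\<in>{i..m}. t i (Suc j))"
      by (rule finsum_reindex) auto
    also have "\<dots> = (\<Oplus>j\<in>{i..m}. \<ominus> t j i)" by (rule finsum_cong') (auto simp: flip)
    also have "\<dots> = \<ominus> (\<Oplus>j\<in>{i..m}. t j i)" by (rule finsum_a_inv) auto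
    finally show ?thesis .
  qed
  have "(\<Oplus>i\<in>{..m}. \<Oplus>j\<in>{..Suc m}. t i j) = (\<Oplus>i\<in>{..m}. (\<Oplus>j\<in>{..i}. t i j) \<oplus> \<ominus> (\<Oplus>j\<in>{i..m}. t j i))"
    by (rule finsum_cong') (auto simp: split simp del: finsum_Suc)
  also have "\<dots> = (\<Oplus>i\<in>{..m}. \<Oplus>j\<in>{..i}. t i j) \<oplus> (\<Oplus>i\<in>{..m}. \<ominus> (\<Oplus>j\<in>{i..m}. t j i))"
    by (rule finsum_addf) auto
  also have "(\<Oplus>i\<in>{..m}. \<ominus> (\<Oplus>j\<in>{i..m}. t j i)) = \<ominus> (\<Oplus>i\<in>{..m}. \<Oplus>j\<in>{i..m}. t j i)"
    by (rule finsum_a_inv) auto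
  also have "(\<Oplus>i\<in>{..m}. \<Oplus>j\<in>{i..m}. t j i) = (\<Oplus>j\<in>{..m}. \<Oplus>i\<in>{..j}. t j i)"
    by (rule finsum_triangle_swap) simp
  also have "(\<Oplus>i\<in>{..m}. \<Oplus>j\<in>{..i}. t i j) \<oplus> \<ominus> (\<Oplus>j\<in>{..m}. \<Oplus>i\<in>{..j}. t j i) = \<zero>"
    by (rule r_neg) (auto intro!: finsum_closed)
  finally show ?thesis by (simp only: t_def)
qed

definition has_face_identities :: "'k ring \<Rightarrow> ('k,'c) simp_mod \<Rightarrow> bool" where
  "has_face_identities k Z \<longleftrightarrow>
    (\<forall>n i j c. i < j \<longrightarrow> j \<le> Suc (Suc n) \<longrightarrow> c \<in> carrier (smod Z (Suc (Suc n))) \<longrightarrow>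
      sface Z (Suc n) i (sface Z (Suc (Suc n)) j c) =
      sface Z (Suc n) (j - 1) (sface Z (Suc (Suc n)) i c))"

definition has_linear_faces :: "'k ring \<Rightarrow> ('k,'c) simp_mod \<Rightarrow> bool" where
  "has_linear_faces k Z \<longleftrightarrow> (\<forall>n. module k (smod Z n)) \<and>
    (\<forall>n i. i \<le> Suc n \<longrightarrow> sface Z (Suc n) i \<in> mod_hom k (smod Z (Suc n)) (smod Z n))"

lemma assoc_cx_mod [simp]: "cmod (assoc_cx Z) = smod Z"
  by (simp add: assoc_cx_def)

lemma assoc_cx_diff: "cdiff (assoc_cx Z) n c = (\<Oplus>\<^bsub>smod Z n\<^esub>i\<in>{..Suc n}. signed (smod Z n) i (sface Z (Suc n) i c))"
  by (simp only: assoc_cx_def signed_def atLeast0AtMost chain_cx.simps)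

lemma mod_hom_signed:
  assumes "module k N" "h \<in> mod_hom k M N" shows "(\<lambda>x. signed N i (h x)) \<in> mod_hom k M N"
  using assms mod_hom_uminus_map[OF assms] by (cases "even i") (auto simp: signed_def)

lemma mod_hom_commutes_signed:
  assumes "module k M" "module k N" "h \<in> mod_hom k M N" "x \<in> carrier M"
  shows "h (signed M i x) = signed N i (h x)"
  using mod_hom_a_inv[OF assms] by (simp add: signed_def)

lemma assoc_cx_diff_hom:
  assumes "has_linear_faces k Z"
  shows "cdiff (assoc_cx Z) n \<in> mod_hom k (smod Z (Suc n)) (smod Z n)"
proof -
  have "(\<lambda>c. \<Oplus>\<^bsub>smod Z n\<^esub>i\<in>{..Suc n}. signed (smod Z n) i (sface Z (Suc n) i c))
      \<in> mod_hom k (smod Z (Suc n)) (smod Z n)"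
    using assms by (intro mod_hom_finsum_maps mod_hom_signed) (auto simp: has_linear_faces_def)
  moreover have "cdiff (assoc_cx Z) n =
      (\<lambda>c. \<Oplus>\<^bsub>smod Z n\<^esub>i\<in>{..Suc n}. signed (smod Z n) i (sface Z (Suc n) i c))"
    by (rule ext) (rule assoc_cx_diff)
  ultimately show ?thesis by (simp only:)
qed

lemma assoc_cx_is_chain_cx:
  assumes lin: "has_linear_faces k Z" and simp: "has_face_identities k Z"
  shows "is_chain_cx k (assoc_cx Z)"
  unfolding is_chain_cx_def
proof (intro conjI allI ballI)
  have Z: "module k (smod Z n)" for n using lin by (simp add: has_linear_faces_def)
  have F: "sface Z (Suc n) i \<in> mod_hom k (smod Z (Suc n)) (smod Z n)" if "i \<le> Suc n" for n i
    using lin that by (simp add: has_linear_faces_def)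
  show "module k (cmod (assoc_cx Z) n)" for n using Z by simp
  show "cdiff (assoc_cx Z) n \<in> mod_hom k (cmod (assoc_cx Z) (Suc n)) (cmod (assoc_cx Z) n)" for n
    using assoc_cx_diff_hom[OF lin] by simp
  fix n c assume "c \<in> carrier (cmod (assoc_cx Z) (Suc (Suc n)))"
  then have c: "c \<in> carrier (smod Z (Suc (Suc n)))" by simp
  interpret M: module k "smod Z n" by (rule Z)
  interpret M1: module k "smod Z (Suc n)" by (rule Z)
  define x where "x i j = (if i \<le> Suc n \<and> j \<le> Suc (Suc n)
    then sface Z (Suc n) i (sface Z (Suc (Suc n)) j c) else \<zero>\<^bsub>smod Z n\<^esub>)" for i j
  have xcl: "x i j \<in> carrier (smod Z n)" for i j
    using mod_hom_closed[OF F] c by (auto simp: x_def)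
  have "cdiff (assoc_cx Z) n (cdiff (assoc_cx Z) (Suc n) c) =
      (\<Oplus>\<^bsub>smod Z n\<^esub>i\<in>{..Suc n}. \<Oplus>\<^bsub>smod Z n\<^esub>j\<in>{..Suc (Suc n)}. signed (smod Z n) (i + j) (x i j))"
    unfolding assoc_cx_diff
  proof (rule M.M.finsum_cong')
    fix i assume i: "i \<in> {..Suc n}"
    let ?h = "\<lambda>y. signed (smod Z n) i (sface Z (Suc n) i y)"
    have h: "?h \<in> mod_hom k (smod Z (Suc n)) (smod Z n)" using i by (intro mod_hom_signed Z F) auto
    have "?h (\<Oplus>\<^bsub>smod Z (Suc n)\<^esub>j\<in>{..Suc (Suc n)}. signed (smod Z (Suc n)) j (sface Z (Suc (Suc n)) j c))
       = (\<Oplus>\<^bsub>smod Z n\<^esub>j\<in>{..Suc (Suc n)}. ?h (signed (smod Z (Suc n)) j (sface Z (Suc (Suc n)) j c)))"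
      using mod_hom_closed[OF F c] by (intro mod_hom_finsum[OF Z Z h]) auto
    also have "\<dots> = (\<Oplus>\<^bsub>smod Z n\<^esub>j\<in>{..Suc (Suc n)}. signed (smod Z n) (i + j) (x i j))"
    proof (rule M.M.finsum_cong')
      fix j assume j: "j \<in> {..Suc (Suc n)}"
      have cl: "sface Z (Suc (Suc n)) j c \<in> carrier (smod Z (Suc n))" using mod_hom_closed[OF F c] j by auto
      have "x i j = sface Z (Suc n) i (sface Z (Suc (Suc n)) j c)" using i j by (simp add: x_def)
      then show "?h (signed (smod Z (Suc n)) j (sface Z (Suc (Suc n)) j c)) = signed (smod Z n) (i + j) (x i j)"
        using mod_hom_commutes_signed[OF Z Z F cl] i xcl[of i j] by (auto simp: signed_def)
    qed (use xcl in auto)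
    finally show "?h (\<Oplus>\<^bsub>smod Z (Suc n)\<^esub>j\<in>{..Suc (Suc n)}. signed (smod Z (Suc n)) j (sface Z (Suc (Suc n)) j c))
       = (\<Oplus>\<^bsub>smod Z n\<^esub>j\<in>{..Suc (Suc n)}. signed (smod Z n) (i + j) (x i j))" .
  qed (use xcl in auto)
  also have "\<dots> = \<zero>\<^bsub>smod Z n\<^esub>"
  proof (rule M.M.alternating_double_sum_zero[OF xcl])
    fix i j :: nat assume ij: "i < j" "j \<le> Suc (Suc n)"
    then have "i \<le> Suc n" "j - 1 \<le> Suc n" "i \<le> Suc (Suc n)" by linarith+
    with ij show "x i j = x (j - 1) i"
      using simp[unfolded has_face_identities_def, rule_format, of i j n c] c unfolding x_def by simp
  qed
  finally show "cdiff (assoc_cx Z) n (cdiff (assoc_cx Z) (Suc n) c) = \<zero>\<^bsub>cmod (assoc_cx Z) n\<^esub>"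
    by (simp only: assoc_cx_mod)
qed

lemma assoc_cx_diff_commute:
  assumes Z: "has_linear_faces k Z" and W: "has_linear_faces k W"
    and f: "\<And>n. f n \<in> mod_hom k (smod Z n) (smod W n)"
    and comm: "\<And>n i c. i \<le> Suc n \<Longrightarrow> c \<in> carrier (smod Z (Suc n)) \<Longrightarrow>
      f n (sface Z (Suc n) i c) = sface W (Suc n) i (f (Suc n) c)"
    and c: "c \<in> carrier (smod Z (Suc n))"
  shows "f n (cdiff (assoc_cx Z) n c) = cdiff (assoc_cx W) n (f (Suc n) c)"
proof -
  have mZ: "module k (smod Z n)" and mW: "module k (smod W n)" for n
    using Z W by (auto simp: has_linear_faces_def)
  have fZ: "sface Z (Suc n) i c \<in> carrier (smod Z n)" if "i \<le> Suc n" for i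
    by (rule mod_hom_closed[where k = k, OF _ c]) (use Z that in \<open>simp add: has_linear_faces_def\<close>)
  interpret ZM: module k "smod Z n" by (rule mZ)
  interpret WM: module k "smod W n" by (rule mW)
  have "f n (cdiff (assoc_cx Z) n c) =
      (\<Oplus>\<^bsub>smod W n\<^esub>i\<in>{..Suc n}. f n (signed (smod Z n) i (sface Z (Suc n) i c)))"
    unfolding assoc_cx_diff by (rule mod_hom_finsum[OF mZ mW f]) (use fZ in auto)
  also have "\<dots> = (\<Oplus>\<^bsub>smod W n\<^esub>i\<in>{..Suc n}. signed (smod W n) i (sface W (Suc n) i (f (Suc n) c)))"
  proof (rule WM.M.finsum_cong')
    fix i assume "i \<in> {..Suc n}"
    then have i: "i \<le> Suc n" by simp
    have cl: "sface W (Suc n) i (f (Suc n) c) \<in> carrier (smod W n)"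
      using mod_hom_closed[OF f fZ[OF i]] comm[OF i c] by simp
    show "f n (signed (smod Z n) i (sface Z (Suc n) i c)) = signed (smod W n) i (sface W (Suc n) i (f (Suc n) c))"
      using mod_hom_commutes_signed[OF mZ mW f fZ[OF i]] comm[OF i c] by simp
  next
    show "(\<lambda>i. signed (smod W n) i (sface W (Suc n) i (f (Suc n) c))) \<in> {..Suc n} \<rightarrow> carrier (smod W n)"
      using mod_hom_closed[OF f fZ] comm[OF _ c] by (auto intro!: WM.M.signed_closed)
  qed simp
  finally show ?thesis by (simp only: assoc_cx_diff)
qed

section \<open>Subcomplexes and quotient complexes\<close>

lemma is_chain_cxD:
  assumes "is_chain_cx k C"
  shows "module k (cmod C n)" "cdiff C n \<in> mod_hom k (cmod C (Suc n)) (cmod C n)"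
    "c \<in> carrier (cmod C (Suc (Suc n))) \<Longrightarrow> cdiff C n (cdiff C (Suc n) c) = \<zero>\<^bsub>cmod C n\<^esub>"
  using assms by (auto simp: is_chain_cx_def)

lemma is_subcxD:
  assumes "is_subcx k C S"
  shows "submodule (S n) k (cmod C n)" "c \<in> S (Suc n) \<Longrightarrow> cdiff C n c \<in> S n"
  using assms by (auto simp: is_subcx_def)

lemma subcx_gen_superset: "G n \<subseteq> subcx_gen k C G n"
  by (auto simp: subcx_gen_def)

lemma subcx_gen_least: "is_subcx k C S \<Longrightarrow> (\<And>m. G m \<subseteq> S m) \<Longrightarrow> subcx_gen k C G n \<subseteq> S n"
  by (auto simp: subcx_gen_def)

text \<open>The whole complex is one of the subcomplexes that are intersected; without it the intersection would be
  taken over the empty family and be the whole type.\<close>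

lemma subcx_gen_is_subcx:
  assumes C: "is_chain_cx k C" and G: "\<And>m. G m \<subseteq> carrier (cmod C m)"
  shows "is_subcx k C (subcx_gen k C G)"
proof -
  note D = is_chain_cxD[OF C]
  have whole: "is_subcx k C (\<lambda>n. carrier (cmod C n))"
    unfolding is_subcx_def using module.carrier_is_submodule[OF D(1)] mod_hom_closed[OF D(2)] by auto
  have "submodule (subcx_gen k C G n) k (cmod C n)" for n
    unfolding subcx_gen_def
  proof (rule submodule_Inter[OF D(1)])
    have "carrier (cmod C n) \<in> {S n |S. is_subcx k C S \<and> (\<forall>m. G m \<subseteq> S m)}"
      by (rule CollectI, rule exI[of _ "\<lambda>n. carrier (cmod C n)"]) (simp add: whole G)
    then show "{S n |S. is_subcx k C S \<and> (\<forall>m. G m \<subseteq> S m)} \<noteq> {}" by blast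
  qed (auto simp: is_subcx_def)
  moreover have "cdiff C n c \<in> subcx_gen k C G n" if "c \<in> subcx_gen k C G (Suc n)" for n c
    unfolding subcx_gen_def
  proof (rule InterI, elim CollectE exE conjE)
    fix X S assume S: "X = S n" "is_subcx k C S" "\<forall>m. G m \<subseteq> S m"
    then have "c \<in> S (Suc n)" using that subcx_gen_least[OF S(2)] by blast
    then show "cdiff C n c \<in> X" using is_subcxD(2)[OF S(2)] S(1) by simp
  qed
  ultimately show ?thesis by (auto simp: is_subcx_def)
qed

lemma degen_cx_is_subcx:
  assumes "is_chain_cx k (assoc_cx Z)"
    and "\<And>m i. i \<le> m \<Longrightarrow> sdegen Z m i \<in> mod_hom k (smod Z m) (smod Z (Suc m))"
  shows "is_subcx k (assoc_cx Z) (degen_cx k Z)"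
  unfolding degen_cx_def
proof (rule subcx_gen_is_subcx[OF assms(1)])
  show "degenerates Z m \<subseteq> carrier (cmod (assoc_cx Z) m)" for m
    using mod_hom_closed[OF assms(2)] by (auto simp: degenerates_def)
qed

lemma quot_cx_simps [simp]: "cmod (quot_cx C S) n = quot_mod (cmod C n) (S n)"
  by (simp add: quot_cx_def)

lemma quot_cx_diff:
  assumes C: "is_chain_cx k C" and S: "is_subcx k C S" and c: "c \<in> carrier (cmod C (Suc n))"
  shows "cdiff (quot_cx C S) n (S (Suc n) +>\<^bsub>cmod C (Suc n)\<^esub> c) = S n +>\<^bsub>cmod C n\<^esub> cdiff C n c"
proof -
  note D = is_chain_cxD[OF C] and Sd = is_subcxD[OF S]
  note I = mem_coset_iff[OF D(1) Sd(1) c]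
  let ?K = "S (Suc n) +>\<^bsub>cmod C (Suc n)\<^esub> c"
  have cK: "c \<in> ?K"
    using c submoduleD(2)[OF D(1) Sd(1)] minus_self_eq_zero[OF D(1) c refl] by (simp add: I)
  have "S n +>\<^bsub>cmod C n\<^esub> cdiff C n x = S n +>\<^bsub>cmod C n\<^esub> cdiff C n c" if "x \<in> ?K" for x
  proof -
    have x: "x \<in> carrier (cmod C (Suc n))" "x \<ominus>\<^bsub>cmod C (Suc n)\<^esub> c \<in> S (Suc n)" using that by (auto simp: I)
    have "cdiff C n x \<ominus>\<^bsub>cmod C n\<^esub> cdiff C n c \<in> S n"
      using Sd(2)[OF x(2)] mod_hom_minus[OF D(1) D(1) D(2) x(1) c] by simp
    then show ?thesis
      using mod_hom_closed[OF D(2)] x(1) c by (simp add: quot_class_eq_iff[OF D(1) Sd(1)])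
  qed
  then have "(\<Union>x\<in>?K. S n +>\<^bsub>cmod C n\<^esub> cdiff C n x) = (\<Union>x\<in>?K. S n +>\<^bsub>cmod C n\<^esub> cdiff C n c)"
    by (intro SUP_cong refl)
  also have "\<dots> = S n +>\<^bsub>cmod C n\<^esub> cdiff C n c" using cK by blast
  finally show ?thesis by (simp add: quot_cx_def)
qed

lemma quot_cx_is_chain_cx:
  assumes C: "is_chain_cx k C" and S: "is_subcx k C S"
  shows "is_chain_cx k (quot_cx C S)"
proof -
  note D = is_chain_cxD[OF C] and Sd = is_subcxD[OF S] and d = quot_cx_diff[OF C S]
  note Q = quot_mod_ops[OF D(1) Sd(1)] and cl = mod_hom_closed[OF D(2)]
  have M: "module k (quot_mod (cmod C n) (S n))" for n by (rule module_quot_mod[OF D(1) Sd(1)])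
  interpret MC: module k "cmod C n" for n by (rule D(1))
  show ?thesis unfolding is_chain_cx_def
  proof (intro conjI allI ballI)
    show "cdiff (quot_cx C S) n \<in> mod_hom k (cmod (quot_cx C S) (Suc n)) (cmod (quot_cx C S) n)" for n
      by (rule mod_homI) (auto simp: carrier_quot_mod Q d cl mod_homD[OF D(2)])
    fix n Z assume "Z \<in> carrier (cmod (quot_cx C S) (Suc (Suc n)))"
    then show "cdiff (quot_cx C S) n (cdiff (quot_cx C S) (Suc n) Z) = \<zero>\<^bsub>cmod (quot_cx C S) n\<^esub>"
      by (auto simp: carrier_quot_mod Q d cl D(3))
  qed (simp add: M)
qed

lemma is_chain_mapD:
  assumes "is_chain_map k C D f"
  shows "is_chain_cx k C" "is_chain_cx k D" "f n \<in> mod_hom k (cmod C n) (cmod D n)"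
    "c \<in> carrier (cmod C (Suc n)) \<Longrightarrow> f n (cdiff C n c) = cdiff D n (f (Suc n) c)"
  using assms by (auto simp: is_chain_map_def)

lemma is_chain_map_cong:
  assumes "is_chain_map k C D f" "\<And>n c. c \<in> carrier (cmod C n) \<Longrightarrow> g n c = f n c"
  shows "is_chain_map k C D g"
proof -
  note F = is_chain_mapD[OF assms(1)]
  interpret MC: module k "cmod C n" for n by (rule is_chain_cxD[OF F(1)])
  have "g n \<in> mod_hom k (cmod C n) (cmod D n)" for n
    by (rule mod_homI) (auto simp: assms(2) mod_homD[OF F(3)])
  then show ?thesis unfolding is_chain_map_def
    using F assms(2) mod_hom_closed[OF is_chain_cxD(2)[OF F(1)]] by auto
qed

text \<open>Preimages turn membership in a generated subcomplex into a condition on its generators. This is applied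
  to the degenerate chains, and, with the zero subcomplex, to \<open>NCS\<^sup>1\<close>.\<close>

lemma is_subcx_preimage:
  assumes f: "is_chain_map k C D f" and T: "is_subcx k D T"
  shows "is_subcx k C (\<lambda>n. {c \<in> carrier (cmod C n). f n c \<in> T n})"
proof -
  note F = is_chain_mapD[OF f] and Td = is_subcxD[OF T]
  show ?thesis unfolding is_subcx_def
    using submodule_preimage[OF is_chain_cxD(1)[OF F(1)] is_chain_cxD(1)[OF F(2)] F(3) Td(1)]
      mod_hom_closed[OF is_chain_cxD(2)[OF F(1)]] F(4) Td(2) by auto
qed

lemma is_subcx_zero:
  assumes "is_chain_cx k C" shows "is_subcx k C (\<lambda>n. {\<zero>\<^bsub>cmod C n\<^esub>})"
proof -
  note D = is_chain_cxD[OF assms]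
  show ?thesis unfolding is_subcx_def
    by (simp add: submodule_zero[OF D(1)] mod_hom_zero[OF D(1) D(1) D(2)])
qed

lemma quot_cx_map:
  assumes f: "is_chain_map k C D f" and S: "is_subcx k C S" and T: "is_subcx k D T"
    and ST: "\<And>n c. c \<in> S n \<Longrightarrow> f n c \<in> T n"
  shows "\<exists>g. is_chain_map k (quot_cx C S) (quot_cx D T) g \<and>
    (\<forall>n. \<forall>c\<in>carrier (cmod C n). g n (S n +>\<^bsub>cmod C n\<^esub> c) = T n +>\<^bsub>cmod D n\<^esub> f n c)"
proof -
  note F = is_chain_mapD[OF f] and Sd = is_subcxD[OF S] and Td = is_subcxD[OF T]
  note C = is_chain_cxD[OF F(1)] and D = is_chain_cxD[OF F(2)]
  have "\<exists>h. h \<in> mod_hom k (quot_mod (cmod C n) (S n)) (quot_mod (cmod D n) (T n)) \<and>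
    (\<forall>c\<in>carrier (cmod C n). h (S n +>\<^bsub>cmod C n\<^esub> c) = T n +>\<^bsub>cmod D n\<^esub> f n c)" for n
  proof -
    have "T n +>\<^bsub>cmod D n\<^esub> f n c = \<zero>\<^bsub>quot_mod (cmod D n) (T n)\<^esub>" if "c \<in> S n" for c
    proof -
      have "f n c \<in> carrier (cmod D n)" using submoduleD(1)[OF D(1) Td(1)] ST[OF that] by blast
      then show ?thesis using quot_class_eq_zero_iff[OF D(1) Td(1)] ST[OF that] by blast
    qed
    from quot_lift[OF C(1) module_quot_mod[OF D(1) Td(1)] Sd(1)
        mod_hom_comp[OF quot_class_hom[OF D(1) Td(1)] F(3)] this]
    show ?thesis by blast
  qed
  then obtain g where g: "\<And>n. g n \<in> mod_hom k (quot_mod (cmod C n) (S n)) (quot_mod (cmod D n) (T n))"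
    "\<And>n c. c \<in> carrier (cmod C n) \<Longrightarrow> g n (S n +>\<^bsub>cmod C n\<^esub> c) = T n +>\<^bsub>cmod D n\<^esub> f n c"
    by metis
  have "is_chain_map k (quot_cx C S) (quot_cx D T) g"
    unfolding is_chain_map_def
    using quot_cx_is_chain_cx[OF F(1) S] quot_cx_is_chain_cx[OF F(2) T] g(1)
    by (auto simp: carrier_quot_mod quot_cx_diff[OF F(1) S] quot_cx_diff[OF F(2) T] g(2)
        mod_hom_closed[OF C(2)] mod_hom_closed[OF F(3)] F(4))
  then show ?thesis using g(2) by blast
qed


section \<open>Strings in a category\<close>

locale category_cat =
  fixes C :: "('o,'m) cat"
  assumes dom_obj: "f \<in> Mor C \<Longrightarrow> Dom C f \<in> Obj C"
    and cod_obj: "f \<in> Mor C \<Longrightarrow> Cod C f \<in> Obj C"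
    and comp: "f \<in> Mor C \<Longrightarrow> g \<in> Mor C \<Longrightarrow> Dom C g = Cod C f \<Longrightarrow>
      Comp C g f \<in> Mor C \<and> Dom C (Comp C g f) = Dom C f \<and> Cod C (Comp C g f) = Cod C g"
    and assoc: "f \<in> Mor C \<Longrightarrow> g \<in> Mor C \<Longrightarrow> h \<in> Mor C \<Longrightarrow> Dom C g = Cod C f \<Longrightarrow> Dom C h = Cod C g \<Longrightarrow>
      Comp C h (Comp C g f) = Comp C (Comp C h g) f"
    and ident: "x \<in> Obj C \<Longrightarrow> Ident C x \<in> Mor C \<and> Dom C (Ident C x) = x \<and> Cod C (Ident C x) = x"

text \<open>All faces of a string except the zeroth, by recursion: the map in position \<open>i\<close> is composed with its successor,
  or dropped if it is the last one. Positions are counted from zero, so this is the face \<open>i + 1\<close>.\<close>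

fun merge_at :: "('o,'m) cat \<Rightarrow> nat \<Rightarrow> 'm list \<Rightarrow> 'm list" where
  "merge_at C i [] = []"
| "merge_at C 0 (f # fs) = (case fs of [] \<Rightarrow> [] | g # gs \<Rightarrow> Comp C g f # gs)"
| "merge_at C (Suc i) (f # fs) = f # merge_at C i fs"

lemma merge_at_last: "fs \<noteq> [] \<Longrightarrow> merge_at C (length fs - 1) fs = butlast fs"
proof (induction fs)
  case (Cons f fs) then show ?case by (cases fs) auto
qed simp

lemma merge_at_inner:
  "Suc i < length fs \<Longrightarrow>
    merge_at C i fs = take i fs @ Comp C (fs ! Suc i) (fs ! i) # drop (i + 2) fs"
proof (induction C i fs rule: merge_at.induct)
  case (2 C f fs) then show ?case by (cases fs) auto
qed auto

lemma str_face_Suc: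
  assumes "i < length fs" shows "str_face C (Suc i) (x, fs) = (x, merge_at C i fs)"
proof (cases "Suc i = length fs")
  case True
  then have "fs \<noteq> []" "i = length fs - 1" by auto
  then show ?thesis using True merge_at_last[of fs C] by (simp add: str_face_def)
next
  case False
  then show ?thesis using assms merge_at_inner[of i fs C] by (simp add: str_face_def)
qed

lemma str_face_0: "str_face C 0 (x, fs) = (Cod C (hd fs), tl fs)"
  by (simp add: str_face_def)

lemma str_face_last:
  assumes "length fs = Suc n" shows "str_face C (Suc n) (x, fs) = (x, butlast fs)"
  using assms by (simp add: str_face_def)

lemma length_merge_at: "i < length fs \<Longrightarrow> length (merge_at C i fs) = length fs - 1"
proof (induction C i fs rule: merge_at.induct)
  case (2 C f fs) then show ?case by (cases fs) auto
qed auto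

lemma is_path_append:
  "is_path C x (fs @ gs) y \<longleftrightarrow> (\<exists>z. is_path C x fs z \<and> is_path C z gs y)"
proof (induction fs arbitrary: x)
  case Nil
  have "is_path C x gs y \<Longrightarrow> x \<in> Obj C" by (cases gs) auto
  then show ?case by auto
qed auto

lemma is_path_source_obj: "is_path C x fs y \<Longrightarrow> x \<in> Obj C"
  by (cases fs) auto

lemma is_path_target_obj: "is_path C x fs y \<Longrightarrow> y \<in> Obj C"
  by (induction C x fs y rule: is_path.induct) auto

lemma is_path_unique_target: "is_path C x fs y \<Longrightarrow> is_path C x fs z \<Longrightarrow> y = z"
  by (induction fs arbitrary: x) auto

context category_cat begin

lemma is_path_merge_at_inner:
  "Suc i < length fs \<Longrightarrow> is_path C x fs y \<Longrightarrow> is_path C x (merge_at C i fs) y"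
proof (induction i arbitrary: x fs)
  case 0
  then obtain f g gs where fs: "fs = f # g # gs" by (cases fs; cases "tl fs") auto
  then show ?case using 0 comp[of f g] by auto
next
  case (Suc i)
  then show ?case by (cases fs) auto
qed

text \<open>The simplicial identity for faces other than the zeroth. Only \<open>j = i + 1\<close> makes the two compositions meet, and
  there it is associativity.\<close>

lemma merge_at_merge_at:
  "i < j \<Longrightarrow> j < length fs \<Longrightarrow> is_path C x fs y \<Longrightarrow>
    merge_at C i (merge_at C j fs) = merge_at C (j - 1) (merge_at C i fs)"
proof (induction i arbitrary: j x fs)
  case 0
  then obtain f g gs j' where fs: "fs = f # g # gs" and j: "j = Suc j'"
    by (cases fs; cases "tl fs"; cases j) auto
  show ?case
  proof (cases j')
    case 0
    then show ?thesis
      using \<open>is_path C x fs y\<close> assoc[of f g] by (cases gs) (auto simp: fs j)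
  next
    case (Suc j'')
    then show ?thesis using fs j by simp
  qed
next
  case (Suc i)
  then obtain f gs j' where fs: "fs = f # gs" and j: "j = Suc j'" by (cases fs; cases j) auto
  obtain j'' where "j' = Suc j''" using Suc.prems(1) j by (cases j') auto
  then show ?case using Suc.IH[of j' gs] Suc.prems by (auto simp: fs j)
qed

end

lemma mem_strings: "(x, fs) \<in> strings C n \<longleftrightarrow> length fs = n \<and> (\<exists>y. is_path C x fs y)"
  by (auto simp: strings_def paths_def)

lemma mem_paths: "fs \<in> paths C n x y \<longleftrightarrow> length fs = n \<and> is_path C x fs y"
  by (simp add: paths_def)

lemma path_in_strings: "is_path C x fs y \<Longrightarrow> length fs = n \<Longrightarrow> (x, fs) \<in> strings C n"
  by (auto simp: mem_strings)

lemma is_path_butlast: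
  "is_path C x fs y \<Longrightarrow> fs \<noteq> [] \<Longrightarrow>
    is_path C x (butlast fs) (Dom C (last fs)) \<and> last fs \<in> Mor C \<and> Cod C (last fs) = y"
proof -
  assume p: "is_path C x fs y" "fs \<noteq> []"
  then have "is_path C x (butlast fs @ [last fs]) y" by simp
  then show ?thesis unfolding is_path_append by auto
qed

context category_cat begin

lemma str_face_strings:
  assumes "s \<in> strings C (Suc n)" "i \<le> Suc n"
  shows "str_face C i s \<in> strings C n"
proof -
  obtain x fs y where s: "s = (x, fs)" "length fs = Suc n" "is_path C x fs y"
    using assms(1) by (cases s) (auto simp: mem_strings)
  show ?thesis
  proof (cases i)
    case 0
    then show ?thesis using s by (cases fs) (auto simp: str_face_0 mem_strings)
  next
    case (Suc i')
    show ?thesis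
    proof (cases "i' = n")
      case True
      have "fs \<noteq> []" using s by auto
      then show ?thesis using True s Suc is_path_butlast[OF s(3)] merge_at_last[of fs C]
        by (auto simp: str_face_Suc mem_strings)
    next
      case False
      then show ?thesis using s Suc assms(2) is_path_merge_at_inner[OF _ s(3), of i']
        by (auto simp: str_face_Suc mem_strings length_merge_at)
    qed
  qed
qed

lemma str_face_path_inner:
  assumes "is_path C x fs y" "length fs = Suc n" "i \<le> n"
  shows "is_path C (fst (str_face C i (x, fs))) (snd (str_face C i (x, fs))) y"
proof (cases i)
  case 0
  then show ?thesis using assms by (cases fs) (auto simp: str_face_0)
next
  case (Suc j)
  then show ?thesis using assms is_path_merge_at_inner[OF _ assms(1), of j] by (simp add: str_face_Suc)
qed

lemma str_face_str_face:
  assumes s: "(x, fs) \<in> strings C (Suc (Suc n))" and ij: "i < j" "j \<le> Suc (Suc n)"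
  shows "str_face C i (str_face C j (x, fs)) = str_face C (j - 1) (str_face C i (x, fs))"
proof -
  obtain y where fs: "length fs = Suc (Suc n)" "is_path C x fs y"
    using s by (auto simp: mem_strings)
  obtain j' where j: "j = Suc j'" using ij by (cases j) auto
  obtain f g gs where fg: "fs = f # g # gs" using fs(1) by (cases fs; cases "tl fs") auto
  show ?thesis
  proof (cases i)
    case 0
    show ?thesis
    proof (cases j')
      case 0
      then show ?thesis using fs fg \<open>i = 0\<close> j comp[of f g] by (simp add: str_face_Suc str_face_0)
    next
      case (Suc j'')
      then show ?thesis using fs fg \<open>i = 0\<close> j ij by (simp add: str_face_Suc str_face_0)
    qed
  next
    case (Suc i')
    then have "i' < j'" "j' < length fs" using ij j fs by auto
    then have "j' = Suc (j' - 1)" by auto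
    with Suc \<open>i' < j'\<close> \<open>j' < length fs\<close> show ?thesis
      using merge_at_merge_at[OF _ _ fs(2), of i' j'] j
        str_face_Suc[of "j' - 1" "merge_at C i' fs" C x]
      by (simp add: str_face_Suc length_merge_at)
  qed
qed

lemma str_vertex_obj:
  assumes "is_path C x fs y" "i \<le> length fs"
  shows "is_path C x (take i fs) (str_vertex C (x, fs) i) \<and> is_path C (str_vertex C (x, fs) i) (drop i fs) y"
proof -
  have "is_path C x (take i fs @ drop i fs) y" using assms by simp
  then obtain z where z: "is_path C x (take i fs) z" "is_path C z (drop i fs) y"
    unfolding is_path_append by auto
  have "z = str_vertex C (x, fs) i"
  proof (cases i)
    case 0
    then show ?thesis using z by (simp add: str_vertex_def)
  next
    case (Suc j)
    then have "take i fs = take j fs @ [fs ! j]" using assms(2) by (simp add: take_Suc_conv_app_nth)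
    then show ?thesis using z(1) Suc by (auto simp: is_path_append str_vertex_def)
  qed
  then show ?thesis using z by simp
qed

lemma str_degen_path:
  assumes "is_path C x fs y" "i \<le> length fs"
  shows "\<exists>gs. str_degen C i (x, fs) = (x, gs) \<and> length gs = Suc (length fs) \<and> is_path C x gs y"
proof -
  note V = str_vertex_obj[OF assms]
  have "str_vertex C (x, fs) i \<in> Obj C" by (rule is_path_source_obj[OF V[THEN conjunct2]])
  then have "is_path C x (take i fs @ Ident C (str_vertex C (x, fs) i) # drop i fs) y"
    using V ident by (auto simp: is_path_append)
  then show ?thesis using assms(2) by (auto simp: str_degen_def)
qed

end

section \<open>Surjections with ordered fibres\<close>

text \<open>A map \<open>u\<close> on \<open>{1..n}\<close> factors uniquely as \<open>\<chi> \<circ> \<sigma>\<close> with \<open>\<chi>\<close> order-preserving and \<open>\<sigma>\<close> a permutation that is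
  increasing on the fibres of \<open>u\<close>: the permutation is the one that sorts the values of \<open>u\<close> stably. It sends \<open>a\<close> to
  its rank in the lexicographic order of the pairs \<open>(u a, a)\<close>.\<close>

definition stable_rank :: "nat \<Rightarrow> (nat \<Rightarrow> nat) \<Rightarrow> nat \<Rightarrow> nat" where
  "stable_rank n u a = card {b\<in>{1..n}. u b < u a \<or> u b = u a \<and> b \<le> a}"

lemma stable_sort_exists:
  fixes u :: "nat \<Rightarrow> nat" and n :: nat
  shows "\<exists>\<chi> \<sigma>. \<chi> \<in> extensional {1..n} \<and> mono_on {1..n} \<chi> \<and> \<sigma> permutes {1..n} \<and>
    (\<forall>i\<in>{1..n}. \<chi> (\<sigma> i) = u i) \<and> (\<forall>a\<in>{1..n}. \<forall>b\<in>{1..n}. a < b \<longrightarrow> u a = u b \<longrightarrow> \<sigma> a < \<sigma> b)"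
proof -
  define \<sigma> where "\<sigma> a = (if a \<in> {1..n} then stable_rank n u a else a)" for a
  have less: "\<sigma> a < \<sigma> b" if "a \<in> {1..n}" "b \<in> {1..n}" "u a < u b \<or> u a = u b \<and> a < b" for a b
  proof -
    let ?L = "\<lambda>c. {b\<in>{1..n}. u b < u c \<or> u b = u c \<and> b \<le> c}"
    have "?L a \<subseteq> ?L b" using that(3) by auto
    moreover have "b \<in> ?L b" "b \<notin> ?L a" using that by auto
    ultimately have "?L a \<subset> ?L b" by blast
    then have "card (?L a) < card (?L b)" by (intro psubset_card_mono) auto
    then show ?thesis using that by (simp add: \<sigma>_def stable_rank_def)
  qed
  have inj: "inj_on \<sigma> {1..n}"
  proof (rule inj_onI)
    fix a b assume "a \<in> {1..n}" "b \<in> {1..n}" "\<sigma> a = \<sigma> b"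
    then show "a = b" using less[of a b] less[of b a] by (metis less_irrefl linorder_neqE_nat)
  qed
  have into: "\<sigma> ` {1..n} \<subseteq> {1..n}"
  proof
    fix c assume "c \<in> \<sigma> ` {1..n}"
    then obtain a where a: "a \<in> {1..n}" "c = \<sigma> a" by auto
    let ?B = "{b\<in>{1..n}. u b < u a \<or> u b = u a \<and> b \<le> a}"
    have "card ?B \<le> card {1..n}" by (rule card_mono) auto
    moreover have "card ?B > 0" using a by (subst card_gt_0_iff) auto
    ultimately show "c \<in> {1..n}" using a by (simp add: \<sigma>_def stable_rank_def)
  qed
  have perm: "\<sigma> permutes {1..n}"
  proof (rule bij_imp_permutes)
    show "bij_betw \<sigma> {1..n} {1..n}"
      using inj endo_inj_surj[OF _ into inj] by (simp add: bij_betw_def)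
  qed (auto simp: \<sigma>_def)
  define \<chi> where "\<chi> = (\<lambda>i\<in>{1..n}. u (inv_into UNIV \<sigma> i))"
  have \<chi>: "\<chi> (\<sigma> i) = u i" if "i \<in> {1..n}" for i
    using that permutes_in_image[OF perm] permutes_inverses(2)[OF perm] by (auto simp: \<chi>_def)
  have "mono_on {1..n} \<chi>"
  proof (rule mono_onI)
    fix r s assume "r \<in> {1..n}" "s \<in> {1..n}" "r \<le> s"
    then obtain a b where ab: "a \<in> {1..n}" "b \<in> {1..n}" "r = \<sigma> a" "s = \<sigma> b"
      using permutes_image[OF perm] by (metis imageE)
    then have "\<not> u b < u a" using less[of b a] \<open>r \<le> s\<close> by auto
    then show "\<chi> r \<le> \<chi> s" using ab \<chi> by simp
  qed
  moreover have "\<chi> \<in> extensional {1..n}" by (simp add: \<chi>_def)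
  ultimately show ?thesis using perm \<chi> less by blast
qed

text \<open>Any such \<open>\<sigma>\<close> is strictly increasing for the lexicographic order of the pairs \<open>(u a, a)\<close>, which is total. So the
  elements below \<open>\<sigma> a\<close> are the images of the elements below \<open>a\<close>, and counting them gives the rank.\<close>

lemma stable_sort_unique:
  fixes \<chi> u \<sigma> :: "nat \<Rightarrow> nat" and n :: nat
  assumes \<chi>: "mono_on {1..n} \<chi>" and \<sigma>: "\<sigma> permutes {1..n}"
    and u: "\<And>i. i \<in> {1..n} \<Longrightarrow> \<chi> (\<sigma> i) = u i"
    and st: "\<And>a b. a \<in> {1..n} \<Longrightarrow> b \<in> {1..n} \<Longrightarrow> a < b \<Longrightarrow> u a = u b \<Longrightarrow> \<sigma> a < \<sigma> b"
    and a: "a \<in> {1..n}"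
  shows "\<sigma> a = stable_rank n u a"
proof -
  have in1: "\<sigma> b \<in> {1..n}" if "b \<in> {1..n}" for b using that permutes_in_image[OF \<sigma>] by blast
  have less: "\<sigma> b < \<sigma> c" if "b \<in> {1..n}" "c \<in> {1..n}" "u b < u c \<or> u b = u c \<and> b < c" for b c
  proof (cases "u b < u c")
    case True
    then have "\<not> \<chi> (\<sigma> c) \<le> \<chi> (\<sigma> b)" using u that by simp
    then show ?thesis using mono_onD[OF \<chi> in1[OF that(2)] in1[OF that(1)]] by linarith
  qed (use that st in auto)
  have "{b\<in>{1..n}. u b < u a \<or> u b = u a \<and> b \<le> a} = {b\<in>{1..n}. \<sigma> b \<le> \<sigma> a}"
  proof (intro Collect_cong conj_cong refl)
    fix b assume b: "b \<in> {1..n}"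
    show "(u b < u a \<or> u b = u a \<and> b \<le> a) = (\<sigma> b \<le> \<sigma> a)"
    proof -
      consider "u a < u b \<or> u a = u b \<and> a < b" | "a = b" | "u b < u a \<or> u b = u a \<and> b < a" by linarith
      then show ?thesis
      proof cases
        case 1
        then show ?thesis using less[OF a b 1] by auto
      next
        case 3
        then show ?thesis using less[OF b a 3] by auto
      qed simp
    qed
  qed
  moreover have "\<sigma> ` {b\<in>{1..n}. \<sigma> b \<le> \<sigma> a} = {1..\<sigma> a}"
  proof
    show "{1..\<sigma> a} \<subseteq> \<sigma> ` {b\<in>{1..n}. \<sigma> b \<le> \<sigma> a}"
    proof
      fix c assume c: "c \<in> {1..\<sigma> a}"
      then have "c \<in> {1..n}" using in1[OF a] by auto
      then obtain b where "b \<in> {1..n}" "c = \<sigma> b" using permutes_image[OF \<sigma>] by (metis imageE)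
      then show "c \<in> \<sigma> ` {b\<in>{1..n}. \<sigma> b \<le> \<sigma> a}" using c by auto
    qed
    show "\<sigma> ` {b\<in>{1..n}. \<sigma> b \<le> \<sigma> a} \<subseteq> {1..\<sigma> a}"
    proof
      fix c assume "c \<in> \<sigma> ` {b\<in>{1..n}. \<sigma> b \<le> \<sigma> a}"
      then obtain b where "b \<in> {1..n}" "\<sigma> b \<le> \<sigma> a" "c = \<sigma> b" by blast
      then show "c \<in> {1..\<sigma> a}" using in1[of b] by simp
    qed
  qed
  moreover have "card (\<sigma> ` {b\<in>{1..n}. \<sigma> b \<le> \<sigma> a}) = card {b\<in>{1..n}. \<sigma> b \<le> \<sigma> a}"
    by (rule card_image) (rule permutes_inj_on[OF \<sigma>])
  ultimately show ?thesis by (simp add: stable_rank_def)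
qed

text \<open>The square that defines the composition of \<open>\<Delta>S\<close>: \<open>h \<circ> \<phi> = \<chi> \<circ> \<sigma>\<close>, where \<open>\<chi>\<close> is \<open>h\<^sub>\<star>(\<phi>)\<close> and \<open>\<sigma>\<close> is \<open>\<phi>\<^sup>\<star>(h)\<close>. Since \<open>h\<close> is
  injective, the fibres of \<open>\<phi>\<close> are those of \<open>h \<circ> \<phi>\<close>, so this is a stable sorting of \<open>h \<circ> \<phi>\<close>.\<close>

definition is_exchange ::
  "nat \<Rightarrow> nat \<Rightarrow> (nat \<Rightarrow> nat) \<Rightarrow> (nat \<Rightarrow> nat) \<Rightarrow> (nat \<Rightarrow> nat) \<Rightarrow> (nat \<Rightarrow> nat) \<Rightarrow> bool" where
  "is_exchange n m h \<phi> \<chi> \<sigma> \<longleftrightarrow>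
     \<chi> \<in> {1..n} \<rightarrow>\<^sub>E {1..m} \<and> mono_on {1..n} \<chi> \<and>
     \<sigma> permutes {1..n} \<and> (\<forall>j\<in>{1..m}. mono_on {i\<in>{1..n}. \<phi> i = j} \<sigma>) \<and>
     (\<forall>i\<in>{1..n}. h (\<phi> i) = \<chi> (\<sigma> i))"

lemma is_exchange_strict:
  assumes e: "is_exchange n m h \<phi> \<chi> \<sigma>" and \<phi>: "\<phi> \<in> {1..n} \<rightarrow> {1..m}"
    and ab: "a \<in> {1..n}" "b \<in> {1..n}" "a < b" "\<phi> a = \<phi> b"
  shows "\<sigma> a < \<sigma> b"
proof -
  have "mono_on {i\<in>{1..n}. \<phi> i = \<phi> a} \<sigma>" using e funcset_mem[OF \<phi> ab(1)] by (simp add: is_exchange_def)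
  then have "\<sigma> a \<le> \<sigma> b" by (rule mono_onD) (use ab in auto)
  moreover have "\<sigma> a \<noteq> \<sigma> b"
    using ab e permutes_inj[of \<sigma>] by (auto simp: is_exchange_def inj_eq)
  ultimately show ?thesis by simp
qed

lemma is_exchange_unique:
  assumes "is_exchange n m h \<phi> \<chi> \<sigma>" "is_exchange n m h \<phi> \<chi>' \<sigma>'"
    and \<phi>: "\<phi> \<in> {1..n} \<rightarrow> {1..m}" and h: "inj h"
  shows "\<chi> = \<chi>' \<and> \<sigma> = \<sigma>'"
proof
  have rank: "\<tau> a = stable_rank n (h \<circ> \<phi>) a"
    if "is_exchange n m h \<phi> \<psi> \<tau>" "a \<in> {1..n}" for \<psi> \<tau> a
    using that is_exchange_strict[OF that(1) \<phi>] injD[OF h]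
    by (intro stable_sort_unique[of n \<psi>]) (auto simp: is_exchange_def)
  show \<sigma>: "\<sigma> = \<sigma>'"
  proof
    fix a show "\<sigma> a = \<sigma>' a"
    proof (cases "a \<in> {1..n}")
      case True
      then show ?thesis using rank[OF assms(1)] rank[OF assms(2)] by simp
    next
      case False
      then show ?thesis using assms(1,2) unfolding is_exchange_def permutes_def by metis
    qed
  qed
  have p: "\<sigma> permutes {1..n}" using assms(1) by (simp add: is_exchange_def)
  show "\<chi> = \<chi>'"
  proof (rule extensionalityI[of _ "{1..n}"])
    fix i assume "i \<in> {1..n}"
    then obtain a where "a \<in> {1..n}" "i = \<sigma> a" using permutes_image[OF p] by (metis imageE)
    then show "\<chi> i = \<chi>' i" using assms(1,2) \<sigma> by (simp add: is_exchange_def)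
  qed (use assms(1,2) in \<open>auto simp: is_exchange_def PiE_def\<close>)
qed

lemma is_exchange_exists:
  assumes \<phi>: "\<phi> \<in> {1..n} \<rightarrow> {1..m}" and h: "h permutes {1..m}"
  shows "\<exists>\<chi> \<sigma>. is_exchange n m h \<phi> \<chi> \<sigma>"
proof -
  obtain \<chi> \<sigma> where *: "\<chi> \<in> extensional {1..n}" "mono_on {1..n} \<chi>" "\<sigma> permutes {1..n}"
    "\<forall>i\<in>{1..n}. \<chi> (\<sigma> i) = h (\<phi> i)"
    "\<forall>a\<in>{1..n}. \<forall>b\<in>{1..n}. a < b \<longrightarrow> h (\<phi> a) = h (\<phi> b) \<longrightarrow> \<sigma> a < \<sigma> b"
    using stable_sort_exists[of n "\<lambda>i. h (\<phi> i)"] by auto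
  have "\<chi> i \<in> {1..m}" if i: "i \<in> {1..n}" for i
  proof -
    obtain a where "a \<in> {1..n}" "i = \<sigma> a" using i permutes_image[OF *(3)] by (metis imageE)
    then have "\<chi> i = h (\<phi> a)" "\<phi> a \<in> {1..m}" using *(4) funcset_mem[OF \<phi>] by blast+
    then show ?thesis using permutes_in_image[OF h, of "\<phi> a"] by simp
  qed
  moreover have "mono_on {i \<in> {1..n}. \<phi> i = j} \<sigma>" for j
  proof (rule mono_onI)
    fix r s assume "r \<in> {i \<in> {1..n}. \<phi> i = j}" "s \<in> {i \<in> {1..n}. \<phi> i = j}" "r \<le> s"
    then show "\<sigma> r \<le> \<sigma> s" using *(5) by (cases "r = s") (auto intro: less_imp_le)
  qed
  ultimately have "is_exchange n m h \<phi> \<chi> \<sigma>" using * by (simp add: is_exchange_def PiE_def Pi_iff)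
  then show ?thesis by blast
qed

lemma ds_exchange_eq:
  assumes "is_exchange n m h \<phi> \<chi> \<sigma>" "\<phi> \<in> {1..n} \<rightarrow> {1..m}" "h permutes {1..m}"
  shows "ds_exchange n m h \<phi> = (\<chi>, \<sigma>)"
  unfolding ds_exchange_def is_exchange_def[symmetric]
proof (rule the_equality)
  show "case (\<chi>, \<sigma>) of (\<chi>, \<sigma>) \<Rightarrow> is_exchange n m h \<phi> \<chi> \<sigma>" using assms(1) by simp
  fix p assume "case p of (\<chi>, \<sigma>) \<Rightarrow> is_exchange n m h \<phi> \<chi> \<sigma>"
  then show "p = (\<chi>, \<sigma>)"
    using is_exchange_unique[OF _ assms(1,2) permutes_inj[OF assms(3)]] by (cases p) blast
qed

lemma is_exchange_surj:
  assumes "is_exchange n m h \<phi> \<chi> \<sigma>" "\<phi> ` {1..n} = {1..m}" "h permutes {1..m}"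
  shows "\<chi> ` {1..n} = {1..m}"
proof -
  have "\<chi> ` {1..n} = \<chi> ` \<sigma> ` {1..n}"
    using assms(1) permutes_image[of \<sigma>] by (simp add: is_exchange_def)
  also have "\<dots> = h ` \<phi> ` {1..n}"
    using assms(1) by (auto simp: is_exchange_def image_image)
  finally show ?thesis using assms(2) permutes_image[OF assms(3)] by simp
qed

definition is_ds :: "nat \<Rightarrow> nat \<Rightarrow> (nat \<Rightarrow> nat) \<Rightarrow> (nat \<Rightarrow> nat) \<Rightarrow> bool" where
  "is_ds n m \<phi> g \<longleftrightarrow> n \<ge> 1 \<and> m \<ge> 1 \<and> \<phi> \<in> {1..n} \<rightarrow>\<^sub>E {1..m} \<and> mono_on {1..n} \<phi> \<and>
     g permutes {1..n} \<and> \<phi> ` {1..n} = {1..m}"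

lemma EpiDeltaS_simps [simp]: "Obj EpiDeltaS = {1..}" "Dom EpiDeltaS = ds_dom" "Cod EpiDeltaS = ds_cod"
  "Comp EpiDeltaS = ds_comp" "Ident EpiDeltaS n = DS n n (\<lambda>i\<in>{1..n}. i) id"
  by (simp_all add: EpiDeltaS_def DeltaS_def)

lemma Mor_EpiDeltaS: "DS n m \<phi> g \<in> Mor EpiDeltaS \<longleftrightarrow> is_ds n m \<phi> g"
  by (auto simp: EpiDeltaS_def DeltaS_def is_ds_def)

lemma ds_comp_eq:
  assumes "is_ds n m \<phi> g" "is_ds m l \<psi> h" "is_exchange n m h \<phi> \<chi> \<sigma>"
  shows "ds_comp (DS m l \<psi> h) (DS n m \<phi> g) = DS n l (\<lambda>i\<in>{1..n}. \<psi> (\<chi> i)) (\<sigma> \<circ> g)"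
  using ds_exchange_eq[OF assms(3)] assms(1,2) by (auto simp: ds_comp_def is_ds_def PiE_def)

lemma is_ds_comp:
  assumes F: "is_ds n m \<phi> g" and G: "is_ds m l \<psi> h" and e: "is_exchange n m h \<phi> \<chi> \<sigma>"
  shows "is_ds n l (\<lambda>i\<in>{1..n}. \<psi> (\<chi> i)) (\<sigma> \<circ> g)"
proof -
  have c: "\<chi> \<in> {1..n} \<rightarrow> {1..m}" "mono_on {1..n} \<chi>" "\<sigma> permutes {1..n}"
    using e by (auto simp: is_exchange_def)
  have s: "\<chi> ` {1..n} = {1..m}" using is_exchange_surj[OF e] F G by (auto simp: is_ds_def)
  have "mono_on {1..n} (\<lambda>i\<in>{1..n}. \<psi> (\<chi> i))"
    using c G by (intro mono_onI) (auto simp: is_ds_def intro!: mono_onD[of "{1..m}" \<psi>] mono_onD[of "{1..n}" \<chi>])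
  moreover have "(\<lambda>i\<in>{1..n}. \<psi> (\<chi> i)) ` {1..n} = \<psi> ` \<chi> ` {1..n}" by (auto simp: image_image)
  ultimately show ?thesis
    using F G c s permutes_compose[of g "{1..n}" \<sigma>] by (auto simp: is_ds_def PiE_def Pi_iff)
qed

text \<open>Both bracketings are computed from exchange squares for three pairs. Pasting two such squares, side by
  side or on top of each other, gives an exchange square again, and exchange squares are unique.\<close>

lemma ds_comp_assoc:
  assumes F: "is_ds n m \<phi> g" and G: "is_ds m l \<psi> h" and H: "is_ds l p \<theta> q"
  shows "ds_comp (DS l p \<theta> q) (ds_comp (DS m l \<psi> h) (DS n m \<phi> g)) =
    ds_comp (ds_comp (DS l p \<theta> q) (DS m l \<psi> h)) (DS n m \<phi> g)"
proof -
  have f: "\<phi> \<in> {1..n} \<rightarrow> {1..m}" "\<psi> \<in> {1..m} \<rightarrow> {1..l}" "h permutes {1..m}" "q permutes {1..l}"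
    using F G H by (auto simp: is_ds_def)
  obtain \<chi> \<sigma> where e1: "is_exchange n m h \<phi> \<chi> \<sigma>" using is_exchange_exists[OF f(1,3)] by auto
  obtain \<chi>' \<sigma>' where e2: "is_exchange m l q \<psi> \<chi>' \<sigma>'" using is_exchange_exists[OF f(2,4)] by auto
  have c1: "\<chi> \<in> {1..n} \<rightarrow>\<^sub>E {1..m}" "mono_on {1..n} \<chi>" "\<sigma> permutes {1..n}" "\<And>i. i \<in> {1..n} \<Longrightarrow> h (\<phi> i) = \<chi> (\<sigma> i)"
    and c2: "\<chi>' \<in> {1..m} \<rightarrow>\<^sub>E {1..l}" "mono_on {1..m} \<chi>'" "\<sigma>' permutes {1..m}" "\<And>i. i \<in> {1..m} \<Longrightarrow> q (\<psi> i) = \<chi>' (\<sigma>' i)"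
    using e1 e2 by (auto simp: is_exchange_def)
  have c1': "\<chi> \<in> {1..n} \<rightarrow> {1..m}" using c1(1) by auto
  obtain \<chi>4 \<sigma>4 where e4: "is_exchange n m \<sigma>' \<chi> \<chi>4 \<sigma>4" using is_exchange_exists[OF c1' c2(3)] by auto
  have c4: "\<chi>4 \<in> {1..n} \<rightarrow>\<^sub>E {1..m}" "mono_on {1..n} \<chi>4" "\<sigma>4 permutes {1..n}"
    "\<And>i. i \<in> {1..n} \<Longrightarrow> \<sigma>' (\<chi> i) = \<chi>4 (\<sigma>4 i)"
    using e4 by (auto simp: is_exchange_def)
  have s1: "\<sigma> i \<in> {1..n}" "\<sigma>4 i \<in> {1..n}" if "i \<in> {1..n}" for i
    using that permutes_in_image[OF c1(3)] permutes_in_image[OF c4(3)] by blast+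
  have s2: "\<chi> i \<in> {1..m}" "\<chi>4 i \<in> {1..m}" "\<phi> i \<in> {1..m}" if "i \<in> {1..n}" for i
    using that c1(1) c4(1) f(1) by blast+
  have s3: "\<sigma>' i \<in> {1..m}" "\<chi>' i \<in> {1..l}" if "i \<in> {1..m}" for i
    using that permutes_in_image[OF c2(3)] c2(1) by blast+
  \<comment> \<open>the squares of \<open>h\<close> and \<open>\<sigma>'\<close> over \<open>\<phi>\<close> and \<open>\<chi>\<close>, on top of each other\<close>
  have e5: "is_exchange n m (\<sigma>' \<circ> h) \<phi> \<chi>4 (\<sigma>4 \<circ> \<sigma>)"
    unfolding is_exchange_def
  proof (intro conjI ballI)
    show "\<sigma>4 \<circ> \<sigma> permutes {1..n}" using permutes_compose c1 c4 by blast
    show "(\<sigma>' \<circ> h) (\<phi> i) = \<chi>4 ((\<sigma>4 \<circ> \<sigma>) i)" if "i \<in> {1..n}" for i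
      using c1(4)[OF that] c4(4)[OF s1(1)[OF that]] by simp
    fix j
    show "mono_on {i \<in> {1..n}. \<phi> i = j} (\<sigma>4 \<circ> \<sigma>)"
    proof (rule mono_onI)
      fix a b assume ab: "a \<in> {i \<in> {1..n}. \<phi> i = j}" "b \<in> {i \<in> {1..n}. \<phi> i = j}" "a \<le> b"
      show "(\<sigma>4 \<circ> \<sigma>) a \<le> (\<sigma>4 \<circ> \<sigma>) b"
      proof (cases "a = b")
        case False
        then have 1: "\<sigma> a < \<sigma> b" using is_exchange_strict[OF e1 f(1), of a b] ab by auto
        have "\<chi> (\<sigma> a) = \<chi> (\<sigma> b)" using c1(4)[of a] c1(4)[of b] ab by auto
        then show ?thesis using is_exchange_strict[OF e4 c1' _ _ 1] s1 ab by auto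
      qed simp
    qed
  qed (use c4 in auto)
  \<comment> \<open>the squares of \<open>q\<close> and \<open>\<sigma>'\<close> over \<open>\<psi>\<close> and \<open>\<chi>\<close>, side by side\<close>
  have e3: "is_exchange n l q (\<lambda>i\<in>{1..n}. \<psi> (\<chi> i)) (\<lambda>i\<in>{1..n}. \<chi>' (\<chi>4 i)) \<sigma>4"
    unfolding is_exchange_def
  proof (intro conjI ballI)
    show "(\<lambda>i\<in>{1..n}. \<chi>' (\<chi>4 i)) \<in> {1..n} \<rightarrow>\<^sub>E {1..l}" using s2 s3 by auto
    show "mono_on {1..n} (\<lambda>i\<in>{1..n}. \<chi>' (\<chi>4 i))"
      using s2 by (intro mono_onI) (auto intro!: mono_onD[OF c2(2)] mono_onD[OF c4(2)])
    show "q ((\<lambda>i\<in>{1..n}. \<psi> (\<chi> i)) i) = (\<lambda>i\<in>{1..n}. \<chi>' (\<chi>4 i)) (\<sigma>4 i)" if "i \<in> {1..n}" for i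
      using that s1(2)[OF that] c2(4)[OF s2(1)[OF that]] c4(4)[OF that] by simp
    fix j
    show "mono_on {i \<in> {1..n}. (\<lambda>i\<in>{1..n}. \<psi> (\<chi> i)) i = j} \<sigma>4"
    proof (rule mono_onI)
      fix a b assume "a \<in> {i \<in> {1..n}. (\<lambda>i\<in>{1..n}. \<psi> (\<chi> i)) i = j}"
        "b \<in> {i \<in> {1..n}. (\<lambda>i\<in>{1..n}. \<psi> (\<chi> i)) i = j}" "a \<le> b"
      then have ab: "a \<in> {1..n}" "b \<in> {1..n}" "\<psi> (\<chi> a) = \<psi> (\<chi> b)" "a \<le> b" by auto
      then have "\<chi> a \<le> \<chi> b" using mono_onD[OF c1(2)] by blast
      then consider "a = b" | "a < b" "\<chi> a = \<chi> b" | "\<chi> a < \<chi> b" using ab by linarith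
      then show "\<sigma>4 a \<le> \<sigma>4 b"
      proof cases
        case 2
        then show ?thesis using is_exchange_strict[OF e4 c1' ab(1,2)] by simp
      next
        case 3
        then have "\<sigma>' (\<chi> a) < \<sigma>' (\<chi> b)"
          using is_exchange_strict[OF e2 f(2) s2(1) s2(1)] ab by blast
        then have "\<not> \<chi>4 (\<sigma>4 b) \<le> \<chi>4 (\<sigma>4 a)" using c4(4) ab by simp
        then show ?thesis using mono_onD[OF c4(2) s1(2)[OF ab(2)] s1(2)[OF ab(1)]] by linarith
      qed simp
    qed
  qed (use c4 in auto)
  have "ds_comp (DS l p \<theta> q) (ds_comp (DS m l \<psi> h) (DS n m \<phi> g))
      = DS n p (\<lambda>i\<in>{1..n}. \<theta> ((\<lambda>i\<in>{1..n}. \<chi>' (\<chi>4 i)) i)) (\<sigma>4 \<circ> (\<sigma> \<circ> g))"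
    unfolding ds_comp_eq[OF F G e1] by (rule ds_comp_eq[OF is_ds_comp[OF F G e1] H e3])
  moreover have "ds_comp (ds_comp (DS l p \<theta> q) (DS m l \<psi> h)) (DS n m \<phi> g)
      = DS n p (\<lambda>i\<in>{1..n}. (\<lambda>i\<in>{1..m}. \<theta> (\<chi>' i)) (\<chi>4 i)) ((\<sigma>4 \<circ> \<sigma>) \<circ> g)"
    unfolding ds_comp_eq[OF G H e2] by (rule ds_comp_eq[OF F is_ds_comp[OF G H e2] e5])
  moreover have "(\<lambda>i\<in>{1..n}. \<theta> ((\<lambda>i\<in>{1..n}. \<chi>' (\<chi>4 i)) i)) = (\<lambda>i\<in>{1..n}. (\<lambda>i\<in>{1..m}. \<theta> (\<chi>' i)) (\<chi>4 i))"
    using s2 by auto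
  ultimately show ?thesis by (simp add: comp_assoc)
qed

lemma EpiDeltaS_cases:
  assumes "F \<in> Mor EpiDeltaS"
  obtains n m \<phi> g where "F = DS n m \<phi> g" "is_ds n m \<phi> g"
  using assms by (cases F) (auto simp: Mor_EpiDeltaS)

lemma EpiDeltaS_category: "category_cat EpiDeltaS"
proof
  fix F assume F: "F \<in> Mor EpiDeltaS"
  then show "Dom EpiDeltaS F \<in> Obj EpiDeltaS" "Cod EpiDeltaS F \<in> Obj EpiDeltaS"
    by (auto elim!: EpiDeltaS_cases simp: is_ds_def)
  fix G assume G: "G \<in> Mor EpiDeltaS" and FG: "Dom EpiDeltaS G = Cod EpiDeltaS F"
  obtain n m \<phi> g where F': "F = DS n m \<phi> g" "is_ds n m \<phi> g" using F by (rule EpiDeltaS_cases)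
  obtain l \<psi> h where G': "G = DS m l \<psi> h" "is_ds m l \<psi> h" using G FG F'(1) by (auto elim!: EpiDeltaS_cases)
  obtain \<chi> \<sigma> where e: "is_exchange n m h \<phi> \<chi> \<sigma>"
    using is_exchange_exists[of \<phi> n m h] F' G' by (auto simp: is_ds_def)
  show "Comp EpiDeltaS G F \<in> Mor EpiDeltaS \<and> Dom EpiDeltaS (Comp EpiDeltaS G F) = Dom EpiDeltaS F \<and>
      Cod EpiDeltaS (Comp EpiDeltaS G F) = Cod EpiDeltaS G"
    using ds_comp_eq[OF F'(2) G'(2) e] is_ds_comp[OF F'(2) G'(2) e] by (simp add: F' G' Mor_EpiDeltaS)
  fix H assume H: "H \<in> Mor EpiDeltaS" "Dom EpiDeltaS H = Cod EpiDeltaS G"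
  obtain p \<theta> q where "H = DS l p \<theta> q" "is_ds l p \<theta> q" using H G'(1) by (auto elim!: EpiDeltaS_cases)
  then show "Comp EpiDeltaS H (Comp EpiDeltaS G F) = Comp EpiDeltaS (Comp EpiDeltaS H G) F"
    using ds_comp_assoc[OF F'(2) G'(2)] F' G' by simp
next
  fix x assume "x \<in> Obj EpiDeltaS"
  then show "Ident EpiDeltaS x \<in> Mor EpiDeltaS \<and> Dom EpiDeltaS (Ident EpiDeltaS x) = x \<and>
      Cod EpiDeltaS (Ident EpiDeltaS x) = x"
    by (auto simp: Mor_EpiDeltaS is_ds_def permutes_id intro!: mono_onI)
qed

text \<open>This is why a string that does not end in \<open>1\<close> cannot reach \<open>1\<close> by losing its last morphism.\<close>

lemma EpiDeltaS_cod_le_dom: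
  assumes "F \<in> Mor EpiDeltaS" shows "ds_cod F \<le> ds_dom F"
proof -
  obtain n m \<phi> g where F: "F = DS n m \<phi> g" "is_ds n m \<phi> g" using assms by (rule EpiDeltaS_cases)
  then have "\<phi> ` {1..n} = {1..m}" by (simp add: is_ds_def)
  then have "card {1..m} \<le> card {1..n}" by (metis card_image_le finite_atLeastAtMost)
  then show ?thesis by (simp add: F)
qed

lemma Omega_simps [simp]: "Obj Omega = {1..}" "Dom Omega = om_dom" "Cod Omega = om_cod"
  "Ident Omega n = Om n n (\<lambda>i\<in>{1..n}. i)"
  by (simp_all add: Omega_def)

lemma Mor_Omega: "Om n m f \<in> Mor Omega \<longleftrightarrow>
    n \<ge> 1 \<and> m \<ge> 1 \<and> f \<in> {1..n} \<rightarrow>\<^sub>E {1..m} \<and> f ` {1..n} = {1..m}"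
  by (auto simp: Omega_def)

lemma om_fun_closed: "f \<in> Mor Omega \<Longrightarrow> i \<in> {1..om_dom f} \<Longrightarrow> om_fun f i \<in> {1..om_cod f}"
  by (cases f) (auto simp: Mor_Omega)

lemma om_fun_surj: "f \<in> Mor Omega \<Longrightarrow> j \<in> {1..om_cod f} \<Longrightarrow> \<exists>i\<in>{1..om_dom f}. om_fun f i = j"
proof -
  assume "f \<in> Mor Omega" "j \<in> {1..om_cod f}"
  then have "j \<in> om_fun f ` {1..om_dom f}" by (cases f) (simp add: Mor_Omega)
  then show ?thesis by blast
qed

lemma forget_U_simps [simp]: "om_dom (forget_U F) = ds_dom F" "om_cod (forget_U F) = ds_cod F"
  by (simp_all add: forget_U_def)

lemma forget_U_Mor:
  assumes "F \<in> Mor EpiDeltaS" shows "forget_U F \<in> Mor Omega"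
proof -
  obtain n m \<phi> g where F: "F = DS n m \<phi> g" "is_ds n m \<phi> g" using assms by (rule EpiDeltaS_cases)
  then have g: "g permutes {1..n}" by (simp add: is_ds_def)
  have "(\<lambda>i\<in>{1..n}. \<phi> (g i)) ` {1..n} = \<phi> ` g ` {1..n}" by (auto simp: image_image)
  then show ?thesis
    using F permutes_image[OF g] permutes_in_image[OF g]
    by (auto simp: forget_U_def Mor_Omega is_ds_def PiE_iff)
qed

lemma forget_U_comp:
  assumes "F \<in> Mor EpiDeltaS" "G \<in> Mor EpiDeltaS" "ds_dom G = ds_cod F"
  shows "forget_U (ds_comp G F) = Comp Omega (forget_U G) (forget_U F)"
proof -
  obtain n m \<phi> g where F': "F = DS n m \<phi> g" "is_ds n m \<phi> g" using assms(1) by (rule EpiDeltaS_cases)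
  obtain l \<psi> h where G': "G = DS m l \<psi> h" "is_ds m l \<psi> h"
    using assms(2,3) F'(1) by (auto elim!: EpiDeltaS_cases)
  obtain \<chi> \<sigma> where e: "is_exchange n m h \<phi> \<chi> \<sigma>"
    using is_exchange_exists[of \<phi> n m h] F' G' by (auto simp: is_ds_def)
  have p: "g permutes {1..n}" "\<sigma> permutes {1..n}" and \<phi>: "\<phi> \<in> {1..n} \<rightarrow> {1..m}"
    using F' e by (auto simp: is_ds_def is_exchange_def)
  have g: "g i \<in> {1..n}" "\<sigma> (g i) \<in> {1..n}" "\<phi> (g i) \<in> {1..m}" if "i \<in> {1..n}" for i
    using that permutes_in_image[OF p(1)] permutes_in_image[OF p(2)] \<phi> by blast+
  have ex: "\<chi> (\<sigma> i) = h (\<phi> i)" if "i \<in> {1..n}" for i using that e by (simp add: is_exchange_def)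
  have "(if \<sigma> (g i) \<in> {1..n} then \<psi> (\<chi> (\<sigma> (g i))) else undefined) = (if \<phi> (g i) \<in> {1..m} then \<psi> (h (\<phi> (g i))) else undefined)"
    if "i \<in> {1..n}" for i using g[OF that] ex[OF g(1)[OF that]] by simp
  then show ?thesis
    unfolding F'(1) G'(1) ds_comp_eq[OF F'(2) G'(2) e] forget_U_def Omega_def
    by (auto simp: restrict_def)
qed

lemma forget_U_ident: "forget_U (DS n n (\<lambda>i\<in>{1..n}. i) id) = Om n n (\<lambda>i\<in>{1..n}. i)"
  by (auto simp: forget_U_def)

text \<open>Order the fibres of a surjection by the order of its source: this is the stable sorting factorization.\<close>

lemma forget_U_surj:
  assumes "f \<in> Mor Omega" shows "\<exists>F\<in>Mor EpiDeltaS. forget_U F = f"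
proof -
  obtain n m u where f: "f = Om n m u" by (cases f)
  then have u: "n \<ge> 1" "m \<ge> 1" "u \<in> {1..n} \<rightarrow>\<^sub>E {1..m}" "u ` {1..n} = {1..m}"
    using assms by (auto simp: Mor_Omega)
  obtain \<chi> \<sigma> where *: "\<chi> \<in> extensional {1..n}" "mono_on {1..n} \<chi>" "\<sigma> permutes {1..n}"
    "\<And>i. i \<in> {1..n} \<Longrightarrow> \<chi> (\<sigma> i) = u i"
    using stable_sort_exists[of n u] by auto
  have "\<chi> ` {1..n} = \<chi> ` \<sigma> ` {1..n}" using permutes_image[OF *(3)] by simp
  also have "\<dots> = u ` {1..n}" using *(4) by (auto simp: image_image)
  finally have im: "\<chi> ` {1..n} = {1..m}" using u by simp
  have "is_ds n m \<chi> \<sigma>" using im u * by (auto simp: is_ds_def PiE_def)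
  moreover have "forget_U (DS n m \<chi> \<sigma>) = f"
    using *(4) u(3) by (auto simp: forget_U_def f PiE_def intro!: extensionalityI[of _ "{1..n}"])
  ultimately show ?thesis using Mor_EpiDeltaS by blast
qed

lemma forget_U_path:
  assumes "is_path EpiDeltaS x fs y" shows "is_path Omega x (map forget_U fs) y"
  using assms by (induction fs arbitrary: x) (auto simp: forget_U_Mor)

lemma forget_U_path_surj:
  assumes "is_path Omega x gs y" shows "\<exists>fs. is_path EpiDeltaS x fs y \<and> map forget_U fs = gs"
  using assms
proof (induction gs arbitrary: x)
  case (Cons g gs)
  then obtain fs where fs: "is_path EpiDeltaS (om_cod g) fs y" "map forget_U fs = gs" by auto
  obtain F where F: "F \<in> Mor EpiDeltaS" "forget_U F = g" using forget_U_surj Cons.prems by auto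
  then show ?case using fs Cons.prems by (intro exI[of _ "F # fs"]) auto
qed auto

lemma merge_at_forget_U:
  assumes "is_path EpiDeltaS x fs y" "i < length fs"
  shows "merge_at Omega i (map forget_U fs) = map forget_U (merge_at EpiDeltaS i fs)"
  using assms
proof (induction i arbitrary: x fs)
  case 0
  then show ?case by (cases fs; cases "tl fs") (auto simp: forget_U_comp)
next
  case (Suc i)
  then show ?case by (cases fs) auto
qed

lemma str_face_forget_U:
  assumes "is_path EpiDeltaS x fs y" "i \<le> length fs" "fs \<noteq> []"
  shows "str_face Omega i (x, map forget_U fs) = map_prod id (map forget_U) (str_face EpiDeltaS i (x, fs))"
proof (cases i)
  case 0
  then show ?thesis using assms by (cases fs) (auto simp: str_face_0)
next
  case (Suc j)
  then show ?thesis using assms merge_at_forget_U[OF assms(1), of j] by (simp add: str_face_Suc)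
qed

lemma str_degen_forget_U:
  assumes "i \<le> length fs"
  shows "str_degen Omega i (x, map forget_U fs) = map_prod id (map forget_U) (str_degen EpiDeltaS i (x, fs))"
proof -
  have "str_vertex Omega (x, map forget_U fs) i = str_vertex EpiDeltaS (x, fs) i"
    using assms by (simp add: str_vertex_def)
  then show ?thesis by (simp add: str_degen_def take_map drop_map forget_U_ident[simplified])
qed


section \<open>Chains of a category with coefficients in a functor\<close>

lemma image_case_prod_Collect: "(\<lambda>(s, y). f s y) ` {(s, y). P s y} = {f s y |s y. P s y}"
  by (auto simp: image_iff)

locale category_functor = category_cat C for C :: "('o,'m) cat" +
  fixes k :: "'k ring" and Fo :: "'o \<Rightarrow> ('k,'c) module" and Fm :: "'m \<Rightarrow> 'c \<Rightarrow> 'c"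
  assumes base_ring: "cring k"
    and Fo_module: "x \<in> Obj C \<Longrightarrow> module k (Fo x)"
    and Fm_hom: "f \<in> Mor C \<Longrightarrow> Fm f \<in> mod_hom k (Fo (Dom C f)) (Fo (Cod C f))"
    and Fm_comp: "f \<in> Mor C \<Longrightarrow> g \<in> Mor C \<Longrightarrow> Dom C g = Cod C f \<Longrightarrow>
      y \<in> carrier (Fo (Dom C f)) \<Longrightarrow> Fm (Comp C g f) y = Fm g (Fm f y)"
begin

abbreviation "chain_mod \<equiv> cat_chain_mod C Fo"
abbreviation "chain_elt \<equiv> cat_chain_elt C Fo"
abbreviation "chain_simp \<equiv> cat_chains k C Fo Fm"

lemma source_module: "s \<in> strings C n \<Longrightarrow> module k (Fo (fst s))"
  by (cases s) (auto simp: mem_strings dest: is_path_source_obj intro: Fo_module)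

lemma module_chain_mod: "module k (chain_mod n)"
  unfolding cat_chain_mod_def by (rule module_dsum[OF base_ring source_module])

lemma chain_elt_hom: "s \<in> strings C n \<Longrightarrow> chain_elt n s \<in> mod_hom k (Fo (fst s)) (chain_mod n)"
  unfolding cat_chain_mod_def cat_chain_elt_def[abs_def]
  by (rule dincl_hom[where M = "\<lambda>s. Fo (fst s)", OF source_module])

lemma chain_lift:
  assumes "module k N" "\<And>s. s \<in> strings C n \<Longrightarrow> h s \<in> mod_hom k (Fo (fst s)) N"
  shows "\<exists>g \<in> mod_hom k (chain_mod n) N.
    \<forall>s\<in>strings C n. \<forall>y\<in>carrier (Fo (fst s)). g (chain_elt n s y) = h s y"
  unfolding cat_chain_mod_def cat_chain_elt_def
  by (rule dsum_lift[OF base_ring source_module assms])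

lemma generates_chain_mod:
  "generates k (chain_mod n)
    ((\<lambda>(s, y). chain_elt n s y) ` {(s, y). s \<in> strings C n \<and> y \<in> carrier (Fo (fst s))})"
proof -
  have "(\<lambda>(s, y). chain_elt n s y) ` {(s, y). s \<in> strings C n \<and> y \<in> carrier (Fo (fst s))} =
    {dincl (strings C n) (\<lambda>s. Fo (fst s)) s y |s y. s \<in> strings C n \<and> y \<in> carrier (Fo (fst s))}"
    by (simp only: cat_chain_elt_def image_case_prod_Collect)
  then show ?thesis
    using generates_dsum[where Z = "strings C n" and M = "\<lambda>s. Fo (fst s)"
        and E = "\<lambda>s. carrier (Fo (fst s))", OF base_ring source_module generates_carrier]
    by (simp only: cat_chain_mod_def)
qed

lemma chain_map_eq:
  assumes "module k N" "g \<in> mod_hom k (chain_mod n) N" "h \<in> mod_hom k (chain_mod n) N"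
    and "\<And>s y. s \<in> strings C n \<Longrightarrow> y \<in> carrier (Fo (fst s)) \<Longrightarrow> g (chain_elt n s y) = h (chain_elt n s y)"
    and "c \<in> carrier (chain_mod n)"
  shows "g c = h c"
  by (rule mod_hom_eq_on_generators[OF module_chain_mod assms(1-3) generates_chain_mod _ assms(5)])
    (use assms(4) in auto)

lemma chains_smod [simp]: "smod chain_simp = chain_mod"
  by (simp add: cat_chains_def)

definition face_coeff where "face_coeff i s y = (if i = 0 then Fm (hd (snd s)) y else y)"

lemma face_coeff_hom:
  assumes "s \<in> strings C (Suc n)" "i \<le> Suc n"
  shows "face_coeff i s \<in> mod_hom k (Fo (fst s)) (Fo (fst (str_face C i s)))"
proof -
  obtain x f fs y where s: "s = (x, f # fs)" "is_path C x (f # fs) y" "length fs = n"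
    using assms(1) by (cases s; cases "snd s") (auto simp: mem_strings)
  show ?thesis
  proof (cases i)
    case 0
    then show ?thesis using s Fm_hom[of f] by (auto simp: face_coeff_def[abs_def] str_face_0)
  next
    case (Suc j)
    then show ?thesis using s assms(2)
      by (auto simp: face_coeff_def[abs_def] str_face_Suc intro: mod_homI)
  qed
qed

lemma face_works:
  assumes i: "i \<le> Suc n"
  shows face_hom: "sface chain_simp (Suc n) i \<in> mod_hom k (chain_mod (Suc n)) (chain_mod n)"
    and face_elt: "\<And>s y. s \<in> strings C (Suc n) \<Longrightarrow> y \<in> carrier (Fo (fst s)) \<Longrightarrow>
      sface chain_simp (Suc n) i (chain_elt (Suc n) s y) = chain_elt n (str_face C i s) (face_coeff i s y)"
proof -
  let ?J = "{(s, y). s \<in> strings C (Suc n) \<and> y \<in> carrier (Fo (fst s))}"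
  let ?e = "\<lambda>(s, y). chain_elt (Suc n) s y"
  let ?v = "\<lambda>(s, y). chain_elt n (str_face C i s) (if i = 0 then Fm (hd (snd s)) y else y)"
  have "\<exists>g \<in> mod_hom k (chain_mod (Suc n)) (chain_mod n).
    \<forall>s\<in>strings C (Suc n). \<forall>y\<in>carrier (Fo (fst s)).
      g (chain_elt (Suc n) s y) = chain_elt n (str_face C i s) (face_coeff i s y)"
    by (rule chain_lift[OF module_chain_mod])
      (rule mod_hom_comp[OF chain_elt_hom[OF str_face_strings] face_coeff_hom], use i in auto)
  then obtain g where "g \<in> mod_hom k (chain_mod (Suc n)) (chain_mod n)"
    "\<And>s y. s \<in> strings C (Suc n) \<Longrightarrow> y \<in> carrier (Fo (fst s)) \<Longrightarrow>
      g (chain_elt (Suc n) s y) = chain_elt n (str_face C i s) (face_coeff i s y)"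
    by blast
  then have ex: "\<exists>g \<in> mod_hom k (chain_mod (Suc n)) (chain_mod n). \<forall>j\<in>?J. g (?e j) = ?v j"
    by (intro bexI[of _ g]) (auto simp: face_coeff_def simp del: split_paired_All)
  have face: "sface chain_simp (Suc n) i = lin_ext k (chain_mod (Suc n)) (chain_mod n) ?J ?e ?v"
    by (simp add: cat_chains_def)
  note works = lin_ext_works[OF module_chain_mod module_chain_mod generates_chain_mod ex]
  show "sface chain_simp (Suc n) i \<in> mod_hom k (chain_mod (Suc n)) (chain_mod n)"
    unfolding face by (rule works(1))
  show "sface chain_simp (Suc n) i (chain_elt (Suc n) s y) = chain_elt n (str_face C i s) (face_coeff i s y)"
    if "s \<in> strings C (Suc n)" "y \<in> carrier (Fo (fst s))" for s y
    unfolding face using works(2)[of "(s, y)"] that by (simp add: face_coeff_def)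
qed

lemma degen_strings:
  assumes "s \<in> strings C n" "i \<le> n"
  shows "str_degen C i s \<in> strings C (Suc n)" "fst (str_degen C i s) = fst s"
  using assms str_degen_path[of "fst s" "snd s" _ i] by (cases s; force simp: mem_strings)+

lemma degen_works:
  assumes i: "i \<le> n"
  shows degen_hom: "sdegen chain_simp n i \<in> mod_hom k (chain_mod n) (chain_mod (Suc n))"
    and degen_elt: "\<And>s y. s \<in> strings C n \<Longrightarrow> y \<in> carrier (Fo (fst s)) \<Longrightarrow>
      sdegen chain_simp n i (chain_elt n s y) = chain_elt (Suc n) (str_degen C i s) y"
proof -
  let ?J = "{(s, y). s \<in> strings C n \<and> y \<in> carrier (Fo (fst s))}"
  let ?e = "\<lambda>(s, y). chain_elt n s y"
  let ?v = "\<lambda>(s, y). chain_elt (n + 1) (str_degen C i s) y"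
  have "chain_elt (Suc n) (str_degen C i s) \<in> mod_hom k (Fo (fst s)) (chain_mod (Suc n))"
    if "s \<in> strings C n" for s
    using chain_elt_hom[OF degen_strings(1)[OF that i]] degen_strings(2)[OF that i] by simp
  from chain_lift[OF module_chain_mod this]
  obtain g where "g \<in> mod_hom k (chain_mod n) (chain_mod (Suc n))"
    "\<And>s y. s \<in> strings C n \<Longrightarrow> y \<in> carrier (Fo (fst s)) \<Longrightarrow>
      g (chain_elt n s y) = chain_elt (Suc n) (str_degen C i s) y"
    by blast
  then have ex: "\<exists>g \<in> mod_hom k (chain_mod n) (chain_mod (n + 1)). \<forall>j\<in>?J. g (?e j) = ?v j"
    by (intro bexI[of _ g]) (auto simp del: split_paired_All)
  have degen: "sdegen chain_simp n i = lin_ext k (chain_mod n) (chain_mod (n + 1)) ?J ?e ?v"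
    by (simp add: cat_chains_def)
  note works = lin_ext_works[OF module_chain_mod module_chain_mod generates_chain_mod ex]
  show "sdegen chain_simp n i \<in> mod_hom k (chain_mod n) (chain_mod (Suc n))"
    unfolding degen using works(1) by simp
  show "sdegen chain_simp n i (chain_elt n s y) = chain_elt (Suc n) (str_degen C i s) y"
    if "s \<in> strings C n" "y \<in> carrier (Fo (fst s))" for s y
    unfolding degen using works(2)[of "(s, y)"] that by simp
qed

lemma face_coeff_face_coeff:
  assumes s: "s \<in> strings C (Suc (Suc n))" and y: "y \<in> carrier (Fo (fst s))"
    and ij: "i < j" "j \<le> Suc (Suc n)"
  shows "face_coeff i (str_face C j s) (face_coeff j s y) =
    face_coeff (j - 1) (str_face C i s) (face_coeff i s y)"
proof -
  obtain x f g gs z where fg: "s = (x, f # g # gs)" "is_path C x (f # g # gs) z" "length gs = n"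
  proof -
    obtain x fs z where "s = (x, fs)" "is_path C x fs z" "length fs = Suc (Suc n)"
      using s by (cases s) (auto simp: mem_strings)
    then show ?thesis using that by (cases fs; cases "tl fs") auto
  qed
  obtain j' where j: "j = Suc j'" using ij by (cases j) auto
  show ?thesis
  proof (cases i)
    case 0
    show ?thesis
    proof (cases j')
      case 0
      then show ?thesis using fg y j \<open>i = 0\<close> Fm_comp[of f g y]
        by (auto simp: face_coeff_def str_face_Suc str_face_0)
    next
      case (Suc j'')
      then show ?thesis using fg j ij \<open>i = 0\<close> by (simp add: face_coeff_def str_face_Suc str_face_0)
    qed
  qed (use ij in \<open>auto simp: face_coeff_def\<close>)
qed

lemma chains_linear_faces: "has_linear_faces k chain_simp"
  by (simp add: has_linear_faces_def module_chain_mod face_hom)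

lemma chains_face_identities: "has_face_identities k chain_simp"
  unfolding has_face_identities_def
proof (intro allI impI)
  fix n i j c assume ij: "i < j" "j \<le> Suc (Suc n)" and c: "c \<in> carrier (smod chain_simp (Suc (Suc n)))"
  have le: "i \<le> Suc n" "i \<le> Suc (Suc n)" "j - 1 \<le> Suc n" using ij by linarith+
  have c': "c \<in> carrier (chain_mod (Suc (Suc n)))" using c by simp
  show "sface chain_simp (Suc n) i (sface chain_simp (Suc (Suc n)) j c) =
    sface chain_simp (Suc n) (j - 1) (sface chain_simp (Suc (Suc n)) i c)"
  proof (rule chain_map_eq[OF module_chain_mod _ _ _ c'])
    show "(\<lambda>c. sface chain_simp (Suc n) i (sface chain_simp (Suc (Suc n)) j c))
        \<in> mod_hom k (chain_mod (Suc (Suc n))) (chain_mod n)"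
      by (rule mod_hom_comp[OF face_hom[OF le(1)] face_hom[OF ij(2)]])
    show "(\<lambda>c. sface chain_simp (Suc n) (j - 1) (sface chain_simp (Suc (Suc n)) i c))
        \<in> mod_hom k (chain_mod (Suc (Suc n))) (chain_mod n)"
      by (rule mod_hom_comp[OF face_hom[OF le(3)] face_hom[OF le(2)]])
    fix s y assume s: "s \<in> strings C (Suc (Suc n))" and y: "y \<in> carrier (Fo (fst s))"
    note cl = mod_hom_closed[OF face_coeff_hom[OF s] y]
    have "str_face C i (str_face C j s) = str_face C (j - 1) (str_face C i s)"
      using str_face_str_face[OF _ ij] s by (cases s) simp
    then show "sface chain_simp (Suc n) i (sface chain_simp (Suc (Suc n)) j (chain_elt (Suc (Suc n)) s y)) =
      sface chain_simp (Suc n) (j - 1) (sface chain_simp (Suc (Suc n)) i (chain_elt (Suc (Suc n)) s y))"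
      using s y ij le cl
      by (simp add: face_elt str_face_strings face_coeff_face_coeff)
  qed
qed

lemma chains_chain_cx: "is_chain_cx k (assoc_cx chain_simp)"
  by (rule assoc_cx_is_chain_cx[OF chains_linear_faces chains_face_identities])

end


section \<open>Tensor powers of the augmentation ideal\<close>

context augmented_algebra begin

abbreviation "I \<equiv> aug_ideal k A \<epsilon>"
abbreviation "IP \<equiv> Ipow k A \<epsilon>"
abbreviation "pure \<equiv> Ipure k A \<epsilon>"
abbreviation "tup \<equiv> Ituples k A \<epsilon>"

lemma base_cring: "cring k" and alg_cring: "cring A" and alg_module: "module k A"
  by (rule R_cring M_cring module)+


lemma I_simps [simp]: "x \<oplus>\<^bsub>I\<^esub> y = x \<oplus>\<^bsub>A\<^esub> y" "\<zero>\<^bsub>I\<^esub> = \<zero>\<^bsub>A\<^esub>" "r \<odot>\<^bsub>I\<^esub> x = r \<odot>\<^bsub>A\<^esub> x"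
  by (simp_all add: aug_ideal_def)

lemma carrier_I: "x \<in> carrier I \<longleftrightarrow> x \<in> carrier A \<and> \<epsilon> x = \<zero>\<^bsub>k\<^esub>"
  by (simp add: aug_ideal_def a_kernel_def' )

lemma I_into_A: "x \<in> carrier I \<Longrightarrow> x \<in> carrier A"
  by (simp add: carrier_I)

lemma eps_hom:
  shows eps_closed: "x \<in> carrier A \<Longrightarrow> \<epsilon> x \<in> carrier k"
    and eps_mult: "x \<in> carrier A \<Longrightarrow> y \<in> carrier A \<Longrightarrow> \<epsilon> (x \<otimes>\<^bsub>A\<^esub> y) = \<epsilon> x \<otimes>\<^bsub>k\<^esub> \<epsilon> y"
    and eps_add: "x \<in> carrier A \<Longrightarrow> y \<in> carrier A \<Longrightarrow> \<epsilon> (x \<oplus>\<^bsub>A\<^esub> y) = \<epsilon> x \<oplus>\<^bsub>k\<^esub> \<epsilon> y"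
    and eps_one: "\<epsilon> \<one>\<^bsub>A\<^esub> = \<one>\<^bsub>k\<^esub>"
  using aug_ring_hom by (auto simp: ring_hom_def)

lemma eps_zero: "\<epsilon> \<zero>\<^bsub>A\<^esub> = \<zero>\<^bsub>k\<^esub>"
  using aug_smult[of "\<zero>\<^bsub>k\<^esub>" "\<zero>\<^bsub>A\<^esub>"] eps_closed[of "\<zero>\<^bsub>A\<^esub>"] by simp

lemma module_I: "module k I"
proof -
  have "submodule (carrier I) k A"
    by (rule submoduleI_linear[OF alg_module]) (auto simp: carrier_I eps_add eps_zero aug_smult)
  from submodule.submodule_is_module[OF this alg_module] show ?thesis
    by (simp add: aug_ideal_def)
qed

lemma I_mult: "x \<in> carrier I \<Longrightarrow> a \<in> carrier A \<Longrightarrow> x \<otimes>\<^bsub>A\<^esub> a \<in> carrier I"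
  by (simp add: carrier_I eps_mult eps_closed)

text \<open>Nonempty products suffice in what follows because all maps are surjective; the empty product is \<open>\<one>\<close>.\<close>

lemma finprod_in_I:
  assumes "finite X" "X \<noteq> {}" "\<And>i. i \<in> X \<Longrightarrow> y i \<in> carrier I"
  shows "(\<Otimes>\<^bsub>A\<^esub>i\<in>X. y i) \<in> carrier I"
proof -
  obtain i where i: "i \<in> X" using assms(2) by auto
  have y: "y \<in> X - {i} \<rightarrow> carrier A" "y i \<in> carrier A" using assms(3) i I_into_A by auto
  have "(\<Otimes>\<^bsub>A\<^esub>i\<in>insert i (X - {i}). y i) = y i \<otimes>\<^bsub>A\<^esub> (\<Otimes>\<^bsub>A\<^esub>i\<in>X - {i}. y i)"
    by (rule finprod_insert) (use assms(1) y in auto)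
  then show ?thesis using i I_mult[OF assms(3)[OF i] finprod_closed[OF y(1)]]
    by (simp add: insert_absorb)
qed

lemma tuples_I: "y \<in> tup n \<Longrightarrow> i \<in> {1..n} \<Longrightarrow> y i \<in> carrier I"
  by (auto simp: tuples_def)

lemma om_push_closed:
  assumes "f \<in> Mor Omega" "y \<in> tup (om_dom f)"
  shows "om_push A f y \<in> tup (om_cod f)"
proof -
  have "(\<Otimes>\<^bsub>A\<^esub>i\<in>{i\<in>{1..om_dom f}. om_fun f i = j}. y i) \<in> carrier I" if "j \<in> {1..om_cod f}" for j
    using om_fun_surj[OF assms(1) that] tuples_I[OF assms(2)] by (intro finprod_in_I) auto
  then show ?thesis by (auto simp: om_push_def tuples_def)
qed

text \<open>As a function of the entry \<open>u\<close> in position \<open>i\<close>, only the factor of the fibre through \<open>i\<close> changes, and it is \<open>u\<close> times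
  a fixed element of \<open>A\<close>. This is the multilinearity that is needed to act on tensor powers.\<close>

lemma om_push_upd:
  assumes f: "f \<in> Mor Omega" and y: "y \<in> tup (om_dom f)" and i: "i \<in> {1..om_dom f}"
  shows "\<exists>c\<in>carrier A. \<forall>u\<in>carrier I. om_push A f (y(i := u)) = (om_push A f y)(om_fun f i := u \<otimes>\<^bsub>A\<^esub> c)"
proof (intro bexI ballI)
  let ?fib = "\<lambda>j. {i\<in>{1..om_dom f}. om_fun f i = j}"
  define X where "X = ?fib (om_fun f i) - {i}"
  let ?c = "\<Otimes>\<^bsub>A\<^esub>i\<in>X. y i"
  have yA: "y j \<in> carrier A" if "j \<in> {1..om_dom f}" for j using tuples_I[OF y that] I_into_A by blast
  have yX: "y \<in> X \<rightarrow> carrier A" using yA by (auto simp: X_def)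
  show "?c \<in> carrier A" by (rule finprod_closed[OF yX])
  fix u assume u: "u \<in> carrier I"
  have uA: "u \<in> carrier A" using u by (rule I_into_A)
  have "(\<Otimes>\<^bsub>A\<^esub>a\<in>?fib (om_fun f i). (y(i := u)) a) = u \<otimes>\<^bsub>A\<^esub> ?c"
  proof -
    have "?fib (om_fun f i) = insert i X" using i by (auto simp: X_def)
    moreover have "(\<Otimes>\<^bsub>A\<^esub>a\<in>insert i X. (y(i := u)) a) = (y(i := u)) i \<otimes>\<^bsub>A\<^esub> (\<Otimes>\<^bsub>A\<^esub>a\<in>X. (y(i := u)) a)"
      by (rule finprod_insert) (use uA yA in \<open>auto simp: X_def\<close>)
    moreover have "(\<Otimes>\<^bsub>A\<^esub>a\<in>X. (y(i := u)) a) = ?c"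
      by (rule finprod_cong') (use yX in \<open>auto simp: X_def\<close>)
    ultimately show ?thesis by simp
  qed
  moreover have "(\<Otimes>\<^bsub>A\<^esub>a\<in>?fib j. (y(i := u)) a) = (\<Otimes>\<^bsub>A\<^esub>a\<in>?fib j. y a)" if "j \<noteq> om_fun f i" for j
    by (rule finprod_cong') (use yA that in auto)
  moreover have "om_fun f i \<in> {1..om_cod f}" using om_fun_closed[OF f i] .
  ultimately show "om_push A f (y(i := u)) = (om_push A f y)(om_fun f i := u \<otimes>\<^bsub>A\<^esub> ?c)"
    by (intro ext) (auto simp: om_push_def restrict_def)
qed

definition push :: "om_mor \<Rightarrow> ((nat \<Rightarrow> 'a) \<Rightarrow> 'k) set \<Rightarrow> ((nat \<Rightarrow> 'a) \<Rightarrow> 'k) set" where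
  "push f = lin_ext k (IP (om_dom f)) (IP (om_cod f)) (tup (om_dom f))
     (pure (om_dom f)) (\<lambda>y. pure (om_cod f) (om_push A f y))"

lemma push_works:
  assumes f: "f \<in> Mor Omega"
  shows push_hom: "push f \<in> mod_hom k (IP (om_dom f)) (IP (om_cod f))"
    and push_pure: "\<And>y. y \<in> tup (om_dom f) \<Longrightarrow>
      push f (pure (om_dom f) y) = pure (om_cod f) (om_push A f y)"
proof -
  note T = module_tpow[OF base_cring] and P = pure_tens_multilinear[OF base_cring module_I]
  have "\<exists>h \<in> mod_hom k (IP (om_dom f)) (IP (om_cod f)).
    \<forall>y\<in>tup (om_dom f). h (pure (om_dom f) y) = pure (om_cod f) (om_push A f y)"
  proof (rule tpow_lift[OF base_cring module_I T pure_tens_closed[OF base_cring]])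
    fix y i a b assume y: "y \<in> tup (om_dom f)" and i: "i \<in> {1..om_dom f}"
      and ab: "a \<in> carrier I" "b \<in> carrier I"
    obtain c where c: "c \<in> carrier A"
      "\<And>u. u \<in> carrier I \<Longrightarrow> om_push A f (y(i := u)) = (om_push A f y)(om_fun f i := u \<otimes>\<^bsub>A\<^esub> c)"
      using om_push_upd[OF f y i] by blast
    have s: "a \<oplus>\<^bsub>I\<^esub> b \<in> carrier I" using ab by (simp add: carrier_I eps_add)
    have "(a \<oplus>\<^bsub>I\<^esub> b) \<otimes>\<^bsub>A\<^esub> c = a \<otimes>\<^bsub>A\<^esub> c \<oplus>\<^bsub>I\<^esub> b \<otimes>\<^bsub>A\<^esub> c"
      using ab c(1) I_into_A by (simp add: l_distr)
    then show "pure (om_cod f) (om_push A f (y(i := a \<oplus>\<^bsub>I\<^esub> b))) =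
        pure (om_cod f) (om_push A f (y(i := a))) \<oplus>\<^bsub>IP (om_cod f)\<^esub>
        pure (om_cod f) (om_push A f (y(i := b)))"
      using P(1)[OF om_push_closed[OF f y] om_fun_closed[OF f i] I_mult[OF ab(1) c(1)] I_mult[OF ab(2) c(1)]]
      by (simp only: c(2)[OF s] c(2)[OF ab(1)] c(2)[OF ab(2)])
  next
    fix y i r a assume y: "y \<in> tup (om_dom f)" and i: "i \<in> {1..om_dom f}"
      and r: "r \<in> carrier k" and a: "a \<in> carrier I"
    obtain c where c: "c \<in> carrier A"
      "\<And>u. u \<in> carrier I \<Longrightarrow> om_push A f (y(i := u)) = (om_push A f y)(om_fun f i := u \<otimes>\<^bsub>A\<^esub> c)"
      using om_push_upd[OF f y i] by blast
    have s: "r \<odot>\<^bsub>I\<^esub> a \<in> carrier I" using a r by (simp add: carrier_I aug_smult)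
    have "(r \<odot>\<^bsub>I\<^esub> a) \<otimes>\<^bsub>A\<^esub> c = r \<odot>\<^bsub>I\<^esub> (a \<otimes>\<^bsub>A\<^esub> c)"
      using a r c(1) I_into_A by (simp add: smult_assoc2)
    then show "pure (om_cod f) (om_push A f (y(i := r \<odot>\<^bsub>I\<^esub> a))) =
        r \<odot>\<^bsub>IP (om_cod f)\<^esub> pure (om_cod f) (om_push A f (y(i := a)))"
      using P(2)[OF om_push_closed[OF f y] om_fun_closed[OF f i] r I_mult[OF a c(1)]]
      by (simp only: c(2)[OF s] c(2)[OF a])
  qed
  from lin_ext_works[OF T T generates_tpow[OF base_cring] this]
  show "push f \<in> mod_hom k (IP (om_dom f)) (IP (om_cod f))"
    and "\<And>y. y \<in> tup (om_dom f) \<Longrightarrow>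
      push f (pure (om_dom f) y) = pure (om_cod f) (om_push A f y)"
    by (simp_all add: push_def)
qed

lemma om_push_comp:
  assumes f: "f \<in> Mor Omega" and g: "g \<in> Mor Omega" and fg: "om_dom g = om_cod f"
    and y: "y \<in> tup (om_dom f)"
  shows "om_push A (Comp Omega g f) y = om_push A g (om_push A f y)"
proof -
  have yA: "y j \<in> carrier A" if "j \<in> {1..om_dom f}" for j using tuples_I[OF y that] I_into_A by blast
  let ?fib = "\<lambda>j. {i\<in>{1..om_dom f}. om_fun f i = j}"
  have "(\<Otimes>\<^bsub>A\<^esub>i\<in>{i\<in>{1..om_dom f}. om_fun g (om_fun f i) = l}. y i) =
    (\<Otimes>\<^bsub>A\<^esub>j\<in>{j\<in>{1..om_cod f}. om_fun g j = l}. \<Otimes>\<^bsub>A\<^esub>i\<in>?fib j. y i)" for l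
  proof -
    let ?J = "{j\<in>{1..om_cod f}. om_fun g j = l}"
    have "{i\<in>{1..om_dom f}. om_fun g (om_fun f i) = l} = (\<Union>j\<in>?J. ?fib j)"
      using om_fun_closed[OF f] by blast
    moreover have "(\<Otimes>\<^bsub>A\<^esub>i\<in>(\<Union>j\<in>?J. ?fib j). y i) = (\<Otimes>\<^bsub>A\<^esub>j\<in>?J. \<Otimes>\<^bsub>A\<^esub>i\<in>?fib j. y i)"
      by (rule finprod_UN_disjoint) (use yA in \<open>auto simp: pairwise_def disjnt_def\<close>)
    ultimately show ?thesis by simp
  qed
  moreover have "(\<Otimes>\<^bsub>A\<^esub>j\<in>{j\<in>{1..om_cod f}. om_fun g j = l}. om_push A f y j) =
    (\<Otimes>\<^bsub>A\<^esub>j\<in>{j\<in>{1..om_cod f}. om_fun g j = l}. \<Otimes>\<^bsub>A\<^esub>i\<in>?fib j. y i)" for l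
    by (rule finprod_cong') (use yA in \<open>auto simp: om_push_def intro!: finprod_closed\<close>)
  moreover have "{i\<in>{1..om_dom f}. (\<lambda>i\<in>{1..om_dom f}. om_fun g (om_fun f i)) i = l} =
    {i\<in>{1..om_dom f}. om_fun g (om_fun f i) = l}" for l by auto
  ultimately show ?thesis unfolding om_push_def[of A "Comp Omega g f"] om_push_def[of A g] fg
    by (simp add: Omega_def)
qed

lemma push_comp:
  assumes f: "f \<in> Mor Omega" and g: "g \<in> Mor Omega" and fg: "om_dom g = om_cod f"
    and gf: "Comp Omega g f \<in> Mor Omega" and t: "t \<in> carrier (IP (om_dom f))"
  shows "push (Comp Omega g f) t = push g (push f t)"
proof -
  note T = module_tpow[OF base_cring]
  have d: "om_dom (Comp Omega g f) = om_dom f" "om_cod (Comp Omega g f) = om_cod g"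
    by (simp_all add: Omega_def)
  have h1: "push (Comp Omega g f) \<in> mod_hom k (IP (om_dom f)) (IP (om_cod g))"
    using push_hom[OF gf] by (simp only: d)
  have h2: "(\<lambda>t. push g (push f t)) \<in> mod_hom k (IP (om_dom f)) (IP (om_cod g))"
    using mod_hom_comp[OF push_hom[OF g, unfolded fg] push_hom[OF f]] .
  show ?thesis
  proof (rule mod_hom_eq_on_generators[OF T T h1 h2 generates_tpow[OF base_cring] _ t])
    fix e assume "e \<in> pure (om_dom f) ` tup (om_dom f)"
    then obtain y where y: "y \<in> tup (om_dom f)" "e = pure (om_dom f) y" by auto
    show "push (Comp Omega g f) e = push g (push f e)"
      using push_pure[OF gf, unfolded d, OF y(1)] push_pure[OF f y(1)]
        push_pure[OF g, unfolded fg, OF om_push_closed[OF f y(1)]] om_push_comp[OF f g fg y(1)] y(2)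
      by simp
  qed
qed

text \<open>Since \<open>A\<close> is commutative, the action of a morphism on tensor powers only depends on the underlying
  surjection.\<close>

lemma Bsym_eq_push:
  assumes "F \<in> Mor EpiDeltaS" shows "Bsym k A \<epsilon> F = push (forget_U F)"
proof -
  obtain n m \<phi> g where F: "F = DS n m \<phi> g" "is_ds n m \<phi> g" using assms by (rule EpiDeltaS_cases)
  have g: "g permutes {1..n}" using F by (simp add: is_ds_def)
  have eq: "(\<lambda>j\<in>{1..m}. \<Otimes>\<^bsub>A\<^esub>i\<in>{i\<in>{1..n}. \<phi> i = j}. a (inv_into UNIV g i)) = om_push A (forget_U F) a"
    if a: "a \<in> tup n" for a
  proof -
    have "(\<Otimes>\<^bsub>A\<^esub>i\<in>{i\<in>{1..n}. \<phi> i = j}. a (inv_into UNIV g i)) = (\<Otimes>\<^bsub>A\<^esub>i\<in>{i\<in>{1..n}. \<phi> (g i) = j}. a i)" for j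
    proof -
      have im: "{i\<in>{1..n}. \<phi> i = j} = g ` {i\<in>{1..n}. \<phi> (g i) = j}"
      proof (rule equalityI; rule subsetI)
        fix i assume i: "i \<in> {i\<in>{1..n}. \<phi> i = j}"
        then obtain b where "b \<in> {1..n}" "i = g b" using permutes_image[OF g] by (metis (no_types, lifting) imageE mem_Collect_eq)
        then show "i \<in> g ` {i\<in>{1..n}. \<phi> (g i) = j}" using i by blast
      next
        fix i assume "i \<in> g ` {i\<in>{1..n}. \<phi> (g i) = j}"
        then show "i \<in> {i\<in>{1..n}. \<phi> i = j}" using permutes_in_image[OF g] by blast
      qed
      have "(\<Otimes>\<^bsub>A\<^esub>i\<in>g ` {i\<in>{1..n}. \<phi> (g i) = j}. a (inv_into UNIV g i)) =
          (\<Otimes>\<^bsub>A\<^esub>i\<in>{i\<in>{1..n}. \<phi> (g i) = j}. a (inv_into UNIV g (g i)))"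
        using tuples_I[OF a] I_into_A permutes_inverses(2)[OF g] permutes_inj_on[OF g]
        by (intro finprod_reindex) auto
      then show ?thesis by (simp only: im permutes_inverses(2)[OF g])
    qed
    moreover have "{i\<in>{1..n}. (\<lambda>i\<in>{1..n}. \<phi> (g i)) i = j} = {i\<in>{1..n}. \<phi> (g i) = j}" for j by auto
    ultimately show ?thesis by (simp add: om_push_def forget_U_def F(1))
  qed
  have "Bsym k A \<epsilon> F = lin_ext k (IP n) (IP m) (tup n) (pure n)
      (\<lambda>a. pure m (\<lambda>j\<in>{1..m}. \<Otimes>\<^bsub>A\<^esub>i\<in>{i\<in>{1..n}. \<phi> i = j}. a (inv_into UNIV g i)))"
    by (simp only: Bsym_def Let_def F(1) ds_mor.sel)
  also have "\<dots> = lin_ext k (IP n) (IP m) (tup n) (pure n)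
      (\<lambda>a. pure m (om_push A (forget_U F) a))"
    by (rule lin_ext_cong) (simp only: eq)
  also have "\<dots> = push (forget_U F)"
    by (simp only: push_def forget_U_simps F(1) ds_mor.sel)
  finally show ?thesis .
qed

end

sublocale augmented_algebra \<subseteq> CS: category_functor EpiDeltaS k "Ipow k A \<epsilon>" "Bsym k A \<epsilon>"
proof (intro category_functor.intro[OF EpiDeltaS_category] category_functor_axioms.intro)
  show "cring k" by (rule base_cring)
  show "module k (Ipow k A \<epsilon> x)" for x by (rule module_tpow[OF base_cring])
  fix F assume F: "F \<in> Mor EpiDeltaS"
  show "Bsym k A \<epsilon> F \<in> mod_hom k (Ipow k A \<epsilon> (Dom EpiDeltaS F)) (Ipow k A \<epsilon> (Cod EpiDeltaS F))"
    using push_hom[OF forget_U_Mor[OF F]] by (simp add: Bsym_eq_push[OF F])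
  fix G y assume G: "G \<in> Mor EpiDeltaS" "Dom EpiDeltaS G = Cod EpiDeltaS F"
    and y: "y \<in> carrier (Ipow k A \<epsilon> (Dom EpiDeltaS F))"
  have GF: "Comp EpiDeltaS G F \<in> Mor EpiDeltaS"
    using category_cat.comp[OF EpiDeltaS_category F G] by simp
  have "forget_U (Comp EpiDeltaS G F) = Comp Omega (forget_U G) (forget_U F)"
    using forget_U_comp[OF F G(1)] G(2) by simp
  then show "Bsym k A \<epsilon> (Comp EpiDeltaS G F) y = Bsym k A \<epsilon> G (Bsym k A \<epsilon> F y)"
    using push_comp[OF forget_U_Mor[OF F] forget_U_Mor[OF G(1)]] forget_U_Mor[OF GF] G(2) y
    by (simp add: Bsym_eq_push F G GF del: EpiDeltaS_simps(4))
qed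


section \<open>Components of strings of surjections\<close>

lemma om_fibre_subset: "is_path Omega x gs z \<Longrightarrow> i \<in> {1..z} \<Longrightarrow> om_fibre gs i \<subseteq> {1..x}"
  by (cases gs) auto

lemma om_fibre_nonempty: "is_path Omega x gs z \<Longrightarrow> i \<in> {1..z} \<Longrightarrow> om_fibre gs i \<noteq> {}"
proof (induction gs arbitrary: x)
  case (Cons g gs)
  then have g: "g \<in> Mor Omega" and p: "is_path Omega (om_cod g) gs z" by auto
  obtain j where j: "j \<in> om_fibre gs i" using Cons.IH[OF p Cons.prems(2)] by auto
  then have "j \<in> {1..om_cod g}" using om_fibre_subset[OF p Cons.prems(2)] by auto
  from om_fun_surj[OF g this] show ?case using j by auto
qed simp

lemma om_fibre_disjoint: "a \<in> om_fibre gs i \<Longrightarrow> a \<in> om_fibre gs j \<Longrightarrow> i = j"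
  by (induction gs arbitrary: a) auto

lemma om_fibre_1: "is_path Omega x gs 1 \<Longrightarrow> om_fibre gs 1 = {1..x}"
proof (induction gs arbitrary: x)
  case (Cons g gs)
  then have "g \<in> Mor Omega" "om_fibre gs 1 = {1..om_cod g}" "om_dom g = x" by auto
  then show ?case using om_fun_closed[of g] by auto
qed simp

lemma set_enum_interval: "a \<in> {1..n} \<Longrightarrow> set_enum {1..n} a = a"
proof -
  assume a: "a \<in> {1..n}"
  have "sorted_list_of_set {1..n} = [1..<Suc n]"
    by (metis atLeastLessThanSuc_atLeastAtMost sorted_list_of_set_range)
  then show ?thesis using a by (auto simp: set_enum_def simp del: upt_Suc)
qed

lemma set_rank_interval: "s \<in> {1..n} \<Longrightarrow> set_rank {1..n} s = s"
proof -
  assume "s \<in> {1..n}"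
  then have "{t \<in> {1..n}. t \<le> s} = {1..s}" by auto
  then show ?thesis by (simp add: set_rank_def)
qed

text \<open>A string that ends in \<open>1\<close> has a single component, which is the string itself: the re-indexing is trivial.\<close>

lemma om_component_1: "is_path Omega x gs 1 \<Longrightarrow> om_component gs 1 = gs"
proof (induction gs arbitrary: x)
  case (Cons g gs)
  then have g: "g \<in> Mor Omega" and p: "is_path Omega (om_cod g) gs 1" and x: "om_dom g = x" by auto
  have fib: "om_fibre gs 1 = {1..om_cod g}" "om_fibre (g # gs) 1 = {1..om_dom g}"
    using om_fibre_1[OF p] om_fibre_1[OF Cons.prems] x by auto
  obtain n m f where f: "g = Om n m f" by (cases g)
  then have fm: "f \<in> {1..n} \<rightarrow>\<^sub>E {1..m}" using g by (simp add: Mor_Omega)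
  have "(\<lambda>a\<in>{1..n}. set_rank {1..m} (f (set_enum {1..n} a))) = f"
  proof (rule extensionalityI[of _ "{1..n}"])
    fix a assume a: "a \<in> {1..n}"
    then have "f a \<in> {1..m}" using fm by blast
    then show "(\<lambda>a\<in>{1..n}. set_rank {1..m} (f (set_enum {1..n} a))) a = f a"
      using a by (simp only: restrict_apply if_True set_enum_interval set_rank_interval)
  qed (use fm in \<open>auto simp: PiE_def\<close>)
  then have "om_restrict g {1..om_dom g} {1..om_cod g} = g"
    by (simp add: om_restrict_def f)
  then show ?case using Cons.IH[OF p] by (simp only: om_component.simps fib)
qed simp

section \<open>The chains of \<open>C\<Gamma>\<close>\<close>

context augmented_algebra begin

abbreviation "CG_pre n x \<equiv> tens_mod k (free_mod k (NOmega n x)) (IP x)"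
abbreviation "pre_tens n x \<equiv> tens k (free_mod k (NOmega n x)) (IP x)"

text \<open>The generator \<open>[f\<^sub>n | \<dots> | f\<^sub>1] \<otimes> t \<otimes> \<one>\<close> for an arbitrary \<open>t\<close> in the tensor power. The factor \<open>k\<close> of the tensor product
  only contributes scalars, so the maps on \<open>C\<Gamma>\<close> can be described as linear maps in \<open>t\<close>.\<close>

definition CG_elt where
  "CG_elt n x fs t = dincl {1..} (CG_summand k A \<epsilon> n) x
     (tens k (CG_pre n x) (reg_mod k)
       (pre_tens n x (basis_elt k (NOmega n x) fs) t) \<one>\<^bsub>k\<^esub>)"

abbreviation "CGm \<equiv> CG_mod k A \<epsilon>"

lemma module_Ipow: "module k (IP x)"
  by (rule module_tpow[OF base_cring])

lemma module_pre_summand: "module k (CG_pre n x)"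
  by (rule module_tens_mod[OF module_free_mod[OF base_cring] module_Ipow])

lemma module_summand: "module k (CG_summand k A \<epsilon> n x)"
  unfolding CG_summand_def by (rule module_tens_mod[OF module_pre_summand module_reg_mod[OF base_cring]])

lemma module_CG: "module k (CGm n)"
  unfolding CG_mod_def by (rule module_dsum[OF base_cring module_summand])

lemma one_closed_k: "\<one>\<^bsub>k\<^esub> \<in> carrier (reg_mod k)"
  using cring.cring_simprules(6)[OF base_cring] by simp

lemma pre_elt_hom: "pre_tens n x (basis_elt k (NOmega n x) fs)
    \<in> mod_hom k (IP x) (CG_pre n x)"
  by (rule tens_hom_right[OF module_free_mod[OF base_cring] module_Ipow basis_elt_closed[OF base_cring]])

lemma summand_elt_hom: "(\<lambda>t. tens k (CG_pre n x) (reg_mod k)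
       (pre_tens n x (basis_elt k (NOmega n x) fs) t) \<one>\<^bsub>k\<^esub>)
    \<in> mod_hom k (IP x) (CG_summand k A \<epsilon> n x)"
  unfolding CG_summand_def
  by (rule mod_hom_comp[OF tens_hom_left[OF module_pre_summand module_reg_mod[OF base_cring] one_closed_k] pre_elt_hom])

lemma CG_elt_hom: "x \<ge> 1 \<Longrightarrow> CG_elt n x fs \<in> mod_hom k (IP x) (CGm n)"
  unfolding CG_elt_def[abs_def] CG_mod_def
  by (rule mod_hom_comp[OF dincl_hom[where M = "CG_summand k A \<epsilon> n", OF module_summand] summand_elt_hom]) simp

lemma CG_gen_eq:
  assumes "x \<ge> 1" "l \<in> carrier k"
  shows "CG_gen k A \<epsilon> n x fs y l = l \<odot>\<^bsub>CGm n\<^esub> CG_elt n x fs (pure x y)"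
proof -
  interpret K: cring k by (rule base_cring)
  let ?t = "pre_tens n x (basis_elt k (NOmega n x) fs) (pure x y)"
  have t: "?t \<in> carrier (CG_pre n x)" by (rule mod_hom_closed[OF pre_elt_hom pure_tens_closed[OF base_cring]])
  note h = tens_hom_right[OF module_pre_summand module_reg_mod[OF base_cring] t]
  have "tens k (CG_pre n x) (reg_mod k) ?t (l \<odot>\<^bsub>reg_mod k\<^esub> \<one>\<^bsub>k\<^esub>) =
      l \<odot>\<^bsub>CG_summand k A \<epsilon> n x\<^esub> tens k (CG_pre n x) (reg_mod k) ?t \<one>\<^bsub>k\<^esub>"
    unfolding CG_summand_def by (rule mod_hom_smult[OF h assms(2) one_closed_k])
  then have "tens k (CG_pre n x) (reg_mod k) ?t l = l \<odot>\<^bsub>CG_summand k A \<epsilon> n x\<^esub> tens k (CG_pre n x) (reg_mod k) ?t \<one>\<^bsub>k\<^esub>"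
    using assms(2) by simp
  moreover have "tens k (CG_pre n x) (reg_mod k) ?t \<one>\<^bsub>k\<^esub> \<in> carrier (CG_summand k A \<epsilon> n x)"
    unfolding CG_summand_def by (rule mod_hom_closed[OF h one_closed_k])
  moreover have "dincl {1..} (CG_summand k A \<epsilon> n) x \<in> mod_hom k (CG_summand k A \<epsilon> n x) (CGm n)"
    unfolding CG_mod_def using assms(1) by (intro dincl_hom module_summand) simp
  ultimately show ?thesis using assms(2)
    by (simp add: CG_gen_def CG_elt_def mod_hom_smult)
qed

lemma CG_gen_one: "x \<ge> 1 \<Longrightarrow> CG_gen k A \<epsilon> n x fs y \<one>\<^bsub>k\<^esub> = CG_elt n x fs (pure x y)"
  by (simp add: CG_gen_def CG_elt_def)

lemma CG_gen_zero: "CG_gen k A \<epsilon> n x fs y \<zero>\<^bsub>k\<^esub> = \<zero>\<^bsub>CGm n\<^esub>"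
proof -
  let ?t = "pre_tens n x (basis_elt k (NOmega n x) fs) (pure x y)"
  have t: "?t \<in> carrier (CG_pre n x)" by (rule mod_hom_closed[OF pre_elt_hom pure_tens_closed[OF base_cring]])
  have "tens k (CG_pre n x) (reg_mod k) ?t \<zero>\<^bsub>reg_mod k\<^esub> = \<zero>\<^bsub>CG_summand k A \<epsilon> n x\<^esub>"
    unfolding CG_summand_def
    by (rule mod_hom_zero[OF module_reg_mod[OF base_cring] _
          tens_hom_right[OF module_pre_summand module_reg_mod[OF base_cring] t]])
      (rule module_summand[unfolded CG_summand_def])
  then show ?thesis by (simp add: CG_gen_def dincl_zero CG_mod_def)
qed

lemma generates_summand:
  "generates k (CG_summand k A \<epsilon> n x)
    {tens k (CG_pre n x) (reg_mod k) u r |u r.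
      u \<in> {pre_tens n x b t |b t.
        b \<in> basis_elt k (NOmega n x) ` NOmega n x \<and> t \<in> pure x ` tup x} \<and> r \<in> {\<one>\<^bsub>k\<^esub>}}"
  unfolding CG_summand_def
  by (intro generates_tens_mod module_pre_summand module_reg_mod base_cring module_free_mod module_Ipow
      generates_free_mod generates_tpow generates_reg_mod)

lemma generates_CG_elt:
  "generates k (CGm n) {CG_elt n x fs (pure x y) |x fs y. x \<ge> 1 \<and> fs \<in> NOmega n x \<and> y \<in> tup x}"
  unfolding CG_mod_def
proof (rule generates_if_contains[OF generates_dsum[OF base_cring module_summand generates_summand]])
  show "{CG_elt n x fs (pure x y) |x fs y. x \<ge> 1 \<and> fs \<in> NOmega n x \<and> y \<in> tup x}
      \<subseteq> carrier (dsum {1..} (CG_summand k A \<epsilon> n))"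
    using mod_hom_closed[OF CG_elt_hom pure_tens_closed[OF base_cring]] by (auto simp: CG_mod_def)
qed (auto simp: CG_elt_def)

lemma generates_CG_gen:
  "generates k (CGm n) ((\<lambda>(x, fs, y, l). CG_gen k A \<epsilon> n x fs y l) ` CG_index k A \<epsilon> n)"
proof (rule generates_if_contains[OF generates_CG_elt])
  interpret K: cring k by (rule base_cring)
  show "(\<lambda>(x, fs, y, l). CG_gen k A \<epsilon> n x fs y l) ` CG_index k A \<epsilon> n \<subseteq> carrier (CGm n)"
    using mod_hom_closed[OF CG_elt_hom pure_tens_closed[OF base_cring]] module.smult_closed[OF module_CG]
    by (auto simp: CG_index_def CG_gen_eq)
  fix H assume H: "(\<lambda>(x, fs, y, l). CG_gen k A \<epsilon> n x fs y l) ` CG_index k A \<epsilon> n \<subseteq> H"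
  have "CG_elt n x fs (pure x y) \<in> H" if "x \<ge> 1" "fs \<in> NOmega n x" "y \<in> tup x" for x fs y
  proof -
    have "(x, fs, y, \<one>\<^bsub>k\<^esub>) \<in> CG_index k A \<epsilon> n" using that by (simp add: CG_index_def)
    then have "CG_gen k A \<epsilon> n x fs y \<one>\<^bsub>k\<^esub> \<in> H" using H by (auto simp: image_subset_iff)
    then show ?thesis using that(1) by (simp add: CG_gen_one)
  qed
  then show "{CG_elt n x fs (pure x y) |x fs y. x \<ge> 1 \<and> fs \<in> NOmega n x \<and> y \<in> tup x} \<subseteq> H"
    by blast
qed

text \<open>A linear map out of the chains is a family of linear maps on tensor powers, one for each string. The
  family is extended linearly in the string first, then the factor \<open>k\<close> acts by multiples.\<close>

lemma CG_lift:
  assumes N: "module k N"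
    and w: "\<And>x fs. x \<ge> 1 \<Longrightarrow> fs \<in> NOmega n x \<Longrightarrow> w x fs \<in> mod_hom k (IP x) N"
  shows "\<exists>h \<in> mod_hom k (CGm n) N.
    \<forall>x\<ge>1. \<forall>fs\<in>NOmega n x. \<forall>t\<in>carrier (IP x). h (CG_elt n x fs t) = w x fs t"
proof -
  interpret K: cring k by (rule base_cring)
  interpret N: module k N by (rule N)
  note F = module_free_mod[OF base_cring]
  have "\<exists>h \<in> mod_hom k (CG_summand k A \<epsilon> n x) N. \<forall>fs\<in>NOmega n x. \<forall>t\<in>carrier (IP x).
    h (tens k (CG_pre n x) (reg_mod k)
       (pre_tens n x (basis_elt k (NOmega n x) fs) t) \<one>\<^bsub>k\<^esub>) = w x fs t"
    if x: "x \<ge> 1" for x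
  proof -
    let ?Z = "NOmega n x" and ?T = "IP x"
    let ?F = "free_mod k ?Z"
    have "\<exists>g \<in> mod_hom k ?F N. \<forall>fs\<in>?Z. g (basis_elt k ?Z fs) = w x fs t" if "t \<in> carrier ?T" for t
      using mod_hom_closed[OF w[OF x] that] by (intro free_mod_lift[OF N]) auto
    then obtain g where g: "\<And>t. t \<in> carrier ?T \<Longrightarrow> g t \<in> mod_hom k ?F N"
      "\<And>t fs. t \<in> carrier ?T \<Longrightarrow> fs \<in> ?Z \<Longrightarrow> g t (basis_elt k ?Z fs) = w x fs t"
      by metis
    \<comment> \<open>linearity of \<open>g\<close> in \<open>t\<close> is checked on the basis\<close>
    have gr: "(\<lambda>t. g t c) \<in> mod_hom k ?T N" if c: "c \<in> carrier ?F" for c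
    proof (rule mod_homI)
      interpret T: module k ?T by (rule module_Ipow)
      show "g t c \<in> carrier N" if "t \<in> carrier ?T" for t using mod_hom_closed[OF g(1)[OF that] c] .
      show "g (t \<oplus>\<^bsub>?T\<^esub> t') c = g t c \<oplus>\<^bsub>N\<^esub> g t' c" if t: "t \<in> carrier ?T" "t' \<in> carrier ?T" for t t'
        by (rule mod_hom_eq_on_generators[OF F N g(1) mod_hom_add_maps[OF N g(1) g(1)]
              generates_free_mod[OF base_cring] _ c]) (use t w[OF x] in \<open>auto simp: g(2) mod_hom_add[OF w[OF x]] simp del: One_nat_def\<close>)
      show "g (r \<odot>\<^bsub>?T\<^esub> t) c = r \<odot>\<^bsub>N\<^esub> g t c" if t: "r \<in> carrier k" "t \<in> carrier ?T" for r t
        by (rule mod_hom_eq_on_generators[OF F N g(1) mod_hom_smult_map[OF N t(1) g(1)]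
              generates_free_mod[OF base_cring] _ c]) (use t w[OF x] in \<open>auto simp: g(2) mod_hom_smult[OF w[OF x]] simp del: One_nat_def\<close>)
    qed
    obtain h1 where h1: "h1 \<in> mod_hom k (tens_mod k ?F ?T) N"
      "\<And>c t. c \<in> carrier ?F \<Longrightarrow> t \<in> carrier ?T \<Longrightarrow> h1 (tens k ?F ?T c t) = g t c"
      using tens_lift[where v = "\<lambda>c t. g t c", OF F module_Ipow N g(1) gr] by blast
    have sm: "(\<lambda>u. r \<odot>\<^bsub>N\<^esub> h1 u) \<in> mod_hom k (tens_mod k ?F ?T) N" if "r \<in> carrier (reg_mod k)" for r
      using that by (intro mod_hom_smult_map[OF N _ h1(1)]) simp
    obtain h where h: "h \<in> mod_hom k (CG_summand k A \<epsilon> n x) N"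
      "\<And>u r. u \<in> carrier (tens_mod k ?F ?T) \<Longrightarrow> r \<in> carrier k \<Longrightarrow>
        h (tens k (tens_mod k ?F ?T) (reg_mod k) u r) = r \<odot>\<^bsub>N\<^esub> h1 u"
      using tens_lift[where v = "\<lambda>u r. r \<odot>\<^bsub>N\<^esub> h1 u", OF module_pre_summand module_reg_mod[OF base_cring] N sm
          reg_mod_lift[OF N mod_hom_closed[OF h1(1)]]]
      unfolding CG_summand_def by auto
    show ?thesis
    proof (intro bexI[OF _ h(1)] ballI)
      fix fs t assume fs: "fs \<in> ?Z" and t: "t \<in> carrier ?T"
      have "h1 (tens k ?F ?T (basis_elt k ?Z fs) t) = w x fs t"
        using h1(2)[OF basis_elt_closed[OF base_cring] t] g(2)[OF t fs] by simp
      then show "h (tens k (tens_mod k ?F ?T) (reg_mod k) (tens k ?F ?T (basis_elt k ?Z fs) t) \<one>\<^bsub>k\<^esub>) = w x fs t"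
        using h(2)[OF mod_hom_closed[OF pre_elt_hom t], of "\<one>\<^bsub>k\<^esub>"] mod_hom_closed[OF w[OF x fs] t] by simp
    qed
  qed
  then obtain h where h: "\<And>x. x \<ge> 1 \<Longrightarrow> h x \<in> mod_hom k (CG_summand k A \<epsilon> n x) N"
    "\<And>x fs t. x \<ge> 1 \<Longrightarrow> fs \<in> NOmega n x \<Longrightarrow> t \<in> carrier (IP x) \<Longrightarrow>
      h x (tens k (CG_pre n x) (reg_mod k)
       (pre_tens n x (basis_elt k (NOmega n x) fs) t) \<one>\<^bsub>k\<^esub>) = w x fs t"
    by metis
  obtain H where H: "H \<in> mod_hom k (CGm n) N"
    "\<And>x m. x \<ge> 1 \<Longrightarrow> m \<in> carrier (CG_summand k A \<epsilon> n x) \<Longrightarrow>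
      H (dincl {1..} (CG_summand k A \<epsilon> n) x m) = h x m"
    using dsum_lift[where Z = "{1..}" and M = "CG_summand k A \<epsilon> n" and h = h, OF base_cring module_summand N] h(1)
    unfolding CG_mod_def by auto
  have "H (CG_elt n x fs t) = w x fs t"
    if "x \<ge> 1" "fs \<in> NOmega n x" "t \<in> carrier (IP x)" for x fs t
    unfolding CG_elt_def using H(2)[OF that(1) mod_hom_closed[OF summand_elt_hom that(3)]] h(2)[OF that] by simp
  then show ?thesis using H(1) by blast
qed

text \<open>All faces and degeneracies of \<open>C\<Gamma>\<close> are extensions of this form.\<close>

lemma CG_lin_ext:
  assumes N: "module k N"
    and w: "\<And>x fs. x \<ge> 1 \<Longrightarrow> fs \<in> NOmega n x \<Longrightarrow> w x fs \<in> mod_hom k (IP x) N"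
    and v: "\<And>x fs y l. x \<ge> 1 \<Longrightarrow> fs \<in> NOmega n x \<Longrightarrow> y \<in> tup x \<Longrightarrow> l \<in> carrier k \<Longrightarrow>
      v (x, fs, y, l) = l \<odot>\<^bsub>N\<^esub> w x fs (pure x y)"
  defines "L \<equiv> lin_ext k (CGm n) N (CG_index k A \<epsilon> n) (\<lambda>(x, fs, y, l). CG_gen k A \<epsilon> n x fs y l) v"
  shows "L \<in> mod_hom k (CGm n) N"
    and "\<And>x fs t. x \<ge> 1 \<Longrightarrow> fs \<in> NOmega n x \<Longrightarrow> t \<in> carrier (IP x) \<Longrightarrow>
      L (CG_elt n x fs t) = w x fs t"
proof -
  obtain h where h: "h \<in> mod_hom k (CGm n) N" "\<And>x fs t. x \<ge> 1 \<Longrightarrow> fs \<in> NOmega n x \<Longrightarrow>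
      t \<in> carrier (IP x) \<Longrightarrow> h (CG_elt n x fs t) = w x fs t"
    using CG_lift[where w = w and n = n, OF N w] by blast
  note p = pure_tens_closed[OF base_cring, of "aug_ideal k A \<epsilon>"]
  have hv: "h ((\<lambda>(x, fs, y, l). CG_gen k A \<epsilon> n x fs y l) j) = v j" if "j \<in> CG_index k A \<epsilon> n" for j
    using that mod_hom_smult[OF h(1) _ mod_hom_closed[OF CG_elt_hom p]]
    by (auto simp: CG_index_def CG_gen_eq v h(2) p)
  have L: "L = restrict h (carrier (CGm n))"
    unfolding L_def by (rule lin_ext_eq[OF module_CG N generates_CG_gen h(1)]) (rule hv)
  show "L \<in> mod_hom k (CGm n) N" unfolding L by (rule mod_hom_restrict[OF module_CG h(1)])
  show "L (CG_elt n x fs t) = w x fs t"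
    if "x \<ge> 1" "fs \<in> NOmega n x" "t \<in> carrier (IP x)" for x fs t
    using h(2)[OF that] mod_hom_closed[OF CG_elt_hom[OF that(1)] that(3)] by (simp add: L)
qed

text \<open>A second fibre is nonempty, so its entries put a factor from \<open>I\<close> into the weight of the first one, and the
  augmentation kills it. What remains is the case of a single fibre, where the weight is \<open>\<epsilon> \<one> = \<one>\<close>.\<close>

lemma CG_last_face_eq:
  assumes fs: "fs \<in> NOmega (Suc n) x" and y: "y \<in> tup x" and l: "l \<in> carrier k"
  shows "CG_last_face k A \<epsilon> (Suc n) x fs y l =
    (if om_dom (last fs) = 1 then CG_gen k A \<epsilon> n x (butlast fs) y l else \<zero>\<^bsub>CGm n\<^esub>)"
proof -
  interpret K: cring k by (rule base_cring)
  interpret M: module k "CGm n" by (rule module_CG)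
  have "fs \<noteq> []" using fs by (auto simp: mem_paths)
  then have b: "is_path Omega x (butlast fs) (om_dom (last fs))" "last fs \<in> Mor Omega"
    using is_path_butlast[of Omega x fs 1] fs by (auto simp: mem_paths)
  define f where "f i = (let S = om_fibre (butlast fs) i in
        CG_gen k A \<epsilon> n (card S) (om_component (butlast fs) i)
          (\<lambda>a\<in>{1..card S}. y (set_enum S a)) (\<epsilon> (\<Otimes>\<^bsub>A\<^esub>j\<in>{1..x} - S. y j) \<otimes>\<^bsub>k\<^esub> l))" for i
  have sum: "CG_last_face k A \<epsilon> (Suc n) x fs y l = (\<Oplus>\<^bsub>CGm n\<^esub>i\<in>{1..om_dom (last fs)}. f i)"
    by (simp add: CG_last_face_def f_def)
  show ?thesis
  proof (cases "om_dom (last fs) = 1")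
    case True
    then have p: "is_path Omega x (butlast fs) 1" using b by simp
    have x: "x \<ge> 1" using is_path_source_obj[OF p] by simp
    have "(\<lambda>a\<in>{1..x}. y (set_enum {1..x} a)) = y"
    proof (rule extensionalityI[of _ "{1..x}"])
      fix a assume "a \<in> {1..x}"
      then show "(\<lambda>a\<in>{1..x}. y (set_enum {1..x} a)) a = y a"
        by (simp only: restrict_apply if_True set_enum_interval)
    qed (use y in \<open>auto simp: tuples_def PiE_def\<close>)
    then have f1: "f 1 = CG_gen k A \<epsilon> n x (butlast fs) y l"
      using l unfolding f_def Let_def om_fibre_1[OF p] om_component_1[OF p]
      by (simp add: eps_one)
    then have "f 1 \<in> carrier (CGm n)"
      using mod_hom_closed[OF CG_elt_hom[OF x] pure_tens_closed[OF base_cring]] l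
      by (simp add: CG_gen_eq[OF x l])
    then show ?thesis using True f1 by (simp add: sum)
  next
    case False
    have "f i = \<zero>\<^bsub>CGm n\<^esub>" if i: "i \<in> {1..om_dom (last fs)}" for i
    proof -
      have "\<exists>i'\<in>{1..om_dom (last fs)}. i' \<noteq> i"
        using i False by (intro bexI[of _ "if i = 1 then 2 else 1"]) auto
      then obtain i' where i': "i' \<in> {1..om_dom (last fs)}" "i' \<noteq> i" by blast
      obtain a where a: "a \<in> om_fibre (butlast fs) i'" using om_fibre_nonempty[OF b(1) i'(1)] by auto
      have "a \<in> {1..x}" using om_fibre_subset[OF b(1) i'(1)] a by blast
      moreover have "a \<notin> om_fibre (butlast fs) i" using om_fibre_disjoint[OF a, of i] i'(2) by blast
      ultimately have "{1..x} - om_fibre (butlast fs) i \<noteq> {}" by blast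
      then have "(\<Otimes>\<^bsub>A\<^esub>j\<in>{1..x} - om_fibre (butlast fs) i. y j) \<in> carrier I"
        using tuples_I[OF y] by (intro finprod_in_I) auto
      then show ?thesis using l by (simp add: f_def carrier_I CG_gen_zero)
    qed
    then have "(\<Oplus>\<^bsub>CGm n\<^esub>i\<in>{1..om_dom (last fs)}. f i) = \<zero>\<^bsub>CGm n\<^esub>"
      by (intro M.M.add.finprod_one_eqI) auto
    then show ?thesis using False by (simp add: sum)
  qed
qed

text \<open>The faces of \<open>C\<Gamma>\<close> on the generators with label \<open>t\<close>; the last one is in the simplified form.\<close>

definition CG_face_map where
  "CG_face_map n i x fs t =
     (if i = Suc n then if om_dom (last fs) = 1 then CG_elt n x (butlast fs) t else \<zero>\<^bsub>CGm n\<^esub>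
      else CG_elt n (fst (str_face Omega i (x, fs))) (snd (str_face Omega i (x, fs)))
        (if i = 0 then push (hd fs) t else t))"

lemma CG_face_map_hom:
  assumes "x \<ge> 1" "fs \<in> NOmega (Suc n) x" "i \<le> Suc n"
  shows "CG_face_map n i x fs \<in> mod_hom k (IP x) (CGm n)"
proof -
  obtain g gs where fs: "fs = g # gs" using assms(2) by (cases fs) (auto simp: mem_paths)
  then have g: "g \<in> Mor Omega" "om_dom g = x" "om_cod g \<ge> 1"
    using assms(2) is_path_source_obj[of Omega "om_cod g"] by (auto simp: mem_paths)
  consider "i = Suc n" "om_dom (last fs) = 1" | "i = Suc n" "om_dom (last fs) \<noteq> 1"
    | "i \<noteq> Suc n" "i = 0" | j where "i \<noteq> Suc n" "i = Suc j"
    by (cases i) auto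
  then show ?thesis
  proof cases
    case 1
    then show ?thesis using CG_elt_hom[OF assms(1)] by (simp add: CG_face_map_def[abs_def])
  next
    case 2
    then show ?thesis using mod_hom_zero_map[OF module_CG] by (simp add: CG_face_map_def[abs_def])
  next
    case 3
    then show ?thesis
      using mod_hom_comp[OF CG_elt_hom[OF g(3)] push_hom[OF g(1)]] g(2)
      by (simp add: CG_face_map_def[abs_def] fs str_face_0)
  next
    case 4
    then have "str_face Omega i (x, fs) = (x, merge_at Omega j fs)"
      using assms(2,3) by (simp add: str_face_Suc mem_paths)
    then show ?thesis using 4 CG_elt_hom[OF assms(1)] by (simp add: CG_face_map_def[abs_def])
  qed
qed

abbreviation "CGs \<equiv> CGamma k A \<epsilon>"

lemma CGs_smod [simp]: "smod CGs = CGm"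
  by (simp add: CGamma_def)

lemma str_face_Omega_pos:
  assumes "x \<ge> 1" "fs \<in> NOmega (Suc n) x" "i < Suc n"
  shows "fst (str_face Omega i (x, fs)) \<ge> 1"
proof -
  obtain g gs where fs: "fs = g # gs" using assms(2) by (cases fs) (auto simp: mem_paths)
  then have "om_cod g \<ge> 1"
    using assms(2) is_path_source_obj[of Omega "om_cod g"] by (auto simp: mem_paths)
  then show ?thesis using assms fs by (cases i) (auto simp: str_face_0 str_face_Suc mem_paths)
qed

lemma CG_face_works:
  assumes i: "i \<le> Suc n"
  shows CG_face_hom: "sface CGs (Suc n) i \<in> mod_hom k (CGm (Suc n)) (CGm n)"
    and CG_face_elt: "\<And>x fs t. x \<ge> 1 \<Longrightarrow> fs \<in> NOmega (Suc n) x \<Longrightarrow> t \<in> carrier (IP x) \<Longrightarrow>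
      sface CGs (Suc n) i (CG_elt (Suc n) x fs t) = CG_face_map n i x fs t"
proof -
  let ?v = "\<lambda>(x, fs, y, l).
           if i = Suc n then CG_last_face k A \<epsilon> (Suc n) x fs y l
           else case str_face Omega i (x, fs) of (x', fs') \<Rightarrow>
             CG_gen k A \<epsilon> n x' fs' (if i = 0 then om_push A (hd fs) y else y) l"
  have face: "sface CGs (Suc n) i = lin_ext k (CGm (Suc n)) (CGm n) (CG_index k A \<epsilon> (Suc n))
      (\<lambda>(x, fs, y, l). CG_gen k A \<epsilon> (Suc n) x fs y l) ?v"
    unfolding CGamma_def simp_mod.simps diff_Suc_1 by (rule refl)
  have v: "?v (x, fs, y, l) = l \<odot>\<^bsub>CGm n\<^esub> CG_face_map n i x fs (pure x y)"
    if x: "x \<ge> 1" and fs: "fs \<in> NOmega (Suc n) x" and y: "y \<in> tup x" and l: "l \<in> carrier k" for x fs y l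
  proof (cases "i = Suc n")
    case True
    then show ?thesis using x l module.smult_r_null[OF module_CG l]
      by (simp add: CG_last_face_eq[OF fs y l] CG_gen_eq CG_face_map_def)
  next
    case False
    obtain x' fs' where s: "str_face Omega i (x, fs) = (x', fs')" by fastforce
    have x': "x' \<ge> 1" using str_face_Omega_pos[OF x fs, of i] s False i by simp
    obtain g gs where gs: "fs = g # gs" using fs by (cases fs) (auto simp: mem_paths)
    then have g: "g \<in> Mor Omega" "om_dom g = x" using fs by (auto simp: mem_paths)
    have "pure x' (if i = 0 then om_push A (hd fs) y else y) =
        (if i = 0 then push (hd fs) (pure x y) else pure x y)"
    proof (cases i)
      case 0
      then show ?thesis using s gs g push_pure[OF g(1)] y by (simp add: str_face_0)
    next
      case (Suc j)
      then show ?thesis using s fs i by (simp add: str_face_Suc mem_paths)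
    qed
    then show ?thesis using False s l x' by (simp add: CG_gen_eq CG_face_map_def)
  qed
  have w: "CG_face_map n i x fs \<in> mod_hom k (IP x) (CGm n)" if "x \<ge> 1" "fs \<in> NOmega (Suc n) x" for x fs
    by (rule CG_face_map_hom[OF that i])
  show "sface CGs (Suc n) i \<in> mod_hom k (CGm (Suc n)) (CGm n)"
    unfolding face by (rule CG_lin_ext(1)[where w = "CG_face_map n i", OF module_CG]) (erule (1) w, erule (3) v)
  show "sface CGs (Suc n) i (CG_elt (Suc n) x fs t) = CG_face_map n i x fs t"
    if "x \<ge> 1" "fs \<in> NOmega (Suc n) x" "t \<in> carrier (IP x)" for x fs t
    unfolding face by (rule CG_lin_ext(2)[OF module_CG _ _ that]) (erule (1) w, erule (3) v)
qed

lemma CG_degen_works: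
  assumes i: "i \<le> n"
  shows CG_degen_hom: "sdegen CGs n i \<in> mod_hom k (CGm n) (CGm (Suc n))"
    and CG_degen_elt: "\<And>x fs t. x \<ge> 1 \<Longrightarrow> fs \<in> NOmega n x \<Longrightarrow> t \<in> carrier (IP x) \<Longrightarrow>
      sdegen CGs n i (CG_elt n x fs t) = CG_elt (Suc n) x (snd (str_degen Omega i (x, fs))) t"
proof -
  let ?v = "\<lambda>(x, fs, y, l). case str_degen Omega i (x, fs) of (x', fs') \<Rightarrow> CG_gen k A \<epsilon> (Suc n) x' fs' y l"
  have degen: "sdegen CGs n i = lin_ext k (CGm n) (CGm (Suc n)) (CG_index k A \<epsilon> n)
      (\<lambda>(x, fs, y, l). CG_gen k A \<epsilon> n x fs y l) ?v"
    unfolding CGamma_def simp_mod.simps Suc_eq_plus1 by (rule refl)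
  have v: "?v (x, fs, y, l) = l \<odot>\<^bsub>CGm (Suc n)\<^esub> CG_elt (Suc n) x (snd (str_degen Omega i (x, fs))) (pure x y)"
    if "x \<ge> 1" "l \<in> carrier k" for x fs y l
    using that by (simp add: str_degen_def CG_gen_eq)
  let ?w = "\<lambda>x fs. CG_elt (Suc n) x (snd (str_degen Omega i (x, fs)))"
  show "sdegen CGs n i \<in> mod_hom k (CGm n) (CGm (Suc n))"
    unfolding degen
    by (rule CG_lin_ext(1)[where w = ?w, OF module_CG]) (erule CG_elt_hom, erule (1) v)
  show "sdegen CGs n i (CG_elt n x fs t) = CG_elt (Suc n) x (snd (str_degen Omega i (x, fs))) t"
    if "x \<ge> 1" "fs \<in> NOmega n x" "t \<in> carrier (IP x)" for x fs t
    unfolding degen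
    by (rule CG_lin_ext(2)[where w = ?w, OF module_CG _ _ that]) (erule CG_elt_hom, erule (1) v)
qed

end


section \<open>Forgetting the orderings on the fibres\<close>

context augmented_algebra begin

definition forget_str where
  "forget_str n s t = (if is_path EpiDeltaS (fst s) (snd s) 1
     then CG_elt n (fst s) (map forget_U (snd s)) t else \<zero>\<^bsub>CGm n\<^esub>)"

lemma forget_str_hom:
  assumes "s \<in> strings EpiDeltaS n"
  shows "forget_str n s \<in> mod_hom k (IP (fst s)) (CGm n)"
proof (cases "is_path EpiDeltaS (fst s) (snd s) 1")
  case True
  then have "fst s \<ge> 1" using is_path_source_obj by fastforce
  then show ?thesis using CG_elt_hom True by (simp add: forget_str_def[abs_def])
next
  case False
  then show ?thesis using mod_hom_zero_map[OF module_CG] by (simp add: forget_str_def[abs_def])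
qed

definition forget_chain where
  "forget_chain n = (SOME g. g \<in> mod_hom k (CS.chain_mod n) (CGm n) \<and>
     (\<forall>s\<in>strings EpiDeltaS n. \<forall>y\<in>carrier (IP (fst s)). g (CS.chain_elt n s y) = forget_str n s y))"

lemma forget_chain_works:
  shows forget_chain_hom: "forget_chain n \<in> mod_hom k (CS.chain_mod n) (CGm n)"
    and forget_chain_elt: "\<And>s y. s \<in> strings EpiDeltaS n \<Longrightarrow> y \<in> carrier (IP (fst s)) \<Longrightarrow>
      forget_chain n (CS.chain_elt n s y) = forget_str n s y"
proof -
  have "\<exists>g. g \<in> mod_hom k (CS.chain_mod n) (CGm n) \<and>
     (\<forall>s\<in>strings EpiDeltaS n. \<forall>y\<in>carrier (IP (fst s)). g (CS.chain_elt n s y) = forget_str n s y)"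
    using CS.chain_lift[where h = "forget_str n", OF module_CG forget_str_hom] by blast
  from someI_ex[OF this]
  show "forget_chain n \<in> mod_hom k (CS.chain_mod n) (CGm n)"
    and "\<And>s y. s \<in> strings EpiDeltaS n \<Longrightarrow> y \<in> carrier (IP (fst s)) \<Longrightarrow>
      forget_chain n (CS.chain_elt n s y) = forget_str n s y"
    unfolding forget_chain_def[symmetric] by blast+
qed

lemma forget_U_NOmega:
  assumes "is_path EpiDeltaS x fs 1" "length fs = n"
  shows "map forget_U fs \<in> NOmega n x" "x \<ge> 1"
  using forget_U_path[OF assms(1)] is_path_source_obj[OF assms(1)] assms(2) by (auto simp: mem_paths)

text \<open>For a string that ends in \<open>1\<close>, both sides are the face of the string of surjections; for the last face,
  whether the shortened string still ends in \<open>1\<close> is decided by the source of the removed morphism, in \<open>Epi\<Delta>S\<close>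
  as in \<open>C\<Gamma>\<close>. For other strings both sides vanish, because no face lets them end in \<open>1\<close>.\<close>

lemma forget_chain_face:
  assumes i: "i \<le> Suc n" and c: "c \<in> carrier (CS.chain_mod (Suc n))"
  shows "forget_chain n (sface CS.chain_simp (Suc n) i c) = sface CGs (Suc n) i (forget_chain (Suc n) c)"
proof (rule CS.chain_map_eq[OF module_CG _ _ _ c])
  show "(\<lambda>c. forget_chain n (sface CS.chain_simp (Suc n) i c)) \<in> mod_hom k (CS.chain_mod (Suc n)) (CGm n)"
    by (rule mod_hom_comp[OF forget_chain_hom CS.face_hom[OF i]])
  show "(\<lambda>c. sface CGs (Suc n) i (forget_chain (Suc n) c)) \<in> mod_hom k (CS.chain_mod (Suc n)) (CGm n)"
    by (rule mod_hom_comp[OF CG_face_hom[OF i] forget_chain_hom])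
  fix s y assume s: "s \<in> strings EpiDeltaS (Suc n)" and y: "y \<in> carrier (IP (fst s))"
  obtain x fs z where xf: "s = (x, fs)" "length fs = Suc n" "is_path EpiDeltaS x fs z"
    using s by (cases s) (auto simp: mem_strings)
  then have yx: "y \<in> carrier (IP x)" and ne: "fs \<noteq> []" using y by auto
  obtain F gs where F: "fs = F # gs" using ne by (cases fs) auto
  have FM: "F \<in> Mor EpiDeltaS" using xf F by simp
  note last = is_path_butlast[OF xf(3) ne]
  let ?s' = "str_face EpiDeltaS i s"
  have s': "?s' \<in> strings EpiDeltaS n" by (rule CS.str_face_strings[OF s i])
  have lhs: "forget_chain n (sface CS.chain_simp (Suc n) i (CS.chain_elt (Suc n) s y)) =
      forget_str n ?s' (CS.face_coeff i s y)"
    by (simp only: CS.face_elt[OF i s y]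
        forget_chain_elt[OF s' mod_hom_closed[OF CS.face_coeff_hom[OF s i] y]])
  have rhs: "sface CGs (Suc n) i (forget_chain (Suc n) (CS.chain_elt (Suc n) s y)) =
      sface CGs (Suc n) i (forget_str (Suc n) s y)"
    by (simp only: forget_chain_elt[OF s y])
  show "forget_chain n (sface CS.chain_simp (Suc n) i (CS.chain_elt (Suc n) s y)) =
      sface CGs (Suc n) i (forget_chain (Suc n) (CS.chain_elt (Suc n) s y))"
  proof (cases "z = 1")
    case False
    have "\<not> is_path EpiDeltaS x fs 1" using is_path_unique_target[OF xf(3)] False by blast
    then have r: "sface CGs (Suc n) i (forget_str (Suc n) s y) = \<zero>\<^bsub>CGm n\<^esub>"
      by (simp add: forget_str_def xf(1) mod_hom_zero[OF module_CG module_CG CG_face_hom[OF i]])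
    have "\<not> is_path EpiDeltaS (fst ?s') (snd ?s') 1"
    proof (cases "i = Suc n")
      case True
      have "z \<ge> 1" using is_path_target_obj[OF xf(3)] by simp
      then have "ds_dom (last fs) \<noteq> 1" using EpiDeltaS_cod_le_dom[of "last fs"] last False by auto
      then show ?thesis
        using is_path_unique_target[of EpiDeltaS x "butlast fs" "ds_dom (last fs)" 1] last
        by (auto simp: True xf(1) str_face_last[OF xf(2)])
    next
      case False
      then show ?thesis
        using is_path_unique_target[OF CS.str_face_path_inner[OF xf(3,2), of i]] i \<open>z \<noteq> 1\<close>
        by (auto simp: xf(1))
    qed
    then show ?thesis unfolding lhs rhs r by (simp add: forget_str_def)
  next
    case True
    then have p: "is_path EpiDeltaS x fs 1" using xf(3) by simp
    note N = forget_U_NOmega[OF p xf(2)]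
    have r: "sface CGs (Suc n) i (forget_str (Suc n) s y) = CG_face_map n i x (map forget_U fs) y"
      using p by (simp add: forget_str_def xf(1) CG_face_elt[OF i N(2,1) yx])
    show ?thesis
    proof (cases "i = Suc n")
      case True
      have "om_dom (last (map forget_U fs)) = ds_dom (last fs)" using ne by (simp add: last_map)
      moreover have "is_path EpiDeltaS x (butlast fs) 1 \<longleftrightarrow> ds_dom (last fs) = 1"
        using is_path_unique_target[of EpiDeltaS x "butlast fs" "ds_dom (last fs)" 1] last by auto
      ultimately show ?thesis unfolding lhs rhs r
        by (simp add: True xf(1) forget_str_def CG_face_map_def str_face_last[OF xf(2)]
            CS.face_coeff_def map_butlast)
    next
      case False
      then have p': "is_path EpiDeltaS (fst ?s') (snd ?s') 1"
        using CS.str_face_path_inner[OF p xf(2), of i] i by (simp add: xf(1))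
      have "str_face Omega i (x, map forget_U fs) = map_prod id (map forget_U) ?s'"
        using str_face_forget_U[OF p _ ne, of i] i xf by simp
      moreover have "CS.face_coeff i s y = (if i = 0 then push (hd (map forget_U fs)) y else y)"
        by (simp add: CS.face_coeff_def xf(1) F Bsym_eq_push[OF FM])
      ultimately show ?thesis unfolding lhs rhs r using p' False
        by (simp add: forget_str_def CG_face_map_def)
    qed
  qed
qed

lemma forget_chain_degen:
  assumes i: "i \<le> n" and c: "c \<in> carrier (CS.chain_mod n)"
  shows "forget_chain (Suc n) (sdegen CS.chain_simp n i c) = sdegen CGs n i (forget_chain n c)"
proof (rule CS.chain_map_eq[OF module_CG _ _ _ c])
  show "(\<lambda>c. forget_chain (Suc n) (sdegen CS.chain_simp n i c)) \<in> mod_hom k (CS.chain_mod n) (CGm (Suc n))"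
    by (rule mod_hom_comp[OF forget_chain_hom CS.degen_hom[OF i]])
  show "(\<lambda>c. sdegen CGs n i (forget_chain n c)) \<in> mod_hom k (CS.chain_mod n) (CGm (Suc n))"
    by (rule mod_hom_comp[OF CG_degen_hom[OF i] forget_chain_hom])
  fix s y assume s: "s \<in> strings EpiDeltaS n" and y: "y \<in> carrier (IP (fst s))"
  obtain x fs z where xf: "s = (x, fs)" "length fs = n" "is_path EpiDeltaS x fs z"
    using s by (cases s) (auto simp: mem_strings)
  then have yx: "y \<in> carrier (IP x)" using y by auto
  obtain gs where gs: "str_degen EpiDeltaS i (x, fs) = (x, gs)" "is_path EpiDeltaS x gs z"
    using CS.str_degen_path[OF xf(3)] i xf(2) by blast
  have y': "y \<in> carrier (IP (fst (str_degen EpiDeltaS i s)))" using y CS.degen_strings(2)[OF s i] by simp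
  have lhs: "forget_chain (Suc n) (sdegen CS.chain_simp n i (CS.chain_elt n s y)) =
      forget_str (Suc n) (x, gs) y"
    by (simp only: CS.degen_elt[OF i s y] forget_chain_elt[OF CS.degen_strings(1)[OF s i] y'])
      (simp only: xf(1) gs(1))
  show "forget_chain (Suc n) (sdegen CS.chain_simp n i (CS.chain_elt n s y)) =
      sdegen CGs n i (forget_chain n (CS.chain_elt n s y))"
  proof (cases "z = 1")
    case True
    then have p: "is_path EpiDeltaS x fs 1" "is_path EpiDeltaS x gs 1" using xf gs by auto
    note N = forget_U_NOmega[OF p(1) xf(2)]
    have "snd (str_degen Omega i (x, map forget_U fs)) = map forget_U gs"
      using str_degen_forget_U[of i fs x] gs(1) i xf(2) by simp
    then show ?thesis unfolding lhs forget_chain_elt[OF s y]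
      using p by (simp add: forget_str_def xf(1) CG_degen_elt[OF i N(2,1) yx])
  next
    case False
    have "\<not> is_path EpiDeltaS x fs 1" "\<not> is_path EpiDeltaS x gs 1"
      using is_path_unique_target[OF xf(3)] is_path_unique_target[OF gs(2)] False by blast+
    then show ?thesis unfolding lhs forget_chain_elt[OF s y]
      by (simp add: forget_str_def xf(1) mod_hom_zero[OF module_CG module_CG CG_degen_hom[OF i]])
  qed
qed

lemma forget_chain_surj: "forget_chain n ` carrier (CS.chain_mod n) = carrier (CGm n)"
proof (rule mod_hom_surj_on_generators[OF CS.module_chain_mod module_CG forget_chain_hom generates_CG_elt])
  show "{CG_elt n x fs (pure x y) |x fs y. x \<ge> 1 \<and> fs \<in> NOmega n x \<and> y \<in> tup x}
      \<subseteq> forget_chain n ` carrier (CS.chain_mod n)"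
  proof (intro subsetI, elim CollectE exE conjE)
    fix c x gs y assume c: "c = CG_elt n x gs (pure x y)" and gs: "gs \<in> NOmega n x"
    obtain fs where fs: "is_path EpiDeltaS x fs 1" "map forget_U fs = gs"
      using forget_U_path_surj[of x gs 1] gs unfolding mem_paths by blast
    then have "length fs = n" using gs by (auto simp: mem_paths)
    then have s: "(x, fs) \<in> strings EpiDeltaS n" using path_in_strings[OF fs(1)] by simp
    have y: "pure x y \<in> carrier (IP (fst (x, fs)))" using pure_tens_closed[OF base_cring] by simp
    have "c = forget_chain n (CS.chain_elt n (x, fs) (pure x y))"
      using fs by (simp add: forget_chain_elt[OF s y] forget_str_def c)
    then show "c \<in> forget_chain n ` carrier (CS.chain_mod n)"
      using mod_hom_closed[OF CS.chain_elt_hom[OF s] y] by blast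
  qed
qed

lemma CG_linear_faces: "has_linear_faces k CGs"
  by (simp add: has_linear_faces_def module_CG CG_face_hom)

lemma forget_chain_diff:
  assumes "c \<in> carrier (CS.chain_mod (Suc n))"
  shows "forget_chain n (cdiff (assoc_cx CS.chain_simp) n c) = cdiff (assoc_cx CGs) n (forget_chain (Suc n) c)"
  by (rule assoc_cx_diff_commute[OF CS.chains_linear_faces CG_linear_faces])
    (simp_all add: forget_chain_hom forget_chain_face assms)

text \<open>Every chain of \<open>C\<Gamma>\<close> comes from \<open>CS\<close>, where the square of the differential vanishes.\<close>

lemma CG_chain_cx: "is_chain_cx k (assoc_cx CGs)"
  unfolding is_chain_cx_def
proof (intro conjI allI ballI)
  show "module k (cmod (assoc_cx CGs) n)" for n by (simp add: module_CG)
  show "cdiff (assoc_cx CGs) n \<in> mod_hom k (cmod (assoc_cx CGs) (Suc n)) (cmod (assoc_cx CGs) n)" for n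
    using assoc_cx_diff_hom[OF CG_linear_faces] by simp
  fix n c assume "c \<in> carrier (cmod (assoc_cx CGs) (Suc (Suc n)))"
  then obtain b where b: "b \<in> carrier (CS.chain_mod (Suc (Suc n)))" "c = forget_chain (Suc (Suc n)) b"
    using forget_chain_surj[of "Suc (Suc n)"] by auto
  note D = is_chain_cxD[OF CS.chains_chain_cx]
  have "cdiff (assoc_cx CS.chain_simp) (Suc n) b \<in> carrier (CS.chain_mod (Suc n))"
    using mod_hom_closed[OF D(2)] b(1) by simp
  then have "cdiff (assoc_cx CGs) n (cdiff (assoc_cx CGs) (Suc n) c) =
      forget_chain n (cdiff (assoc_cx CS.chain_simp) n (cdiff (assoc_cx CS.chain_simp) (Suc n) b))"
    by (simp only: b(2) forget_chain_diff[OF b(1), symmetric] forget_chain_diff)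
  also have "\<dots> = \<zero>\<^bsub>CGm n\<^esub>"
    using D(3)[of b n] b(1) mod_hom_zero[OF CS.module_chain_mod module_CG forget_chain_hom] by simp
  finally show "cdiff (assoc_cx CGs) n (cdiff (assoc_cx CGs) (Suc n) c) = \<zero>\<^bsub>cmod (assoc_cx CGs) n\<^esub>" by simp
qed

lemma forget_chain_chain_map: "is_chain_map k (assoc_cx CS.chain_simp) (assoc_cx CGs) forget_chain"
  unfolding is_chain_map_def
  using CS.chains_chain_cx CG_chain_cx forget_chain_hom forget_chain_diff by simp

lemma CS_eq: "Defs.CS k A \<epsilon> = CS.chain_simp"
  by (simp add: CS_def)

lemma CS_degen_subcx: "is_subcx k (assoc_cx CS.chain_simp) (degen_cx k CS.chain_simp)"
  by (rule degen_cx_is_subcx[OF CS.chains_chain_cx]) (simp add: CS.degen_hom)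

lemma CG_degen_subcx: "is_subcx k (assoc_cx CGs) (degen_cx k CGs)"
  by (rule degen_cx_is_subcx[OF CG_chain_cx]) (simp add: CG_degen_hom)

text \<open>The preimage of the degenerate part of \<open>C\<Gamma>\<close> is a subcomplex that contains all degenerate chains.\<close>

lemma forget_chain_degen_cx:
  assumes "c \<in> degen_cx k CS.chain_simp n" shows "forget_chain n c \<in> degen_cx k CGs n"
proof -
  have "degen_cx k CS.chain_simp n \<subseteq> {c \<in> carrier (cmod (assoc_cx CS.chain_simp) n). forget_chain n c \<in> degen_cx k CGs n}"
    unfolding degen_cx_def[of k CS.chain_simp]
  proof (rule subcx_gen_least[OF is_subcx_preimage[OF forget_chain_chain_map CG_degen_subcx]], rule subsetI)
    fix m c assume "c \<in> degenerates CS.chain_simp m"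
    then obtain m' i b where c: "m = Suc m'" "i \<le> m'" "b \<in> carrier (CS.chain_mod m')"
      "c = sdegen CS.chain_simp m' i b" by (auto simp: degenerates_def)
    have "forget_chain m' b \<in> carrier (CGm m')" by (rule mod_hom_closed[OF forget_chain_hom c(3)])
    then have "forget_chain m c \<in> degenerates CGs m"
      using c by (auto simp: forget_chain_degen degenerates_def)
    then have "forget_chain m c \<in> degen_cx k CGs m"
      using subcx_gen_superset[of "degenerates CGs" m k "assoc_cx CGs"] by (auto simp: degen_cx_def)
    moreover have "c \<in> carrier (CS.chain_mod m)" using c mod_hom_closed[OF CS.degen_hom[OF c(2)] c(3)] by simp
    ultimately show "c \<in> {c \<in> carrier (cmod (assoc_cx CS.chain_simp) m). forget_chain m c \<in> degen_cx k CGs m}"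
      by simp
  qed
  then show ?thesis using assms by blast
qed

lemma forget_normalized:
  "\<exists>F. is_chain_map k (NCS k A \<epsilon>) (NCGamma k A \<epsilon>) F \<and>
    (\<forall>n. \<forall>c\<in>carrier (CS.chain_mod n).
      F n (norm_class k (Defs.CS k A \<epsilon>) n c) = norm_class k CGs n (forget_chain n c))"
  using quot_cx_map[OF forget_chain_chain_map CS_degen_subcx CG_degen_subcx forget_chain_degen_cx]
  by (simp add: norm_cx_def norm_class_def CS_eq)

lemma carrier_NCS: "carrier (cmod (NCS k A \<epsilon>) n) = norm_class k (Defs.CS k A \<epsilon>) n ` carrier (CS.chain_mod n)"
  by (simp add: norm_cx_def norm_class_def[abs_def] CS_eq carrier_quot_mod)

lemma carrier_NCGamma: "carrier (cmod (NCGamma k A \<epsilon>) n) = norm_class k CGs n ` carrier (CGm n)"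
  by (simp add: norm_cx_def norm_class_def[abs_def] carrier_quot_mod)

lemma NCS_class_eq: "NCS_class k A \<epsilon> n s y = norm_class k (Defs.CS k A \<epsilon>) n (CS.chain_elt n s y)"
  by (simp add: NCS_class_def)

text \<open>The induced map of normalized complexes vanishes on a subcomplex. It contains the classes of strings that
  do not end in \<open>1\<close>, hence \<open>NCS\<^sup>1\<close>, and what remains on the quotient is \<open>\<Phi>\<close>.\<close>

theorem forget_orderings:
  "\<exists>\<Phi>. (\<forall>n. is_Phi k A \<epsilon> n (\<Phi> n)) \<and>
    is_chain_map k (NCS k A \<epsilon>) (NCGamma k A \<epsilon>) (\<lambda>n. \<Phi> n \<circ> q_map k A \<epsilon> n) \<and>
    (\<forall>n. (\<Phi> n \<circ> q_map k A \<epsilon> n) ` carrier (cmod (NCS k A \<epsilon>) n) = carrier (cmod (NCGamma k A \<epsilon>) n))"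
proof -
  obtain F where F: "is_chain_map k (NCS k A \<epsilon>) (NCGamma k A \<epsilon>) F"
    "\<And>n c. c \<in> carrier (CS.chain_mod n) \<Longrightarrow>
      F n (norm_class k (Defs.CS k A \<epsilon>) n c) = norm_class k CGs n (forget_chain n c)"
    using forget_normalized by blast
  note Fd = is_chain_mapD[OF F(1)]
  note C = is_chain_cxD[OF Fd(1)] and D = is_chain_cxD[OF Fd(2)]
  have class_F: "F n (NCS_class k A \<epsilon> n (x, fs) y) = norm_class k CGs n (forget_str n (x, fs) y)"
    and class_closed: "NCS_class k A \<epsilon> n (x, fs) y \<in> carrier (cmod (NCS k A \<epsilon>) n)"
    if "fs \<in> paths EpiDeltaS n x z" "y \<in> carrier (IP x)" for n x fs z y
  proof -
    have s: "(x, fs) \<in> strings EpiDeltaS n" using that(1) by (auto simp: mem_paths mem_strings)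
    have y: "y \<in> carrier (IP (fst (x, fs)))" using that by simp
    have c: "CS.chain_elt n (x, fs) y \<in> carrier (CS.chain_mod n)"
      by (rule mod_hom_closed[OF CS.chain_elt_hom[OF s] y])
    show "F n (NCS_class k A \<epsilon> n (x, fs) y) = norm_class k CGs n (forget_str n (x, fs) y)"
      by (simp only: NCS_class_eq F(2)[OF c] forget_chain_elt[OF s y])
    show "NCS_class k A \<epsilon> n (x, fs) y \<in> carrier (cmod (NCS k A \<epsilon>) n)"
      using c by (simp add: carrier_NCS NCS_class_eq)
  qed
  let ?G = "\<lambda>n. {NCS_class k A \<epsilon> n (x, fs) y |x fs z y.
        fs \<in> paths EpiDeltaS n x z \<and> z \<noteq> 1 \<and> y \<in> carrier (IP x)}"
  have N1: "is_subcx k (NCS k A \<epsilon>) (NCS1 k A \<epsilon>)"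
    unfolding NCS1_def by (rule subcx_gen_is_subcx[OF Fd(1)]) (use class_closed in blast)
  note N1d = is_subcxD[OF N1]
  have zero_class: "norm_class k CGs n \<zero>\<^bsub>CGm n\<^esub> = \<zero>\<^bsub>cmod (NCGamma k A \<epsilon>) n\<^esub>" for n
    using quot_mod_zero[OF module_CG is_subcxD(1)[OF CG_degen_subcx, simplified]]
    by (simp add: norm_class_def norm_cx_def)
  have kill: "F n Z = \<zero>\<^bsub>cmod (NCGamma k A \<epsilon>) n\<^esub>" if "Z \<in> NCS1 k A \<epsilon> n" for n Z
  proof -
    have "NCS1 k A \<epsilon> n \<subseteq> {Z \<in> carrier (cmod (NCS k A \<epsilon>) n). F n Z \<in> {\<zero>\<^bsub>cmod (NCGamma k A \<epsilon>) n\<^esub>}}"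
      unfolding NCS1_def
    proof (rule subcx_gen_least[OF is_subcx_preimage[OF F(1) is_subcx_zero[OF Fd(2)]]], rule subsetI)
      fix m Z assume "Z \<in> ?G m"
      then obtain x fs z y where Z: "Z = NCS_class k A \<epsilon> m (x, fs) y" "fs \<in> paths EpiDeltaS m x z" "z \<noteq> 1"
        "y \<in> carrier (IP x)" by blast
      have "\<not> is_path EpiDeltaS x fs 1" using Z(2,3) is_path_unique_target[of EpiDeltaS x fs z 1] unfolding mem_paths by blast
      then have "F m Z = \<zero>\<^bsub>cmod (NCGamma k A \<epsilon>) m\<^esub>"
        using class_F[OF Z(2,4)] by (simp add: Z(1) forget_str_def zero_class)
      then show "Z \<in> {Z \<in> carrier (cmod (NCS k A \<epsilon>) m). F m Z \<in> {\<zero>\<^bsub>cmod (NCGamma k A \<epsilon>) m\<^esub>}}"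
        using class_closed[OF Z(2,4)] Z(1) by simp
    qed
    then show ?thesis using that by blast
  qed
  have "\<exists>h \<in> mod_hom k (quot_mod (cmod (NCS k A \<epsilon>) n) (NCS1 k A \<epsilon> n)) (cmod (NCGamma k A \<epsilon>) n).
      \<forall>Z\<in>carrier (cmod (NCS k A \<epsilon>) n). h (NCS1 k A \<epsilon> n +>\<^bsub>cmod (NCS k A \<epsilon>) n\<^esub> Z) = F n Z" for n
    by (rule quot_lift[OF C(1) D(1) N1d(1) Fd(3) kill])
  then obtain h where h: "\<And>n. h n \<in> mod_hom k (cmod (NCSbar k A \<epsilon>) n) (cmod (NCGamma k A \<epsilon>) n)"
    "\<And>n Z. Z \<in> carrier (cmod (NCS k A \<epsilon>) n) \<Longrightarrow> h n (q_map k A \<epsilon> n Z) = F n Z"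
    unfolding NCSbar_def quot_cx_simps q_map_def by metis
  define \<Phi> where "\<Phi> n = restrict (h n) (carrier (cmod (NCSbar k A \<epsilon>) n))" for n
  have Mbar: "module k (cmod (NCSbar k A \<epsilon>) n)" for n
    unfolding NCSbar_def quot_cx_simps by (rule module_quot_mod[OF C(1) N1d(1)])
  have q_closed: "q_map k A \<epsilon> n Z \<in> carrier (cmod (NCSbar k A \<epsilon>) n)" if "Z \<in> carrier (cmod (NCS k A \<epsilon>) n)" for n Z
    using that by (simp add: NCSbar_def q_map_def carrier_quot_mod)
  have \<Phi>q: "(\<Phi> n \<circ> q_map k A \<epsilon> n) Z = F n Z" if "Z \<in> carrier (cmod (NCS k A \<epsilon>) n)" for n Z
    using h(2)[OF that] q_closed[OF that] by (simp add: \<Phi>_def)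
  have "is_Phi k A \<epsilon> n (\<Phi> n)" for n
    unfolding is_Phi_def is_lin_ext_def
  proof (intro conjI ballI)
    show "\<Phi> n \<in> mod_hom k (cmod (NCSbar k A \<epsilon>) n) (cmod (NCGamma k A \<epsilon>) n)"
      unfolding \<Phi>_def by (rule mod_hom_restrict[OF Mbar h(1)])
    show "\<Phi> n \<in> extensional (carrier (cmod (NCSbar k A \<epsilon>) n))" by (simp add: \<Phi>_def)
    fix j assume "j \<in> {(x, fs, y). x \<ge> 1 \<and> fs \<in> paths EpiDeltaS n x 1 \<and> y \<in> tup x}"
    then obtain x fs y where j: "j = (x, fs, y)" "x \<ge> 1" "fs \<in> paths EpiDeltaS n x 1" by auto
    note y = pure_tens_closed[OF base_cring, of "aug_ideal k A \<epsilon>" x y]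
    have "\<Phi> n (q_map k A \<epsilon> n (NCS_class k A \<epsilon> n (x, fs) (pure x y))) =
        norm_class k CGs n (forget_str n (x, fs) (pure x y))"
      using \<Phi>q[OF class_closed[OF j(3) y]] class_F[OF j(3) y] by simp
    also have "forget_str n (x, fs) (pure x y) = CG_gen k A \<epsilon> n x (map forget_U fs) y \<one>\<^bsub>k\<^esub>"
      using j(3) by (simp add: forget_str_def mem_paths CG_gen_one[OF j(2)])
    finally show "\<Phi> n (case j of (x, fs, y) \<Rightarrow> q_map k A \<epsilon> n (NCS_class k A \<epsilon> n (x, fs) (pure x y))) =
        (case j of (x, fs, y) \<Rightarrow> norm_class k CGs n (CG_gen k A \<epsilon> n x (map forget_U fs) y \<one>\<^bsub>k\<^esub>))"
      by (simp add: j(1))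
  qed
  moreover have "is_chain_map k (NCS k A \<epsilon>) (NCGamma k A \<epsilon>) (\<lambda>n. \<Phi> n \<circ> q_map k A \<epsilon> n)"
    by (rule is_chain_map_cong[OF F(1) \<Phi>q])
  moreover have "(\<Phi> n \<circ> q_map k A \<epsilon> n) ` carrier (cmod (NCS k A \<epsilon>) n) = carrier (cmod (NCGamma k A \<epsilon>) n)" for n
  proof -
    have "(\<Phi> n \<circ> q_map k A \<epsilon> n) ` carrier (cmod (NCS k A \<epsilon>) n) = F n ` carrier (cmod (NCS k A \<epsilon>) n)"
      by (rule image_cong[OF refl \<Phi>q])
    also have "\<dots> = norm_class k CGs n ` forget_chain n ` carrier (CS.chain_mod n)"
      unfolding carrier_NCS image_image by (rule image_cong[OF refl F(2)])
    finally show ?thesis by (simp add: forget_chain_surj carrier_NCGamma)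
  qed
  ultimately show ?thesis by blast
qed

end

theorem theorem6p5:
  fixes k :: "'k ring" and A :: "('k,'a) module" and \<epsilon> :: "'a \<Rightarrow> 'k"
  assumes "augmented_algebra k A \<epsilon>"
  shows "\<exists>\<Phi>. (\<forall>n. is_Phi k A \<epsilon> n (\<Phi> n)) \<and>
    is_chain_map k (NCS k A \<epsilon>) (NCGamma k A \<epsilon>) (\<lambda>n. \<Phi> n \<circ> q_map k A \<epsilon> n) \<and>
    (\<forall>n. (\<Phi> n \<circ> q_map k A \<epsilon> n) ` carrier (cmod (NCS k A \<epsilon>) n) = carrier (cmod (NCGamma k A \<epsilon>) n))"
  by (rule augmented_algebra.forget_orderings[OF assms])

end
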